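(* Let $n\ge 1$ be an integer, $s\in(0,1)$, $p\ge 2$, $ps<n<2ps$, $1<q<p$, and $r=p_s^*=\frac{np}{n-ps}$. Let $\Omega\subset\mathbb{R}^n$ be a bounded domain with smooth boundary, let $a,b>0$, $M(t)=a+bt$, and let $f\in L^{\frac{p_s^*}{p_s^*-q}}(\Omega)$ be a (possibly sign-changing) function with $f^+=\max\{f,0\}\not\equiv 0$. Then there exists $\lambda_{00}>0$ such that for all $\lambda\in(0,\lambda_{00})$ the problem $$M(\|u\|_{X_0}^p)(-\Delta)_p^su=\lambda f(x)|u|^{q-2}u+|u|^{p_s^*-2}u,\ \ u\ge0,\ u\not\equiv0\ \text{ in }\Omega,\qquad u=0\ \text{ in }\mathbb{R}^n\setminus\Omega,$$ admits at least one solution.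
   Context: Let $\mathcal C\Omega=\mathbb{R}^n\setminus\Omega$ and $Q=\mathbb{R}^{2n}\setminus(\mathcal C\Omega\times\mathcal C\Omega)$. $X$ is the space of measurable $u:\mathbb{R}^n\to\mathbb{R}$ with $u|_\Omega\in L^p(\Omega)$ and $\frac{u(x)-u(y)}{|x-y|^{n/p+s}}\in L^p(Q)$, with norm $\|u\|_X=\big(\|u\|_{L^p(\Omega)}^p+\int_Q\frac{|u(x)-u(y)|^p}{|x-y|^{n+ps}}dx\,dy\big)^{1/p}$. $X_0$ is the closure of $C_0^\infty(\Omega)$ in $X$, a Banach space normed by $\|u\|_{X_0}=\big(\int_Q\frac{|u(x)-u(y)|^p}{|x-y|^{n+ps}}dx\,dy\big)^{1/p}$; since $u=0$ a.e. in $\mathbb{R}^n\setminus\Omega$, the integral may be taken over $\mathbb{R}^{2n}$. The fractional $p$-Laplacian is $(-\Delta)_p^su(x)=-2\int_{\mathbb{R}^n}\frac{|u(y)-u(x)|^{p-2}(u(y)-u(x))}{|x-y|^{n+ps}}dy$. A solution is a weak solution: $u\in X_0$, $u\ge0$, $u\not\equiv0$, with $$M(\|u\|_{X_0}^p)\int_{\mathbb{R}^{2n}}\frac{|u(x)-u(y)|^{p-2}(u(x)-u(y))(\varphi(x)-\varphi(y))}{|x-y|^{n+ps}}dx\,dy=\lambda\int_\Omega f|u|^{q-2}u\varphi\,dx+\int_\Omega |u|^{p_s^*-2}u\varphi\,dx\quad\forall\varphi\in X_0.$$ *)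

theory Defs
  imports "HOL-Analysis.Analysis"
begin

subsection \<open>Smooth functions and smooth domains\<close>

text \<open>
  On an open set \<open>S\<close> of a finite-dimensional space this is the class \<open>C\<^sup>k\<close>: the recursion goes
  through all directional derivatives.
\<close>

primrec Ck_on :: "nat \<Rightarrow> 'a::euclidean_space set \<Rightarrow> ('a \<Rightarrow> 'b::euclidean_space) \<Rightarrow> bool" where
  "Ck_on 0 S g \<longleftrightarrow> continuous_on S g"
| "Ck_on (Suc k) S g \<longleftrightarrow>
     (\<forall>x\<in>S. g differentiable (at x)) \<and>
     (\<forall>v. Ck_on k S (\<lambda>x. frechet_derivative g (at x) v))"

definition smooth_on :: "'a::euclidean_space set \<Rightarrow> ('a \<Rightarrow> 'b::euclidean_space) \<Rightarrow> bool" where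
  "smooth_on S g \<longleftrightarrow> (\<forall>k. Ck_on k S g)"

text \<open>
  The boundary is smooth if near each of its points a smooth diffeomorphism straightens it,
  carrying \<open>\<Omega>\<close> to one side of a hyperplane and the boundary into that hyperplane.
\<close>

definition smooth_boundary :: "'a::euclidean_space set \<Rightarrow> bool" where
  "smooth_boundary \<Omega> \<longleftrightarrow>
     (\<forall>x0\<in>frontier \<Omega>. \<exists>U V (\<psi> :: 'a \<Rightarrow> 'a) \<psi>' e.
        open U \<and> x0 \<in> U \<and> open V \<and> homeomorphism U V \<psi> \<psi>' \<and>
        smooth_on U \<psi> \<and> smooth_on V \<psi>' \<and> e \<in> Basis \<and>
        \<psi> ` (\<Omega> \<inter> U) = V \<inter> {y. 0 < y \<bullet> e} \<and>
        \<psi> ` (frontier \<Omega> \<inter> U) = V \<inter> {y. y \<bullet> e = 0})"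

definition smooth_bounded_domain :: "'a::euclidean_space set \<Rightarrow> bool" where
  "smooth_bounded_domain \<Omega> \<longleftrightarrow>
     open \<Omega> \<and> connected \<Omega> \<and> \<Omega> \<noteq> {} \<and> bounded \<Omega> \<and> smooth_boundary \<Omega>"

definition test_functions :: "'a::euclidean_space set \<Rightarrow> ('a \<Rightarrow> real) set" where
  "test_functions \<Omega> =
     {\<phi>. smooth_on UNIV \<phi> \<and> compact (closure {x. \<phi> x \<noteq> 0}) \<and> closure {x. \<phi> x \<noteq> 0} \<subseteq> \<Omega>}"

subsection \<open>The spaces\<close>

text \<open>
  Elements of the function spaces are represented by everywhere defined functions that are not
  identified when they agree almost everywhere.
\<close>

definition Lspace_on :: "real \<Rightarrow> 'a::euclidean_space set \<Rightarrow> ('a \<Rightarrow> real) set" where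
  "Lspace_on p A =
     {u. u \<in> borel_measurable (lebesgue_on A) \<and> integrable (lebesgue_on A) (\<lambda>x. \<bar>u x\<bar> powr p)}"

definition Qset :: "'a set \<Rightarrow> ('a \<times> 'a) set" where
  "Qset \<Omega> = UNIV - ((UNIV - \<Omega>) \<times> (UNIV - \<Omega>))"

text \<open>
  On the diagonal, a null set, the quotients below are \<open>0 / 0 = 0\<close>.
\<close>

definition Xspace :: "real \<Rightarrow> real \<Rightarrow> (real ^ 'n) set \<Rightarrow> (real ^ 'n \<Rightarrow> real) set" where
  "Xspace s p \<Omega> =
     {u. u \<in> borel_measurable lebesgue \<and> u \<in> Lspace_on p \<Omega> \<and>
         (\<lambda>(x, y). (u x - u y) / norm (x - y) powr (real CARD('n) / p + s)) \<in> Lspace_on p (Qset \<Omega>)}"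

definition Qenergy :: "real \<Rightarrow> real \<Rightarrow> (real ^ 'n) set \<Rightarrow> (real ^ 'n \<Rightarrow> real) \<Rightarrow> real" where
  "Qenergy s p \<Omega> u =
     (\<integral>(x, y). \<bar>u x - u y\<bar> powr p / norm (x - y) powr (real CARD('n) + p * s)
        \<partial>(lebesgue_on (Qset \<Omega>)))"

definition Xnorm :: "real \<Rightarrow> real \<Rightarrow> (real ^ 'n) set \<Rightarrow> (real ^ 'n \<Rightarrow> real) \<Rightarrow> real" where
  "Xnorm s p \<Omega> u =
     ((\<integral>x. \<bar>u x\<bar> powr p \<partial>(lebesgue_on \<Omega>)) + Qenergy s p \<Omega> u) powr (1 / p)"

definition X0space :: "real \<Rightarrow> real \<Rightarrow> (real ^ 'n) set \<Rightarrow> (real ^ 'n \<Rightarrow> real) set" where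
  "X0space s p \<Omega> =
     {u \<in> Xspace s p \<Omega>. \<forall>\<epsilon>>0. \<exists>\<phi>\<in>test_functions \<Omega>. Xnorm s p \<Omega> (\<lambda>x. u x - \<phi> x) < \<epsilon>}"

definition X0norm :: "real \<Rightarrow> real \<Rightarrow> (real ^ 'n) set \<Rightarrow> (real ^ 'n \<Rightarrow> real) \<Rightarrow> real" where
  "X0norm s p \<Omega> u = Qenergy s p \<Omega> u powr (1 / p)"

subsection \<open>Weak solutions\<close>

definition crit_exponent :: "real \<Rightarrow> real \<Rightarrow> real \<Rightarrow> real" where
  "crit_exponent n s p = n * p / (n - p * s)"

text \<open>
  \<open>spow m t\<close> is \<open>|t|\<^sup>m\<^sup>-\<^sup>2 t\<close>. For \<open>m < 2\<close> the value at \<open>t = 0\<close> is \<open>0\<close>, as it should be.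
\<close>

definition spow :: "real \<Rightarrow> real \<Rightarrow> real" where
  "spow m t = \<bar>t\<bar> powr (m - 2) * t"

definition fracp_form ::
  "real \<Rightarrow> real \<Rightarrow> (real ^ 'n \<Rightarrow> real) \<Rightarrow> (real ^ 'n \<Rightarrow> real) \<Rightarrow> real" where
  "fracp_form s p u \<phi> =
     (\<integral>(x, y). spow p (u x - u y) * (\<phi> x - \<phi> y) / norm (x - y) powr (real CARD('n) + p * s)
        \<partial>lebesgue)"

text \<open>
  The exterior condition \<open>u = 0\<close> outside \<open>\<Omega>\<close> is contained in \<open>u \<in> X0space s p \<Omega>\<close>.
\<close>

definition weak_solution ::
  "real \<Rightarrow> real \<Rightarrow> real \<Rightarrow> (real ^ 'n) set \<Rightarrow> (real \<Rightarrow> real) \<Rightarrow> (real ^ 'n \<Rightarrow> real) \<Rightarrow> real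
     \<Rightarrow> (real ^ 'n \<Rightarrow> real) \<Rightarrow> bool" where
  "weak_solution s p q \<Omega> M f \<mu> u \<longleftrightarrow>
     u \<in> X0space s p \<Omega> \<and>
     (AE x in lebesgue_on \<Omega>. 0 \<le> u x) \<and>
     \<not> (AE x in lebesgue_on \<Omega>. u x = 0) \<and>
     (\<forall>\<phi>\<in>X0space s p \<Omega>.
        M (X0norm s p \<Omega> u powr p) * fracp_form s p u \<phi> =
          \<mu> * (\<integral>x. f x * spow q (u x) * \<phi> x \<partial>(lebesgue_on \<Omega>))
          + (\<integral>x. spow (crit_exponent (real CARD('n)) s p) (u x) * \<phi> x \<partial>(lebesgue_on \<Omega>)))"

end

theory Submission
  imports Defs "HOL-Complex_Analysis.Great_Picard"
begin

text \<open>
  Since \<open>q < p < r\<close>, for small \<open>\<mu>\<close> the energy functional of the problem is positive on a small sphere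
  of the energy space but takes negative values inside it, because \<open>f\<close> is positive somewhere. A minimiser in
  the ball is thus an interior critical point different from \<open>0\<close>, and passing to its absolute value makes
  it nonnegative. The minimiser is found by the direct method although the critical term is not compact:
  by the Brezis--Lieb lemma its defect \<open>\<bar>w\<^sub>k\<bar>\<^sub>r\<^sup>r\<close> is, in a small ball, at most a fraction of the defect
  of the leading term of the energy.
\<close>

section \<open>Pointwise inequalities for powers\<close>

text \<open>The energy of \<open>u\<close> is the p-th power of the L^p norm of a linear difference
  quotient \<open>D u\<close> on \<open>Qset \<Omega>\<close>. Hence Fatou, Brezis--Lieb and
  differentiation under the integral are proved once, for powers of functions on a measure space,
  and serve both for \<open>u\<close> on \<open>\<Omega>\<close> and for \<open>D u\<close>; the
  variational argument sees only these two families. Brezis--Lieb splits \<open>E\<close>, but not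
  the Kirchhoff term \<open>(E u)\<^sup>2\<close>. There the tangent at the energy of the limit is a
  sufficient lower bound, because the defect of \<open>E\<close> is nonnegative. The main obstacle
  is membership in \<open>X0space\<close>, a closure in norm: the limit of a minimising sequence and
  the absolute value of a function in the space are at hand only as almost everywhere limits of
  sequences of bounded energy. Uniform convexity, from Clarkson's inequality for
  \<open>2 \<le> p\<close>, shows that such limits stay in the closure. The Sobolev inequality and
  the compactness are proved for test functions and carried over by density; both rest on comparing
  a function with its means over balls.\<close>

lemma abs_spow: "\<bar>spow m t\<bar> = \<bar>t\<bar> powr (m - 1)"
proof (cases "t = 0")
  case False
  then have "\<bar>t\<bar> powr (m - 2) * \<bar>t\<bar> = \<bar>t\<bar> powr (m - 2 + 1)"
    by (subst powr_add) simp
  then show ?thesis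
    by (simp add: spow_def abs_mult)
qed (simp add: spow_def)

text \<open>Away from 0 the sign is locally constant and the power rule applies. At 0 the difference
  quotient is at most \<open>\<bar>h\<bar> powr (m - 1)\<close> in modulus, which tends to 0 because
  \<open>1 < m\<close>.\<close>

lemma has_real_derivative_abs_powr:
  assumes "1 < m"
  shows "((\<lambda>t. \<bar>t\<bar> powr m) has_real_derivative m * spow m t) (at t)"
proof (cases "t = 0")
  case False
  consider "t > 0" | "t < 0" using False by linarith
  then show ?thesis
  proof cases
    case 1
    have "((\<lambda>t. t powr m) has_real_derivative m * spow m t) (at t)"
      using 1 by (auto intro!: derivative_eq_intros simp: spow_def powr_diff power2_eq_square powr_add field_simps)
    moreover have "eventually (\<lambda>x. x > 0) (nhds t)"
      using eventually_nhds_in_open[of "{0<..}" t] 1 by auto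
    then have "eventually (\<lambda>x. \<bar>x\<bar> powr m = x powr m) (nhds t)"
      by eventually_elim auto
    ultimately show ?thesis
      by (subst DERIV_cong_ev[OF refl _ refl]) auto
  next
    case 2
    have "((\<lambda>t. (- t) powr m) has_real_derivative m * spow m t) (at t)"
      using 2 by (auto intro!: derivative_eq_intros simp: spow_def powr_diff power2_eq_square powr_add field_simps)
    moreover have "eventually (\<lambda>x. x < 0) (nhds t)"
      using eventually_nhds_in_open[of "{..<0}" t] 2 by auto
    then have "eventually (\<lambda>x. \<bar>x\<bar> powr m = (- x) powr m) (nhds t)"
      by eventually_elim auto
    ultimately show ?thesis
      by (subst DERIV_cong_ev[OF refl _ refl]) auto
  qed
next
  case True
  have "((\<lambda>h. \<bar>h\<bar> powr (m - 1)) \<longlongrightarrow> 0) (at 0)"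
    using assms by (auto intro!: tendsto_eq_intros simp: eventually_at_filter)
  then have "((\<lambda>h. (\<bar>0 + h\<bar> powr m - \<bar>0\<bar> powr m) / h) \<longlongrightarrow> 0) (at 0)"
  proof (rule Lim_null_comparison[rotated])
    have "norm ((\<bar>0 + h\<bar> powr m - \<bar>0\<bar> powr m) / h) \<le> \<bar>h\<bar> powr (m - 1)" for h :: real
      using powr_diff[of "\<bar>h\<bar>" m 1] by (cases "h = 0") auto
    then show "\<forall>\<^sub>F h in at 0. norm ((\<bar>0 + h\<bar> powr m - \<bar>0\<bar> powr m) / h) \<le> \<bar>h\<bar> powr (m - 1)"
      by simp
  qed
  then show ?thesis
    unfolding DERIV_def using True by (simp add: spow_def)
qed

text \<open>Mean value theorem along \<open>a + t * h\<close> for \<open>t\<close> between 0 and 1,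
  where the modulus is at most \<open>\<bar>a\<bar> + \<bar>h\<bar>\<close>. The growth bounds
  behind Brezis--Lieb and behind differentiation under the integral both come from here.\<close>

lemma abs_powr_diff_le:
  fixes a h m :: real
  assumes "1 < m"
  shows "\<bar>\<bar>a + h\<bar> powr m - \<bar>a\<bar> powr m\<bar> \<le> m * (\<bar>a\<bar> + \<bar>h\<bar>) powr (m - 1) * \<bar>h\<bar>"
proof -
  let ?g = "\<lambda>t. \<bar>a + t * h\<bar> powr m"
  have d: "(?g has_real_derivative m * spow m (a + t * h) * h) (at t)" for t
    by (rule DERIV_chain2[OF has_real_derivative_abs_powr[OF assms]])
      (auto intro!: derivative_eq_intros)
  obtain z :: real where z: "0 < z" "z < 1" "?g 1 - ?g 0 = (1 - 0) * (m * spow m (a + z * h) * h)"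
    using MVT2[of 0 1 ?g "\<lambda>t. m * spow m (a + t * h) * h"] d by auto
  have "\<bar>a + z * h\<bar> \<le> \<bar>a\<bar> + \<bar>h\<bar>"
    using z abs_triangle_ineq[of a "z * h"] mult_right_mono[of z 1 "\<bar>h\<bar>"] by (simp add: abs_mult)
  then have "\<bar>spow m (a + z * h)\<bar> \<le> (\<bar>a\<bar> + \<bar>h\<bar>) powr (m - 1)"
    unfolding abs_spow using assms by (intro powr_mono2) auto
  then have "m * \<bar>spow m (a + z * h)\<bar> * \<bar>h\<bar> \<le> m * (\<bar>a\<bar> + \<bar>h\<bar>) powr (m - 1) * \<bar>h\<bar>"
    using assms by (intro mult_right_mono mult_left_mono) auto
  then show ?thesis
    using z(3) assms by (simp add: abs_mult)
qed

lemma abs_add_powr_le: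
  fixes a b m :: real
  assumes "0 \<le> m"
  shows "\<bar>a + b\<bar> powr m \<le> 2 powr m * (\<bar>a\<bar> powr m + \<bar>b\<bar> powr m)"
proof -
  have "\<bar>a + b\<bar> powr m \<le> (2 * max \<bar>a\<bar> \<bar>b\<bar>) powr m"
    using assms by (intro powr_mono2) auto
  also have "\<dots> = 2 powr m * max \<bar>a\<bar> \<bar>b\<bar> powr m"
    by (simp add: powr_mult)
  also have "\<dots> \<le> 2 powr m * (\<bar>a\<bar> powr m + \<bar>b\<bar> powr m)"
    by (intro mult_left_mono) (auto simp: max_def)
  finally show ?thesis .
qed

text \<open>Two regimes for the mean value bound: if \<open>b\<close> is small relative to
  \<open>a\<close>, the smallness produces the factor \<open>e\<close>; otherwise \<open>a\<close>
  is at most a multiple of \<open>b\<close> and everything is absorbed by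
  \<open>\<bar>b\<bar> powr m\<close>.\<close>

lemma abs_powr_add_diff_le_eps:
  fixes m e :: real
  assumes "1 < m" "0 < e"
  shows "\<exists>C\<ge>0. \<forall>a b :: real. \<bar>\<bar>a + b\<bar> powr m - \<bar>a\<bar> powr m\<bar> \<le> e * \<bar>a\<bar> powr m + C * \<bar>b\<bar> powr m"
proof -
  \<comment> \<open>The minimum with 1 gives \<open>\<bar>b\<bar> \<le> \<bar>a\<bar>\<close> in the
    first regime, hence the base \<open>2 * \<bar>a\<bar>\<close> and the factor
    \<open>2 powr (m - 1)\<close> that the other entry divides out.\<close>
  define d where "d = min 1 (e / (m * 2 powr (m - 1)))"
  have d: "0 < d" "d \<le> 1" using assms by (auto simp: d_def)
  have "m * 2 powr (m - 1) * d \<le> m * 2 powr (m - 1) * (e / (m * 2 powr (m - 1)))"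
    using assms by (intro mult_left_mono) (auto simp: d_def)
  also have "\<dots> = e" using assms by simp
  finally have de: "m * 2 powr (m - 1) * d \<le> e" .
  define C where "C = m * (1 / d + 1) powr (m - 1)"
  have C: "C \<ge> 0" using assms by (simp add: C_def)
  have m1: "x powr (m - 1) * x = x powr m" if "x \<ge> 0" for x
    using powr_add[of x "m - 1" 1] that by (cases "x = 0") auto
  have "\<bar>\<bar>a + b\<bar> powr m - \<bar>a\<bar> powr m\<bar> \<le> e * \<bar>a\<bar> powr m + C * \<bar>b\<bar> powr m" for a b
  proof (cases "\<bar>b\<bar> \<le> d * \<bar>a\<bar>")
    case True
    then have "\<bar>b\<bar> \<le> \<bar>a\<bar>" using d mult_right_mono[of d 1 "\<bar>a\<bar>"] by linarith
    then have "m * (\<bar>a\<bar> + \<bar>b\<bar>) powr (m - 1) * \<bar>b\<bar> \<le> m * (2 * \<bar>a\<bar>) powr (m - 1) * (d * \<bar>a\<bar>)"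
      using assms True by (intro mult_mono mult_left_mono powr_mono2) auto
    also have "\<dots> = m * 2 powr (m - 1) * d * (\<bar>a\<bar> powr (m - 1) * \<bar>a\<bar>)"
      by (simp add: powr_mult)
    also have "\<dots> \<le> e * \<bar>a\<bar> powr m"
      using de by (subst m1) (auto intro: mult_right_mono)
    finally show ?thesis
      using abs_powr_diff_le[OF assms(1), of a b] C by (smt (verit) mult_nonneg_nonneg powr_ge_zero)
  next
    case False
    then have "\<bar>a\<bar> \<le> \<bar>b\<bar> / d" using d by (simp add: field_simps)
    then have "m * (\<bar>a\<bar> + \<bar>b\<bar>) powr (m - 1) * \<bar>b\<bar> \<le> m * ((1 / d + 1) * \<bar>b\<bar>) powr (m - 1) * \<bar>b\<bar>"
      using assms d by (intro mult_right_mono mult_left_mono powr_mono2) (auto simp: field_simps)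
    also have "\<dots> = C * (\<bar>b\<bar> powr (m - 1) * \<bar>b\<bar>)"
      using d by (simp add: powr_mult C_def)
    also have "\<dots> = C * \<bar>b\<bar> powr m" by (subst m1) auto
    finally show ?thesis
      using abs_powr_diff_le[OF assms(1), of a b] assms by (smt (verit) mult_nonneg_nonneg powr_ge_zero)
  qed
  then show ?thesis using C by blast
qed

text \<open>The inequality between the l^p and l^2 norms of a pair. After normalising by
  \<open>S\<close>, each square divided by \<open>S\<close> lies in [0, 1], where raising to the
  power \<open>p / 2 \<ge> 1\<close> can only decrease it.\<close>

lemma add_powr_le_powr_add_squares:
  fixes x y p :: real
  assumes "2 \<le> p" "0 \<le> x" "0 \<le> y"
  shows "x powr p + y powr p \<le> (x\<^sup>2 + y\<^sup>2) powr (p / 2)"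
proof (cases "x\<^sup>2 + y\<^sup>2 = 0")
  case False
  define S where "S = x\<^sup>2 + y\<^sup>2"
  have S: "S > 0" using False unfolding S_def by (smt (verit) zero_le_power2)
  have sq: "z powr p \<le> S powr (p / 2) * (z\<^sup>2 / S)" if "0 \<le> z" "z\<^sup>2 \<le> S" for z
  proof -
    have "z powr p = (z\<^sup>2) powr (p / 2)"
      using that(1) by (cases "z = 0") (auto simp: powr_powr simp flip: powr_numeral)
    also have "\<dots> = S powr (p / 2) * (z\<^sup>2 / S) powr (p / 2)"
      using S by (subst powr_mult[symmetric]) auto
    also have "\<dots> \<le> S powr (p / 2) * (z\<^sup>2 / S) powr 1"
      using that S assms by (intro mult_left_mono powr_mono') auto
    finally show ?thesis using S by simp
  qed
  have "x powr p + y powr p \<le> S powr (p / 2) * (x\<^sup>2 / S) + S powr (p / 2) * (y\<^sup>2 / S)"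
    using assms by (intro add_mono sq) (auto simp: S_def)
  also have "\<dots> = S powr (p / 2)"
    using S by (simp add: S_def[symmetric] flip: distrib_left add_divide_distrib)
  finally show ?thesis by (simp add: S_def)
qed (use assms in \<open>auto simp: add_nonneg_eq_0_iff\<close>)

lemma convex_powr_midpoint:
  fixes A B c :: real
  assumes "1 \<le> c" "0 \<le> A" "0 \<le> B"
  shows "((A + B) / 2) powr c \<le> (A powr c + B powr c) / 2"
proof -
  have half: "(x / 2) powr c \<le> x powr c / 2" if "0 \<le> x" for x :: real
  proof -
    have "(1 / 2) powr c \<le> (1 / 2 :: real) powr 1"
      using assms by (intro powr_mono') auto
    then have "x powr c * (1 / 2) powr c \<le> x powr c * (1 / 2)"
      by (intro mult_left_mono) auto
    then show ?thesis
      by (simp add: powr_divide)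
  qed
  consider "A = 0" | "B = 0" | "0 < A" "0 < B" using assms by linarith
  then show ?thesis
  proof cases
    case 3
    from convex_onD[OF powr_convex[OF assms(1)], of "1/2" A B] show ?thesis
      using 3 by (simp add: field_simps)
  qed (use assms half in auto)
qed

text \<open>The parallelogram identity settles squares. Passing to exponent p is harmless on the
  left, since l^p norms are below l^2 norms, and on the right, since \<open>t powr (p / 2)\<close>
  is convex. Integrated, this is the uniform convexity of the energy.\<close>

lemma clarkson_pointwise:
  fixes a b p :: real
  assumes "2 \<le> p"
  shows "\<bar>(a + b) / 2\<bar> powr p + \<bar>(a - b) / 2\<bar> powr p \<le> (\<bar>a\<bar> powr p + \<bar>b\<bar> powr p) / 2"
proof -
  have sq: "(z\<^sup>2) powr (p / 2) = \<bar>z\<bar> powr p" for z :: real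
  proof -
    have "z\<^sup>2 = \<bar>z\<bar> powr 2" by simp
    then show ?thesis by (simp only: powr_powr) simp
  qed
  have "\<bar>(a + b) / 2\<bar> powr p + \<bar>(a - b) / 2\<bar> powr p \<le> (\<bar>(a + b) / 2\<bar>\<^sup>2 + \<bar>(a - b) / 2\<bar>\<^sup>2) powr (p / 2)"
    by (rule add_powr_le_powr_add_squares) (use assms in auto)
  also have "\<bar>(a + b) / 2\<bar>\<^sup>2 + \<bar>(a - b) / 2\<bar>\<^sup>2 = (a\<^sup>2 + b\<^sup>2) / 2"
    by (simp add: power2_eq_square field_simps)
  also have "\<dots> powr (p / 2) \<le> ((a\<^sup>2) powr (p / 2) + (b\<^sup>2) powr (p / 2)) / 2"
    by (rule convex_powr_midpoint) (use assms in auto)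
  finally show ?thesis by (simp add: sq)
qed

section \<open>Convergence of integrals of powers\<close>

text \<open>Dominated convergence with a moving majorant that is only bounded in L^1 but enters with
  an arbitrarily small factor. The excess of \<open>\<bar>h k\<bar>\<close> over
  \<open>e * F k\<close> is dominated by \<open>g\<close>, and the rest contributes at most
  \<open>e * K\<close>.\<close>

lemma integral_tendsto_zero_of_almost_dominated:
  fixes h F :: "nat \<Rightarrow> 'a \<Rightarrow> real"
  assumes meas [measurable]: "\<And>k. h k \<in> borel_measurable M"
    and lim: "AE x in M. (\<lambda>k. h k x) \<longlonglongrightarrow> 0"
    and F: "\<And>k. integrable M (F k)" "\<And>k. (\<integral>x. F k x \<partial>M) \<le> K" "\<And>k x. 0 \<le> F k x"
    and dom: "\<And>e. e > 0 \<Longrightarrow> \<exists>g. integrable M g \<and> (\<forall>k x. \<bar>h k x\<bar> \<le> e * F k x + g x)"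
  shows "(\<lambda>k. \<integral>x. \<bar>h k x\<bar> \<partial>M) \<longlonglongrightarrow> 0" and "\<And>k. integrable M (h k)"
proof -
  show int: "integrable M (h k)" for k
  proof -
    obtain g where g: "integrable M g" "\<And>k x. \<bar>h k x\<bar> \<le> 1 * F k x + g x"
      using dom[of 1] by auto
    show ?thesis
    proof (rule Bochner_Integration.integrable_bound[of M "\<lambda>x. F k x + g x"])
      show "AE x in M. norm (h k x) \<le> norm (F k x + g x)"
      proof (rule AE_I2)
        fix x
        show "norm (h k x) \<le> norm (F k x + g x)"
          using g(2)[of k x] by simp
      qed
    qed (use F(1) g(1) in auto)
  qed
  have K: "0 \<le> K"
    using F(2)[of 0] Bochner_Integration.integral_nonneg[of M "F 0"] F(3) by fastforce
  show "(\<lambda>k. \<integral>x. \<bar>h k x\<bar> \<partial>M) \<longlonglongrightarrow> 0"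
  proof (rule LIMSEQ_I)
    fix \<epsilon> :: real assume \<epsilon>: "0 < \<epsilon>"
    \<comment> \<open>Half of \<open>\<epsilon>\<close> is spent on \<open>e * K\<close>;
      \<open>K + 1\<close> in place of \<open>K\<close> covers \<open>K = 0\<close>.\<close>
    define e where "e = \<epsilon> / (2 * (K + 1))"
    have e: "e > 0" "e * K \<le> \<epsilon> / 2" using \<epsilon> K by (auto simp: e_def field_simps)
    obtain g where g: "integrable M g" "\<And>k x. \<bar>h k x\<bar> \<le> e * F k x + g x"
      using dom[OF e(1)] by auto
    define W where "W k x = max 0 (\<bar>h k x\<bar> - e * F k x)" for k x
    have [measurable]: "F k \<in> borel_measurable M" for k using F(1) by auto
    have Wm [measurable]: "W k \<in> borel_measurable M" for k unfolding W_def by measurable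
    have "(\<lambda>k. \<integral>x. W k x \<partial>M) \<longlonglongrightarrow> (\<integral>x. 0 \<partial>M)"
    proof (rule integral_dominated_convergence[of _ M _ "\<lambda>x. \<bar>g x\<bar>"])
      show "AE x in M. (\<lambda>k. W k x) \<longlonglongrightarrow> 0"
        using lim
      proof eventually_elim
        case (elim x)
        have "norm (W k x) \<le> \<bar>h k x\<bar>" for k
          using F(3)[of k x] e by (auto simp: W_def)
        then have "eventually (\<lambda>k. norm (W k x) \<le> \<bar>h k x\<bar>) sequentially"
          by (rule always_eventually[OF allI])
        then show ?case
          by (rule Lim_null_comparison[OF _ tendsto_rabs_zero[OF elim]])
      qed
      show "AE x in M. norm (W k x) \<le> \<bar>g x\<bar>" for k
      proof (rule AE_I2)
        fix x
        show "norm (W k x) \<le> \<bar>g x\<bar>"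
        proof -
          have "\<bar>h k x\<bar> - e * F k x \<le> \<bar>g x\<bar>"
            using g(2)[of k x] by linarith
          then show ?thesis by (simp add: W_def)
        qed
      qed
    qed (use g(1) in auto)
    then obtain k0 where k0: "\<And>k. k \<ge> k0 \<Longrightarrow> \<bar>\<integral>x. W k x \<partial>M\<bar> < \<epsilon> / 2"
      using \<epsilon> LIMSEQ_D[of "\<lambda>k. \<integral>x. W k x \<partial>M" 0 "\<epsilon>/2"] by auto
    have "norm ((\<integral>x. \<bar>h k x\<bar> \<partial>M) - 0) < \<epsilon>" if k: "k \<ge> k0" for k
    proof -
      have Wi: "integrable M (W k)"
        by (rule Bochner_Integration.integrable_bound[of M "\<lambda>x. \<bar>h k x\<bar>"])
          (use int F(3) e in \<open>auto simp: W_def\<close>)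
      have "(\<integral>x. \<bar>h k x\<bar> \<partial>M) \<le> (\<integral>x. W k x + e * F k x \<partial>M)"
        using int Wi F by (intro integral_mono) (auto simp: W_def)
      also have "\<dots> = (\<integral>x. W k x \<partial>M) + e * (\<integral>x. F k x \<partial>M)"
        using Wi F by simp
      also have "\<dots> \<le> (\<integral>x. W k x \<partial>M) + e * K"
        using e F(2) by (intro add_left_mono mult_left_mono) auto
      also have "\<dots> < \<epsilon>"
        using k0[OF k] e(2) by linarith
      finally show ?thesis by (simp add: integral_nonneg_AE)
    qed
    then show "\<exists>k0. \<forall>k\<ge>k0. norm ((\<integral>x. \<bar>h k x\<bar> \<partial>M) - 0) < \<epsilon>" by blast
  qed
qed

section \<open>Fatou bounds and the Brezis--Lieb lemma\<close>

lemma integral_fatou_bound: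
  fixes f :: "nat \<Rightarrow> 'a \<Rightarrow> real"
  assumes f: "\<And>k. integrable M (f k)" "\<And>k x. 0 \<le> f k x" "\<And>k. (\<integral>x. f k x \<partial>M) \<le> K"
    and g [measurable]: "g \<in> borel_measurable M"
    and lim: "AE x in M. (\<lambda>k. f k x) \<longlonglongrightarrow> g x"
  shows "integrable M g" "(\<integral>x. g x \<partial>M) \<le> K"
proof -
  have [measurable]: "f k \<in> borel_measurable M" for k using f(1) by auto
  have K: "0 \<le> K" using f(3)[of 0] Bochner_Integration.integral_nonneg[of M "f 0"] f(2) by fastforce
  have g0: "AE x in M. 0 \<le> g x"
    using lim by eventually_elim (rule LIMSEQ_le_const, auto simp: f)
  have "(\<integral>\<^sup>+x. ennreal (g x) \<partial>M) = (\<integral>\<^sup>+x. liminf (\<lambda>k. ennreal (f k x)) \<partial>M)"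
    using lim
    by (intro nn_integral_cong_AE, eventually_elim)
      (metis lim_imp_Liminf tendsto_ennrealI trivial_limit_sequentially)
  also have "\<dots> \<le> liminf (\<lambda>k. \<integral>\<^sup>+x. ennreal (f k x) \<partial>M)"
    by (rule nn_integral_liminf) measurable
  also have "\<dots> \<le> ennreal K"
    using f by (intro Liminf_le always_eventually) (auto simp: nn_integral_eq_integral ennreal_leI)
  finally have le: "(\<integral>\<^sup>+x. ennreal (g x) \<partial>M) \<le> ennreal K" .
  show int: "integrable M g"
    using le g0 by (intro integrableI_nonneg) (auto simp: top.extremum_strict less_top le_less_trans)
  show "(\<integral>x. g x \<partial>M) \<le> K"
    using le K by (subst (asm) nn_integral_eq_integral[OF int g0]) (simp add: ennreal_le_iff)
qed

lemma integrable_abs_add_powr: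
  fixes u v :: "'a \<Rightarrow> real"
  assumes m: "0 \<le> m" and [measurable]: "u \<in> borel_measurable M" "v \<in> borel_measurable M"
    and i: "integrable M (\<lambda>x. \<bar>u x\<bar> powr m)" "integrable M (\<lambda>x. \<bar>v x\<bar> powr m)"
  shows "integrable M (\<lambda>x. \<bar>u x + v x\<bar> powr m)"
    and "(\<integral>x. \<bar>u x + v x\<bar> powr m \<partial>M) \<le> 2 powr m * ((\<integral>x. \<bar>u x\<bar> powr m \<partial>M) + (\<integral>x. \<bar>v x\<bar> powr m \<partial>M))"
proof -
  have g: "integrable M (\<lambda>x. 2 powr m * (\<bar>u x\<bar> powr m + \<bar>v x\<bar> powr m))"
    using i by simp
  show 1: "integrable M (\<lambda>x. \<bar>u x + v x\<bar> powr m)"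
    by (rule Bochner_Integration.integrable_bound[OF g]) (use abs_add_powr_le[OF m] in auto)
  have "(\<integral>x. \<bar>u x + v x\<bar> powr m \<partial>M) \<le> (\<integral>x. 2 powr m * (\<bar>u x\<bar> powr m + \<bar>v x\<bar> powr m) \<partial>M)"
    by (rule integral_mono[OF 1 g]) (rule abs_add_powr_le[OF m])
  then show "(\<integral>x. \<bar>u x + v x\<bar> powr m \<partial>M) \<le> 2 powr m * ((\<integral>x. \<bar>u x\<bar> powr m \<partial>M) + (\<integral>x. \<bar>v x\<bar> powr m \<partial>M))"
    using i by simp
qed

lemma integrable_abs_diff_powr:
  fixes u v :: "'a \<Rightarrow> real"
  assumes m: "0 \<le> m" and [measurable]: "u \<in> borel_measurable M" "v \<in> borel_measurable M"
    and i: "integrable M (\<lambda>x. \<bar>u x\<bar> powr m)" "integrable M (\<lambda>x. \<bar>v x\<bar> powr m)"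
  shows "integrable M (\<lambda>x. \<bar>u x - v x\<bar> powr m)"
    and "(\<integral>x. \<bar>u x - v x\<bar> powr m \<partial>M) \<le> 2 powr m * ((\<integral>x. \<bar>u x\<bar> powr m \<partial>M) + (\<integral>x. \<bar>v x\<bar> powr m \<partial>M))"
  using integrable_abs_add_powr[of m u M "\<lambda>x. - v x"] assms by auto

lemma abs_powr_tendsto:
  fixes X :: "nat \<Rightarrow> real"
  assumes "0 < m" "X \<longlonglongrightarrow> c"
  shows "(\<lambda>k. \<bar>X k\<bar> powr m) \<longlonglongrightarrow> \<bar>c\<bar> powr m"
  using assms by (intro tendsto_powr2 tendsto_rabs) auto

lemma Lp_fatou_bound:
  fixes u :: "nat \<Rightarrow> 'a \<Rightarrow> real"
  assumes m: "0 < m" and v: "v \<in> borel_measurable M"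
    and "\<And>k. integrable M (\<lambda>x. \<bar>u k x\<bar> powr m)" "\<And>k. (\<integral>x. \<bar>u k x\<bar> powr m \<partial>M) \<le> K"
    and lim: "AE x in M. (\<lambda>k. u k x) \<longlonglongrightarrow> v x"
  shows "integrable M (\<lambda>x. \<bar>v x\<bar> powr m)" "(\<integral>x. \<bar>v x\<bar> powr m \<partial>M) \<le> K"
proof -
  have lim': "AE x in M. (\<lambda>k. \<bar>u k x\<bar> powr m) \<longlonglongrightarrow> \<bar>v x\<bar> powr m"
    using lim by eventually_elim (rule abs_powr_tendsto[OF m])
  show "integrable M (\<lambda>x. \<bar>v x\<bar> powr m)" "(\<integral>x. \<bar>v x\<bar> powr m \<partial>M) \<le> K"
    using integral_fatou_bound[OF assms(3) _ assms(4) _ lim'] v by auto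
qed

text \<open>The combination \<open>h\<close> below tends to 0 pointwise, and the epsilon inequality
  with \<open>a = u k x - v x\<close> and \<open>b = v x\<close> bounds it by a small multiple of
  the L^1-bounded family \<open>\<bar>u k x - v x\<bar> powr m\<close> plus a fixed integrable
  function.\<close>

lemma brezis_lieb:
  fixes u :: "nat \<Rightarrow> 'a \<Rightarrow> real"
  assumes m: "1 < m" and [measurable]: "\<And>k. u k \<in> borel_measurable M" "v \<in> borel_measurable M"
    and int: "\<And>k. integrable M (\<lambda>x. \<bar>u k x\<bar> powr m)" and K: "\<And>k. (\<integral>x. \<bar>u k x\<bar> powr m \<partial>M) \<le> K"
    and lim: "AE x in M. (\<lambda>k. u k x) \<longlonglongrightarrow> v x"
  shows "(\<lambda>k. (\<integral>x. \<bar>u k x\<bar> powr m \<partial>M) - (\<integral>x. \<bar>u k x - v x\<bar> powr m \<partial>M)) \<longlonglongrightarrow> (\<integral>x. \<bar>v x\<bar> powr m \<partial>M)"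
proof -
  have v: "integrable M (\<lambda>x. \<bar>v x\<bar> powr m)" "(\<integral>x. \<bar>v x\<bar> powr m \<partial>M) \<le> K"
    using Lp_fatou_bound[of m v M u K] m int K lim by auto
  have w: "integrable M (\<lambda>x. \<bar>u k x - v x\<bar> powr m)"
     "(\<integral>x. \<bar>u k x - v x\<bar> powr m \<partial>M) \<le> 2 powr m * (K + K)" for k
  proof -
    show "integrable M (\<lambda>x. \<bar>u k x - v x\<bar> powr m)"
      using integrable_abs_diff_powr[of m "u k" M v] m int v by auto
    have "(\<integral>x. \<bar>u k x - v x\<bar> powr m \<partial>M) \<le> 2 powr m * ((\<integral>x. \<bar>u k x\<bar> powr m \<partial>M) + (\<integral>x. \<bar>v x\<bar> powr m \<partial>M))"
      using integrable_abs_diff_powr[of m "u k" M v] m int v by auto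
    also have "\<dots> \<le> 2 powr m * (K + K)"
      using K v by (intro mult_left_mono add_mono) auto
    finally show "(\<integral>x. \<bar>u k x - v x\<bar> powr m \<partial>M) \<le> 2 powr m * (K + K)" .
  qed
  define h where "h k x = \<bar>u k x\<bar> powr m - \<bar>u k x - v x\<bar> powr m - \<bar>v x\<bar> powr m" for k x
  have [measurable]: "h k \<in> borel_measurable M" for k unfolding h_def by measurable
  have limh: "AE x in M. (\<lambda>k. h k x) \<longlonglongrightarrow> 0"
    using lim
  proof eventually_elim
    case (elim x)
    have "(\<lambda>k. u k x - v x) \<longlonglongrightarrow> v x - v x"
      using elim by (intro tendsto_intros)
    then have "(\<lambda>k. h k x) \<longlonglongrightarrow> \<bar>v x\<bar> powr m - \<bar>v x - v x\<bar> powr m - \<bar>v x\<bar> powr m"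
      unfolding h_def using m elim by (intro tendsto_diff abs_powr_tendsto tendsto_const) auto
    then show ?case by simp
  qed
  have "(\<lambda>k. \<integral>x. \<bar>h k x\<bar> \<partial>M) \<longlonglongrightarrow> 0"
  proof (rule integral_tendsto_zero_of_almost_dominated[where F="\<lambda>k x. \<bar>u k x - v x\<bar> powr m"])
    fix e :: real assume "e > 0"
    then obtain C where C: "C \<ge> 0"
      "\<And>a b :: real. \<bar>\<bar>a + b\<bar> powr m - \<bar>a\<bar> powr m\<bar> \<le> e * \<bar>a\<bar> powr m + C * \<bar>b\<bar> powr m"
      using abs_powr_add_diff_le_eps[OF m] by blast
    have "\<bar>h k x\<bar> \<le> e * \<bar>u k x - v x\<bar> powr m + (C + 1) * \<bar>v x\<bar> powr m" for k x
    proof -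
      have "\<bar>h k x\<bar> \<le> \<bar>\<bar>u k x - v x + v x\<bar> powr m - \<bar>u k x - v x\<bar> powr m\<bar> + \<bar>v x\<bar> powr m"
        unfolding h_def diff_add_cancel by (rule order_trans[OF abs_triangle_ineq4]) simp
      also have "\<dots> \<le> e * \<bar>u k x - v x\<bar> powr m + (C + 1) * \<bar>v x\<bar> powr m"
        using C(2)[of "u k x - v x" "v x"] by (simp add: distrib_right)
      finally show ?thesis .
    qed
    then show "\<exists>g. integrable M g \<and> (\<forall>k x. \<bar>h k x\<bar> \<le> e * \<bar>u k x - v x\<bar> powr m + g x)"
      using v by (intro exI[of _ "\<lambda>x. (C + 1) * \<bar>v x\<bar> powr m"]) auto
  qed (use w limh in auto)
  then have "(\<lambda>k. \<integral>x. h k x \<partial>M) \<longlonglongrightarrow> 0"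
    by (rule Lim_null_comparison[rotated]) (auto intro: integral_abs_bound)
  moreover have "(\<integral>x. h k x \<partial>M) = (\<integral>x. \<bar>u k x\<bar> powr m \<partial>M) - (\<integral>x. \<bar>u k x - v x\<bar> powr m \<partial>M) - (\<integral>x. \<bar>v x\<bar> powr m \<partial>M)" for k
    unfolding h_def using int w v by simp
  ultimately show ?thesis
    by (simp add: LIM_zero_iff)
qed

text \<open>Young's inequality for the exponents \<open>r / (r - q)\<close> and
  \<open>r / q\<close>, with constants 1: whichever of \<open>F\<close> and
  \<open>t powr (r - q)\<close> is the larger, eliminating the other one leaves one of the two
  summands.\<close>

lemma young_critical:
  fixes F t q r :: real
  assumes "0 < q" "q < r" "0 \<le> F" "0 \<le> t"
  shows "F * t powr q \<le> F powr (r / (r - q)) + t powr r"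
proof (cases "F \<le> t powr (r - q)")
  case True
  then have "F * t powr q \<le> t powr (r - q) * t powr q" by (intro mult_right_mono) auto
  also have "\<dots> = t powr r" by (simp flip: powr_add)
  finally show ?thesis by (smt (verit) powr_ge_zero)
next
  case False
  then have F: "F > 0" using assms by (smt (verit) powr_ge_zero)
  have "t = (t powr (r - q)) powr (1 / (r - q))"
    using assms by (simp add: powr_powr)
  also have "\<dots> \<le> F powr (1 / (r - q))"
    using False assms by (intro powr_mono2) auto
  finally have "F * t powr q \<le> F powr 1 * (F powr (1 / (r - q))) powr q"
    using assms F by (auto intro!: mult_left_mono powr_mono2)
  also have "\<dots> = F powr (r / (r - q))"
    using assms by (simp only: powr_powr flip: powr_add) (simp add: field_simps)
  finally show ?thesis by (smt (verit) powr_ge_zero)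
qed

text \<open>\<open>young_critical\<close> for \<open>F / d powr q\<close> and \<open>d * t\<close>,
  where \<open>d\<close> is fixed by \<open>d powr r = e\<close>.\<close>

lemma young_critical_eps:
  fixes e q r :: real
  assumes "0 < q" "q < r" "0 < e"
  shows "\<exists>C\<ge>0. \<forall>F t. 0 \<le> F \<longrightarrow> 0 \<le> t \<longrightarrow> F * t powr q \<le> e * t powr r + C * F powr (r / (r - q))"
proof -
  define d where "d = e powr (1 / r)"
  have d: "d > 0" "d powr r = e" using assms by (auto simp: d_def powr_powr)
  define C where "C = (1 / d powr q) powr (r / (r - q))"
  have "F * t powr q \<le> e * t powr r + C * F powr (r / (r - q))" if "0 \<le> F" "0 \<le> t" for F t
  proof -
    have "F * t powr q = (F * (1 / d powr q)) * (d * t) powr q"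
      using d that by (simp add: powr_mult)
    also have "\<dots> \<le> (F * (1 / d powr q)) powr (r / (r - q)) + (d * t) powr r"
      using assms d that by (intro young_critical) auto
    also have "\<dots> = e * t powr r + C * F powr (r / (r - q))"
      using d that by (simp add: powr_mult powr_divide C_def)
    finally show ?thesis .
  qed
  then show ?thesis by (intro exI[of _ C]) (auto simp: C_def)
qed

lemma integrable_subcritical:
  fixes f u :: "'a \<Rightarrow> real"
  assumes q: "0 < q" "q < r" and [measurable]: "f \<in> borel_measurable M" "u \<in> borel_measurable M"
    and i: "integrable M (\<lambda>x. \<bar>f x\<bar> powr (r / (r - q)))" "integrable M (\<lambda>x. \<bar>u x\<bar> powr r)"
  shows "integrable M (\<lambda>x. f x * \<bar>u x\<bar> powr q)"
    and "\<bar>\<integral>x. f x * \<bar>u x\<bar> powr q \<partial>M\<bar> \<le> (\<integral>x. \<bar>f x\<bar> powr (r / (r - q)) \<partial>M) + (\<integral>x. \<bar>u x\<bar> powr r \<partial>M)"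
proof -
  have g: "integrable M (\<lambda>x. \<bar>f x\<bar> powr (r / (r - q)) + \<bar>u x\<bar> powr r)" using i by simp
  have le: "\<bar>f x * \<bar>u x\<bar> powr q\<bar> \<le> \<bar>f x\<bar> powr (r / (r - q)) + \<bar>u x\<bar> powr r" for x
    using young_critical[OF q, of "\<bar>f x\<bar>" "\<bar>u x\<bar>"] by (simp add: abs_mult)
  show 1: "integrable M (\<lambda>x. f x * \<bar>u x\<bar> powr q)"
  proof (rule Bochner_Integration.integrable_bound[OF g])
    show "AE x in M. norm (f x * \<bar>u x\<bar> powr q) \<le> norm (\<bar>f x\<bar> powr (r / (r - q)) + \<bar>u x\<bar> powr r)"
    proof (rule AE_I2)
      fix x
      show "norm (f x * \<bar>u x\<bar> powr q) \<le> norm (\<bar>f x\<bar> powr (r / (r - q)) + \<bar>u x\<bar> powr r)"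
        using le[of x] by simp
    qed
  qed measurable
  have "\<bar>\<integral>x. f x * \<bar>u x\<bar> powr q \<partial>M\<bar> \<le> (\<integral>x. \<bar>f x * \<bar>u x\<bar> powr q\<bar> \<partial>M)"
    by (rule integral_abs_bound)
  also have "\<dots> \<le> (\<integral>x. \<bar>f x\<bar> powr (r / (r - q)) + \<bar>u x\<bar> powr r \<partial>M)"
    by (rule integral_mono) (use 1 g le in auto)
  finally show "\<bar>\<integral>x. f x * \<bar>u x\<bar> powr q \<partial>M\<bar> \<le> (\<integral>x. \<bar>f x\<bar> powr (r / (r - q)) \<partial>M) + (\<integral>x. \<bar>u x\<bar> powr r \<partial>M)"
    using i by simp
qed

text \<open>Because \<open>q < r\<close>, the epsilon form of Young's inequality makes the
  difference almost dominated by the r-th powers, whose integrals stay bounded. So this term, unlike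
  the critical one, passes to almost everywhere limits without a defect.\<close>

lemma subcritical_tendsto:
  fixes u :: "nat \<Rightarrow> 'a \<Rightarrow> real" and f :: "'a \<Rightarrow> real"
  assumes q: "0 < q" "q < r"
    and [measurable]: "f \<in> borel_measurable M" "\<And>k. u k \<in> borel_measurable M" "v \<in> borel_measurable M"
    and f: "integrable M (\<lambda>x. \<bar>f x\<bar> powr (r / (r - q)))"
    and int: "\<And>k. integrable M (\<lambda>x. \<bar>u k x\<bar> powr r)" and K: "\<And>k. (\<integral>x. \<bar>u k x\<bar> powr r \<partial>M) \<le> K"
    and lim: "AE x in M. (\<lambda>k. u k x) \<longlonglongrightarrow> v x"
  shows "(\<lambda>k. \<integral>x. f x * \<bar>u k x\<bar> powr q \<partial>M) \<longlonglongrightarrow> (\<integral>x. f x * \<bar>v x\<bar> powr q \<partial>M)"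
proof -
  have r: "0 < r" using q by simp
  have v: "integrable M (\<lambda>x. \<bar>v x\<bar> powr r)" "(\<integral>x. \<bar>v x\<bar> powr r \<partial>M) \<le> K"
    using Lp_fatou_bound[of r v M u K] r int K lim by auto
  define h where "h k x = f x * \<bar>u k x\<bar> powr q - f x * \<bar>v x\<bar> powr q" for k x
  have [measurable]: "h k \<in> borel_measurable M" for k unfolding h_def by measurable
  have limh: "AE x in M. (\<lambda>k. h k x) \<longlonglongrightarrow> 0"
    using lim
  proof eventually_elim
    case (elim x)
    have "(\<lambda>k. h k x) \<longlonglongrightarrow> f x * \<bar>v x\<bar> powr q - f x * \<bar>v x\<bar> powr q"
      unfolding h_def using q elim by (intro tendsto_diff tendsto_mult abs_powr_tendsto tendsto_const) auto
    then show ?case by simp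
  qed
  have "(\<lambda>k. \<integral>x. \<bar>h k x\<bar> \<partial>M) \<longlonglongrightarrow> 0"
  proof (rule integral_tendsto_zero_of_almost_dominated[where F="\<lambda>k x. \<bar>u k x\<bar> powr r + \<bar>v x\<bar> powr r"])
    show "(\<integral>x. \<bar>u k x\<bar> powr r + \<bar>v x\<bar> powr r \<partial>M) \<le> K + K" for k
    proof -
      have "(\<integral>x. \<bar>u k x\<bar> powr r + \<bar>v x\<bar> powr r \<partial>M) = (\<integral>x. \<bar>u k x\<bar> powr r \<partial>M) + (\<integral>x. \<bar>v x\<bar> powr r \<partial>M)"
        using int v by simp
      then show ?thesis using K[of k] v(2) by linarith
    qed
    fix e :: real assume "e > 0"
    then obtain C where C: "C \<ge> 0"
      "\<And>F t :: real. 0 \<le> F \<Longrightarrow> 0 \<le> t \<Longrightarrow> F * t powr q \<le> e * t powr r + C * F powr (r / (r - q))"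
      using young_critical_eps[OF q] by blast
    have "\<bar>h k x\<bar> \<le> e * (\<bar>u k x\<bar> powr r + \<bar>v x\<bar> powr r) + 2 * C * \<bar>f x\<bar> powr (r / (r - q))" for k x
    proof -
      have "\<bar>h k x\<bar> \<le> \<bar>f x\<bar> * \<bar>u k x\<bar> powr q + \<bar>f x\<bar> * \<bar>v x\<bar> powr q"
        unfolding h_def by (rule order_trans[OF abs_triangle_ineq4]) (simp add: abs_mult)
      then show ?thesis
        using C(2)[of "\<bar>f x\<bar>" "\<bar>u k x\<bar>"] C(2)[of "\<bar>f x\<bar>" "\<bar>v x\<bar>"] by (simp add: algebra_simps)
    qed
    then show "\<exists>g. integrable M g \<and> (\<forall>k x. \<bar>h k x\<bar> \<le> e * (\<bar>u k x\<bar> powr r + \<bar>v x\<bar> powr r) + g x)"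
      using f by (intro exI[of _ "\<lambda>x. 2 * C * \<bar>f x\<bar> powr (r / (r - q))"]) auto
  qed (use int v limh in auto)
  then have "(\<lambda>k. \<integral>x. h k x \<partial>M) \<longlonglongrightarrow> 0"
    by (rule Lim_null_comparison[rotated]) (auto intro: integral_abs_bound)
  moreover have "(\<integral>x. h k x \<partial>M) = (\<integral>x. f x * \<bar>u k x\<bar> powr q \<partial>M) - (\<integral>x. f x * \<bar>v x\<bar> powr q \<partial>M)" for k
    unfolding h_def using integrable_subcritical[OF q, of f M] f int v by simp
  ultimately show ?thesis
    by (simp add: LIM_zero_iff)
qed

text \<open>The weight makes one lemma serve all terms of the functional: \<open>W = 1\<close> for
  the energy and the critical term, \<open>W = f\<close> for the subcritical one. The difference
  quotient is tested along sequences, where the mean value bound gives an integrable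
  majorant.\<close>

lemma has_real_derivative_integral_abs_powr:
  fixes W a b :: "'a \<Rightarrow> real"
  assumes m: "1 < m"
    and [measurable]: "W \<in> borel_measurable M" "a \<in> borel_measurable M" "b \<in> borel_measurable M"
    and i: "integrable M (\<lambda>x. W x * \<bar>a x\<bar> powr m)" "integrable M (\<lambda>x. W x * \<bar>b x\<bar> powr m)"
  shows "((\<lambda>t. \<integral>x. W x * \<bar>a x + t * b x\<bar> powr m \<partial>M) has_real_derivative
           m * (\<integral>x. W x * (spow m (a x) * b x) \<partial>M)) (at 0)"
proof -
  have ig: "integrable M (\<lambda>x. C * (\<bar>W x\<bar> * \<bar>a x\<bar> powr m + T * (\<bar>W x\<bar> * \<bar>b x\<bar> powr m)))" for C T :: real
    using integrable_abs[OF i(1)] integrable_abs[OF i(2)] by (simp add: abs_mult)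
  have it: "integrable M (\<lambda>x. W x * \<bar>a x + t * b x\<bar> powr m)" for t
  proof (rule Bochner_Integration.integrable_bound[OF ig[of "2 powr m" "\<bar>t\<bar> powr m"]])
    show "AE x in M. norm (W x * \<bar>a x + t * b x\<bar> powr m)
        \<le> norm (2 powr m * (\<bar>W x\<bar> * \<bar>a x\<bar> powr m + \<bar>t\<bar> powr m * (\<bar>W x\<bar> * \<bar>b x\<bar> powr m)))"
    proof (rule AE_I2)
      fix x
      have "\<bar>W x\<bar> * \<bar>a x + t * b x\<bar> powr m \<le> \<bar>W x\<bar> * (2 powr m * (\<bar>a x\<bar> powr m + \<bar>t * b x\<bar> powr m))"
        using m by (intro mult_left_mono abs_add_powr_le) auto
      then show "norm (W x * \<bar>a x + t * b x\<bar> powr m)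
        \<le> norm (2 powr m * (\<bar>W x\<bar> * \<bar>a x\<bar> powr m + \<bar>t\<bar> powr m * (\<bar>W x\<bar> * \<bar>b x\<bar> powr m)))"
        by (simp add: abs_mult powr_mult algebra_simps)
    qed
  qed measurable
  have "((\<lambda>t. ((\<integral>x. W x * \<bar>a x + t * b x\<bar> powr m \<partial>M) - (\<integral>x. W x * \<bar>a x + 0 * b x\<bar> powr m \<partial>M)) / t)
      \<longlongrightarrow> m * (\<integral>x. W x * (spow m (a x) * b x) \<partial>M)) (at 0)"
    unfolding tendsto_at_iff_sequentially
  proof (intro allI impI)
    fix X :: "nat \<Rightarrow> real" assume X: "\<forall>i. X i \<in> UNIV - {0}" "X \<longlonglongrightarrow> 0"
    \<comment> \<open>\<open>T\<close> bounds the whole sequence, so that the majorant does not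
      depend on \<open>k\<close>; \<open>1 \<le> T\<close> gives
      \<open>\<bar>b x\<bar> \<le> \<bar>a x\<bar> + T * \<bar>b x\<bar>\<close>, which turns the
      product in the mean value bound into a pure power of exponent \<open>m\<close>.\<close>
    obtain T where T: "\<And>k. \<bar>X k\<bar> \<le> T" "1 \<le> T"
    proof -
      obtain B where "\<And>k. norm (X k) \<le> B"
        using convergent_imp_Bseq[of X] X(2) unfolding convergent_def Bseq_def by blast
      then show ?thesis by (intro that[of "max B 1"]) (auto simp: max_def intro: order_trans)
    qed
    define g where "g k x = (W x * \<bar>a x + X k * b x\<bar> powr m - W x * \<bar>a x\<bar> powr m) / X k" for k x
    have [measurable]: "g k \<in> borel_measurable M" for k unfolding g_def by measurable
    have "(\<lambda>k. \<integral>x. g k x \<partial>M) \<longlonglongrightarrow> (\<integral>x. m * (W x * (spow m (a x) * b x)) \<partial>M)"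
    proof (rule integral_dominated_convergence[OF _ _ ig[of "m * 2 powr m" "T powr m"]])
      show "AE x in M. (\<lambda>k. g k x) \<longlonglongrightarrow> m * (W x * (spow m (a x) * b x))"
      proof (rule AE_I2)
        fix x
        have "((\<lambda>t. W x * \<bar>a x + t * b x\<bar> powr m) has_real_derivative W x * (m * spow m (a x + 0 * b x) * b x)) (at 0)"
          by (intro DERIV_cmult DERIV_chain2[OF has_real_derivative_abs_powr[OF m]])
            (auto intro!: derivative_eq_intros)
        then have "((\<lambda>t. (W x * \<bar>a x + t * b x\<bar> powr m - W x * \<bar>a x\<bar> powr m) / t)
              \<longlongrightarrow> m * (W x * (spow m (a x) * b x))) (at 0)"
          unfolding DERIV_def by (simp add: algebra_simps)
        then show "(\<lambda>k. g k x) \<longlonglongrightarrow> m * (W x * (spow m (a x) * b x))"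
          unfolding g_def using X unfolding tendsto_at_iff_sequentially comp_def by blast
      qed
      show "AE x in M. norm (g k x) \<le> m * 2 powr m * (\<bar>W x\<bar> * \<bar>a x\<bar> powr m + T powr m * (\<bar>W x\<bar> * \<bar>b x\<bar> powr m))" for k
      proof (rule AE_I2)
        fix x
        have X0: "X k \<noteq> 0" using X by auto
        have Tb: "\<bar>X k * b x\<bar> \<le> T * \<bar>b x\<bar>"
          using T by (simp add: abs_mult mult_right_mono)
        have bT: "\<bar>b x\<bar> \<le> \<bar>a x\<bar> + T * \<bar>b x\<bar>"
          using T mult_right_mono[of 1 T "\<bar>b x\<bar>"] by auto
        have "\<bar>\<bar>a x + X k * b x\<bar> powr m - \<bar>a x\<bar> powr m\<bar> \<le> m * (\<bar>a x\<bar> + \<bar>X k * b x\<bar>) powr (m - 1) * \<bar>X k * b x\<bar>"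
          by (rule abs_powr_diff_le[OF m])
        also have "\<dots> \<le> m * (\<bar>a x\<bar> + T * \<bar>b x\<bar>) powr (m - 1) * \<bar>X k * b x\<bar>"
          using Tb m by (intro mult_right_mono mult_left_mono powr_mono2) auto
        also have "\<dots> = \<bar>X k\<bar> * (m * ((\<bar>a x\<bar> + T * \<bar>b x\<bar>) powr (m - 1) * \<bar>b x\<bar>))"
          by (simp add: abs_mult)
        also have "\<dots> \<le> \<bar>X k\<bar> * (m * ((\<bar>a x\<bar> + T * \<bar>b x\<bar>) powr (m - 1) * (\<bar>a x\<bar> + T * \<bar>b x\<bar>)))"
          using bT m by (intro mult_left_mono) auto
        also have "(\<bar>a x\<bar> + T * \<bar>b x\<bar>) powr (m - 1) * (\<bar>a x\<bar> + T * \<bar>b x\<bar>) = \<bar>\<bar>a x\<bar> + T * \<bar>b x\<bar>\<bar> powr m"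
          using T powr_add[of "\<bar>a x\<bar> + T * \<bar>b x\<bar>" "m - 1" 1] by (cases "\<bar>a x\<bar> + T * \<bar>b x\<bar> = 0") auto
        also have "\<dots> \<le> 2 powr m * (\<bar>\<bar>a x\<bar>\<bar> powr m + \<bar>T * \<bar>b x\<bar>\<bar> powr m)"
          using m by (intro abs_add_powr_le) auto
        also have "\<dots> = 2 powr m * (\<bar>a x\<bar> powr m + T powr m * \<bar>b x\<bar> powr m)"
          using T by (simp add: abs_mult powr_mult)
        finally have *: "\<bar>\<bar>a x + X k * b x\<bar> powr m - \<bar>a x\<bar> powr m\<bar>
          \<le> \<bar>X k\<bar> * (m * (2 powr m * (\<bar>a x\<bar> powr m + T powr m * \<bar>b x\<bar> powr m)))"
          using m by (simp add: mult_left_mono)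
        have "norm (g k x) = \<bar>W x\<bar> * (\<bar>\<bar>a x + X k * b x\<bar> powr m - \<bar>a x\<bar> powr m\<bar> / \<bar>X k\<bar>)"
          unfolding g_def by (simp flip: abs_mult right_diff_distrib add: abs_divide)
        also have "\<dots> \<le> \<bar>W x\<bar> * (m * (2 powr m * (\<bar>a x\<bar> powr m + T powr m * \<bar>b x\<bar> powr m)))"
          using * X0 by (intro mult_left_mono) (auto simp: field_simps)
        finally show "norm (g k x) \<le> m * 2 powr m * (\<bar>W x\<bar> * \<bar>a x\<bar> powr m + T powr m * (\<bar>W x\<bar> * \<bar>b x\<bar> powr m))"
          by (simp add: algebra_simps)
      qed
    qed (simp_all add: spow_def)
    moreover have "(\<integral>x. g k x \<partial>M) = ((\<integral>x. W x * \<bar>a x + X k * b x\<bar> powr m \<partial>M) - (\<integral>x. W x * \<bar>a x + 0 * b x\<bar> powr m \<partial>M)) / X k" for k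
      unfolding g_def using it[of "X k"] i(1) by simp
    ultimately show "((\<lambda>t. ((\<integral>x. W x * \<bar>a x + t * b x\<bar> powr m \<partial>M) - (\<integral>x. W x * \<bar>a x + 0 * b x\<bar> powr m \<partial>M)) / t) \<circ> X)
       \<longlonglongrightarrow> m * (\<integral>x. W x * (spow m (a x) * b x) \<partial>M)"
      by (simp add: comp_def)
  qed
  then show ?thesis
    unfolding DERIV_def by simp
qed

text \<open>Along a fast subsequence the p-th powers of the increments \<open>d j\<close>, weighted
  by \<open>w j\<close>, have a sum that is integrable, hence finite almost everywhere. Its terms
  are eventually below 1, which means \<open>\<bar>d j x\<bar> < (1/2) ^ j\<close>, so the
  increments are summable.\<close>

lemma Lp_Cauchy_AE_convergent_subseq:
  fixes u :: "nat \<Rightarrow> 'a \<Rightarrow> real"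
  assumes p: "0 < p" and [measurable]: "\<And>k. u k \<in> borel_measurable M"
    and int: "\<And>k l. integrable M (\<lambda>x. \<bar>u k x - u l x\<bar> powr p)"
    and Cauchy: "\<And>e. e > 0 \<Longrightarrow> \<exists>N. \<forall>k\<ge>N. \<forall>l\<ge>N. (\<integral>x. \<bar>u k x - u l x\<bar> powr p \<partial>M) < e"
  shows "\<exists>\<sigma>. strict_mono \<sigma> \<and> (AE x in M. convergent (\<lambda>k. u (\<sigma> k) x))"
proof -
  define w :: "nat \<Rightarrow> real" where "w j = (2 powr p) ^ j" for j
  have w: "w j > 0" for j by (simp add: w_def)
  have "\<forall>j. \<exists>N. \<forall>k\<ge>N. \<forall>l\<ge>N. (\<integral>x. \<bar>u k x - u l x\<bar> powr p \<partial>M) < (1/2)^j / w j"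
    using Cauchy w by simp
  then obtain N where N: "\<And>j k l. k \<ge> N j \<Longrightarrow> l \<ge> N j \<Longrightarrow> (\<integral>x. \<bar>u k x - u l x\<bar> powr p \<partial>M) < (1/2)^j / w j"
    by metis
  \<comment> \<open>The partial sums of \<open>N\<close> dominate \<open>N j\<close>, and the
    summand \<open>j\<close> makes \<open>\<sigma>\<close> strictly increasing even where
    \<open>N\<close> vanishes.\<close>
  define \<sigma> where "\<sigma> j = (\<Sum>i\<le>j. N i) + j" for j
  have mono: "strict_mono \<sigma>" by (intro strict_mono_Suc_iff[THEN iffD2]) (simp add: \<sigma>_def)
  have \<sigma>N: "\<sigma> j \<ge> N j" for j
    using member_le_sum[of j "{..j}" N] unfolding \<sigma>_def by simp
  have \<sigma>N': "\<sigma> (Suc j) \<ge> N j" for j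
    using \<sigma>N[of j] strict_mono_less_eq[OF mono, of j "Suc j"] by simp
  define d where "d j x = u (\<sigma> (Suc j)) x - u (\<sigma> j) x" for j x
  define G where "G j x = w j * \<bar>d j x\<bar> powr p" for j x
  have Gi: "integrable M (G j)" and Gm: "(\<integral>x. G j x \<partial>M) \<le> (1/2)^j" for j
  proof -
    show "integrable M (G j)" unfolding G_def d_def using int by simp
    have "(\<integral>x. G j x \<partial>M) = w j * (\<integral>x. \<bar>d j x\<bar> powr p \<partial>M)" unfolding G_def by simp
    also have "\<dots> \<le> w j * ((1/2)^j / w j)"
      unfolding d_def using N[OF \<sigma>N' \<sigma>N] w[of j] by (intro mult_left_mono) (auto intro: less_imp_le)
    finally show "(\<integral>x. G j x \<partial>M) \<le> (1/2)^j" using w[of j] by simp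
  qed
  have G0: "0 \<le> G j x" for j x using w[of j] by (simp add: G_def)
  have [measurable]: "G j \<in> borel_measurable M" for j using Gi by auto
  have "(\<integral>\<^sup>+x. (\<Sum>j. ennreal (G j x)) \<partial>M) = (\<Sum>j. \<integral>\<^sup>+x. ennreal (G j x) \<partial>M)"
    by (rule nn_integral_suminf) measurable
  also have "\<dots> \<le> (\<Sum>j. ennreal ((1/2)^j))"
    using Gm Gi G0 by (intro suminf_le) (auto simp: nn_integral_eq_integral ennreal_leI)
  also have "\<dots> < \<infinity>"
    by (subst suminf_ennreal_eq[OF _ geometric_sums]) auto
  finally have "(\<integral>\<^sup>+x. (\<Sum>j. ennreal (G j x)) \<partial>M) \<noteq> \<infinity>" by simp
  then have "AE x in M. (\<Sum>j. ennreal (G j x)) \<noteq> \<infinity>"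
    by (intro nn_integral_PInf_AE) measurable
  then have "AE x in M. convergent (\<lambda>k. u (\<sigma> k) x)"
  proof eventually_elim
    case (elim x)
    then have "summable (\<lambda>j. G j x)"
      using G0 by (intro summable_suminf_not_top) auto
    then have "(\<lambda>j. G j x) \<longlonglongrightarrow> 0" by (rule summable_LIMSEQ_zero)
    then have "eventually (\<lambda>j. G j x < 1) sequentially"
      by (rule order_tendstoD) simp
    then have "eventually (\<lambda>j. norm (d j x) \<le> (1/2) ^ j) sequentially"
    proof eventually_elim
      case (elim j)
      have "(2 ^ j * \<bar>d j x\<bar>) powr p = G j x"
        by (simp add: G_def w_def powr_mult powr_power powr_powr mult.commute flip: powr_realpow)
      then have "(2 ^ j * \<bar>d j x\<bar>) powr p < 1 powr p" using elim by simp
      then have "2 ^ j * \<bar>d j x\<bar> < 1"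
        using p powr_mono2[of p 1 "2 ^ j * \<bar>d j x\<bar>"] by (cases "2 ^ j * \<bar>d j x\<bar> < 1") auto
      then show ?case by (simp add: field_simps power_one_over)
    qed
    then have "summable (\<lambda>j. d j x)"
      by (rule summable_comparison_test_ev) (simp add: summable_geometric)
    then have "convergent (\<lambda>n. \<Sum>j<n. d j x)" by (simp add: summable_iff_convergent)
    moreover have "(\<Sum>j<n. d j x) = u (\<sigma> n) x - u (\<sigma> 0) x" for n
      unfolding d_def by (rule sum_lessThan_telescope)
    ultimately have "convergent (\<lambda>n. u (\<sigma> n) x - u (\<sigma> 0) x)" by simp
    then show ?case
      using convergent_add[OF _ convergent_const[of "u (\<sigma> 0) x"], of "\<lambda>n. u (\<sigma> n) x - u (\<sigma> 0) x"] by simp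
  qed
  with mono show ?thesis by blast
qed

section \<open>Local minimisation of a Kirchhoff energy with critical growth\<close>

text \<open>\<open>D\<close> stands for the difference quotient, and \<open>sobolev\<close> is
  stated for p-th and r-th powers, without roots. In \<open>compact\<close> only almost everywhere
  convergence is asked for, of the functions and of their difference quotients: this is what
  Brezis--Lieb consumes.\<close>

locale critical_kirchhoff =
  fixes M :: "'a measure" and N :: "'b measure"
    and D :: "('a \<Rightarrow> real) \<Rightarrow> 'b \<Rightarrow> real" and V :: "('a \<Rightarrow> real) set"
    and f :: "'a \<Rightarrow> real" and p q r C a b :: real
  assumes p: "2 \<le> p" and q: "1 < q" "q < p" and r: "p < r"
    and a: "0 < a" and b: "0 \<le> b" and C: "0 \<le> C"
    and V_meas: "\<And>u. u \<in> V \<Longrightarrow> u \<in> borel_measurable M"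
    and V_int: "\<And>u. u \<in> V \<Longrightarrow> integrable M (\<lambda>x. \<bar>u x\<bar> powr r)"
    and D_meas: "\<And>u. u \<in> V \<Longrightarrow> D u \<in> borel_measurable N"
    and D_int: "\<And>u. u \<in> V \<Longrightarrow> integrable N (\<lambda>z. \<bar>D u z\<bar> powr p)"
    and V_lin: "\<And>u v c. u \<in> V \<Longrightarrow> v \<in> V \<Longrightarrow> (\<lambda>x. u x + c * v x) \<in> V"
    and D_lin: "\<And>u v c z. D (\<lambda>x. u x + c * v x) z = D u z + c * D v z"
    and V_abs: "\<And>u. u \<in> V \<Longrightarrow> (\<lambda>x. \<bar>u x\<bar>) \<in> V"
    and D_abs: "\<And>u z. \<bar>D (\<lambda>x. \<bar>u x\<bar>) z\<bar> \<le> \<bar>D u z\<bar>"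
    and sobolev: "\<And>u. u \<in> V \<Longrightarrow>
      (\<integral>x. \<bar>u x\<bar> powr r \<partial>M) \<le> C * (\<integral>z. \<bar>D u z\<bar> powr p \<partial>N) powr (r / p)"
    and compact: "\<And>(u :: nat \<Rightarrow> 'a \<Rightarrow> real) K. (\<And>k. u k \<in> V) \<Longrightarrow> (\<And>k. (\<integral>z. \<bar>D (u k) z\<bar> powr p \<partial>N) \<le> K) \<Longrightarrow>
      \<exists>\<sigma> v. strict_mono \<sigma> \<and> v \<in> V \<and> (AE x in M. (\<lambda>k. u (\<sigma> k) x) \<longlonglongrightarrow> v x) \<and>
        (AE z in N. (\<lambda>k. D (u (\<sigma> k)) z) \<longlonglongrightarrow> D v z)"
    and f_meas: "f \<in> borel_measurable M"
    and f_int: "integrable M (\<lambda>x. \<bar>f x\<bar> powr (r / (r - q)))"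
    and f_pos: "\<exists>\<phi>\<in>V. 0 < (\<integral>x. f x * \<bar>\<phi> x\<bar> powr q \<partial>M)"
begin

section \<open>Energy estimates on a small ball\<close>

definition E :: "('a \<Rightarrow> real) \<Rightarrow> real" where "E u = (\<integral>z. \<bar>D u z\<bar> powr p \<partial>N)"
definition R :: "('a \<Rightarrow> real) \<Rightarrow> real" where "R u = (\<integral>x. \<bar>u x\<bar> powr r \<partial>M)"
definition P :: "('a \<Rightarrow> real) \<Rightarrow> real" where "P u = (\<integral>x. f x * \<bar>u x\<bar> powr q \<partial>M)"
definition F :: real where "F = (\<integral>x. \<bar>f x\<bar> powr (r / (r - q)) \<partial>M)"
text \<open>The first two terms are \<open>1 / p\<close> times the primitive
  \<open>a * t + b * t\<^sup>2 / 2\<close> of \<open>M\<close> at \<open>t = E u\<close>. The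
  factors \<open>1 / p\<close>, \<open>1 / q\<close>, \<open>1 / r\<close> are cancelled by
  differentiation, so that critical points of \<open>J \<mu>\<close> satisfy the weak
  equation.\<close>

definition J :: "real \<Rightarrow> ('a \<Rightarrow> real) \<Rightarrow> real" where
  "J \<mu> u = a / p * E u + b / (2 * p) * (E u)\<^sup>2 - \<mu> / q * P u - R u / r"

text \<open>On the ball \<open>E u \<le> 2 * e0\<close> half of the leading term of \<open>J\<close> absorbs the critical term.\<close>

definition e0 :: real where "e0 = (a * r / (2 * p * (C + 1))) powr (1 / (r / p - 1)) / 2"

lemma E_nonneg: "0 \<le> E u" and R_nonneg: "0 \<le> R u" and F_nonneg: "0 \<le> F"
  by (simp_all add: E_def R_def F_def integral_nonneg_AE)

lemma e0_pos: "0 < e0"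
  using a r p C by (simp add: e0_def)

text \<open>By the Sobolev inequality \<open>R u\<close> is at most
  \<open>C * E u powr (r / p - 1)\<close> times \<open>E u\<close>, with a positive exponent, so the
  factor is small on small balls. \<open>e0\<close> makes it at most \<open>a * r / (2 * p)\<close>;
  the \<open>C + 1\<close> in its definition avoids a division by 0.\<close>

lemma R_le_E: assumes "u \<in> V" "E u \<le> 2 * e0" shows "R u / r \<le> a / (2 * p) * E u"
proof (cases "E u = 0")
  case True
  then have "R u \<le> 0" using sobolev[OF assms(1)] by (simp add: E_def R_def)
  then show ?thesis using True R_nonneg[of u] by simp
next
  case False
  then have E: "E u > 0" using E_nonneg[of u] by simp
  have "R u \<le> C * E u powr (r / p)"
    using sobolev[OF assms(1)] by (simp add: E_def R_def)
  also have "E u powr (r / p) = E u powr (r / p - 1) * E u"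
    using E by (simp add: powr_diff)
  also have "E u powr (r / p - 1) \<le> (2 * e0) powr (r / p - 1)"
    using E assms r p by (intro powr_mono2) auto
  also have "(2 * e0) powr (r / p - 1) = a * r / (2 * p * (C + 1))"
    using a r p C by (simp add: e0_def powr_powr)
  finally have "R u \<le> C * (a * r / (2 * p * (C + 1)) * E u)"
    using C E by (simp add: mult_left_mono mult_right_mono)
  also have "\<dots> = C / (C + 1) * (a * r / (2 * p) * E u)"
    using C p by (simp add: field_simps)
  also have "\<dots> \<le> 1 * (a * r / (2 * p) * E u)"
    using C a r p E by (intro mult_right_mono) auto
  finally show ?thesis
    using r p by (simp add: field_simps)
qed

text \<open>Young's inequality followed by the Sobolev inequality. A bound that is uniform on the
  ball is enough, since \<open>P\<close> enters \<open>J\<close> with the small factor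
  \<open>\<mu>\<close>.\<close>

lemma abs_P_le: assumes "u \<in> V" "E u \<le> e0" shows "\<bar>P u\<bar> \<le> F + C * e0 powr (r / p)"
proof -
  have "\<bar>P u\<bar> \<le> F + R u"
    using integrable_subcritical(2)[of q r f M u] q r f_meas f_int V_meas V_int assms
    by (simp add: P_def F_def R_def)
  also have "R u \<le> C * E u powr (r / p)"
    using sobolev[OF assms(1)] by (simp add: E_def R_def)
  also have "\<dots> \<le> C * e0 powr (r / p)"
    using C assms r p E_nonneg by (intro mult_left_mono powr_mono2) auto
  finally show ?thesis by simp
qed

lemma J_nonneg_of_AE_zero: "0 < \<mu> \<Longrightarrow> AE x in M. u x = 0 \<Longrightarrow> 0 \<le> J \<mu> u"
proof -
  assume \<mu>: "0 < \<mu>" and ae: "AE x in M. u x = 0"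
  have "P u = 0"
    unfolding P_def using ae by (intro integral_eq_zero_AE) auto
  moreover have "R u = 0"
    unfolding R_def using ae by (intro integral_eq_zero_AE) auto
  ultimately show "0 \<le> J \<mu> u"
    using E_nonneg[of u] a b p by (simp add: J_def)
qed

text \<open>The functions \<open>w k\<close> carry the mass that is lost in the limit.
  \<open>S k\<close> below is \<open>J \<mu> (u k)\<close> without this part and with the square
  replaced by its tangent at \<open>E v\<close>. It tends to \<open>J \<mu> v\<close> and is
  eventually at most \<open>J \<mu> (u k)\<close>, because \<open>E (w k)\<close> outweighs
  \<open>R (w k)\<close>.\<close>

lemma J_lower_semicontinuous:
  assumes \<mu>: "0 < \<mu>" and u: "\<And>k. u k \<in> V" and Eu: "\<And>k. E (u k) \<le> e0" and v: "v \<in> V"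
    and lim: "AE x in M. (\<lambda>k. u k x) \<longlonglongrightarrow> v x" "AE z in N. (\<lambda>k. D (u k) z) \<longlonglongrightarrow> D v z"
    and J: "(\<lambda>k. J \<mu> (u k)) \<longlonglongrightarrow> m"
  shows "J \<mu> v \<le> m" "E v \<le> e0"
proof -
  show Ev: "E v \<le> e0"
    using Lp_fatou_bound(2)[of p "D v" N "\<lambda>k. D (u k)" e0] p D_meas D_int u v Eu lim
    by (simp add: E_def)
  define w where "w k = (\<lambda>x. u k x + (-1) * v x)" for k
  have w: "w k \<in> V" for k unfolding w_def by (intro V_lin u v)
  have Ru: "R (u k) \<le> C * e0 powr (r / p)" for k
  proof -
    have "R (u k) \<le> C * E (u k) powr (r / p)"
      using sobolev[OF u] by (simp add: E_def R_def)
    also have "\<dots> \<le> C * e0 powr (r / p)"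
      using C Eu r p E_nonneg by (intro mult_left_mono powr_mono2) auto
    finally show ?thesis .
  qed
  have Dw: "D (w k) z = D (u k) z - D v z" for k z
    unfolding w_def D_lin by simp
  have 1: "(\<lambda>k. E (u k) - E (w k)) \<longlonglongrightarrow> E v"
    using brezis_lieb[of p "\<lambda>k. D (u k)" N "D v" e0] p u v D_meas D_int Eu lim
    by (simp add: E_def Dw)
  have 2: "(\<lambda>k. R (u k) - R (w k)) \<longlonglongrightarrow> R v"
    using brezis_lieb[of r u M v "C * e0 powr (r / p)"] p r u v V_meas V_int Ru lim
    by (simp add: R_def w_def)
  have 3: "(\<lambda>k. P (u k)) \<longlonglongrightarrow> P v"
    using subcritical_tendsto[of q r f M u v "C * e0 powr (r / p)"] q r u v V_meas V_int f_meas f_int Ru lim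
    by (simp add: P_def R_def)
  define d where "d k = E (u k) - E (w k) - E v" for k
  define d' where "d' k = R (u k) - R (w k) - R v" for k
  have d: "d \<longlonglongrightarrow> 0" and d': "d' \<longlonglongrightarrow> 0"
    unfolding d_def d'_def using 1 2 by (auto intro: LIM_zero)
  define S where "S k = a / p * (E v + d k) + b / (2 * p) * ((E v)\<^sup>2 + 2 * E v * d k)
      - \<mu> / q * P (u k) - (R v + d' k) / r" for k
  have "S \<longlonglongrightarrow> a / p * (E v + 0) + b / (2 * p) * ((E v)\<^sup>2 + 2 * E v * 0) - \<mu> / q * P v - (R v + 0) / r"
    unfolding S_def using r p q by (intro tendsto_intros d d' 3) auto
  then have S: "S \<longlonglongrightarrow> J \<mu> v" by (simp add: J_def)
  \<comment> \<open>The defect \<open>E (w k)\<close> need not lie below \<open>e0\<close>: it is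
    \<open>E (u k) - E v - d k\<close> with an error \<open>d k\<close> tending to 0. The slack of
    one more \<open>e0\<close> places it in the range of \<open>R_le_E\<close>.\<close>
  have "eventually (\<lambda>k. - e0 < d k) sequentially"
    using order_tendstoD(1)[OF d, of "- e0"] e0_pos by simp
  then have "eventually (\<lambda>k. S k \<le> J \<mu> (u k)) sequentially"
  proof eventually_elim
    case (elim k)
    have "E (w k) = E (u k) - E v - d k" by (simp add: d_def)
    also have "\<dots> \<le> 2 * e0" using elim Eu[of k] E_nonneg[of v] by simp
    finally have Rw: "R (w k) / r \<le> a / (2 * p) * E (w k)" by (rule R_le_E[OF w])
    have "a / (2 * p) * E (w k) \<le> a / p * E (w k)"
      using a p E_nonneg by (intro mult_right_mono) (auto simp: field_simps)
    with Rw have Rw': "R (w k) / r \<le> a / p * E (w k)" by simp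
    \<comment> \<open>The tangent inequality for the square; \<open>d k \<le> E (u k) - E v\<close>
      holds since \<open>E (w k)\<close> is nonnegative.\<close>
    have "(E v)\<^sup>2 + 2 * E v * d k \<le> (E v)\<^sup>2 + 2 * E v * (E (u k) - E v)"
      using E_nonneg[of v] E_nonneg[of "w k"] by (intro add_left_mono mult_left_mono) (auto simp: d_def)
    also have "\<dots> \<le> (E (u k))\<^sup>2"
      using zero_le_power2[of "E (u k) - E v"] by (simp add: power2_eq_square algebra_simps)
    finally have "b / (2 * p) * ((E v)\<^sup>2 + 2 * E v * d k) \<le> b / (2 * p) * (E (u k))\<^sup>2"
      using b p by (intro mult_left_mono) auto
    moreover have "E (u k) = E v + d k + E (w k)" "R (u k) = R v + d' k + R (w k)"
      by (simp_all add: d_def d'_def)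
    ultimately show "S k \<le> J \<mu> (u k)"
      using Rw' unfolding S_def J_def by (simp add: distrib_left add_divide_distrib)
  qed
  with S J show "J \<mu> v \<le> m"
    by (intro LIMSEQ_le[of S]) (auto simp: eventually_sequentially)
qed

text \<open>On the sphere \<open>E u = e0\<close> the leading term leaves
  \<open>a / (2 * p) * e0\<close>, while the subcritical term is at most \<open>\<mu> / q\<close>
  times the bound of \<open>abs_P_le\<close>. Below \<open>mu0\<close> the former wins; the summand
  1 keeps the denominator positive.\<close>

definition mu0 :: real where "mu0 = q * (a * e0 / (2 * p)) / (F + C * e0 powr (r / p) + 1)"

lemma mu0_pos: "0 < mu0"
  using F_nonneg C a p q e0_pos
  by (auto simp: mu0_def intro!: divide_pos_pos mult_pos_pos add_nonneg_pos add_nonneg_nonneg mult_nonneg_nonneg)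

lemma J_lower_bound:
  assumes \<mu>: "0 < \<mu>" and u: "u \<in> V" "E u \<le> e0"
  shows "a / (2 * p) * E u - \<mu> / q * (F + C * e0 powr (r / p)) \<le> J \<mu> u"
proof -
  have "R u / r \<le> a / (2 * p) * E u" using u e0_pos by (intro R_le_E) auto
  moreover have "\<mu> / q * P u \<le> \<mu> / q * (F + C * e0 powr (r / p))"
    using abs_P_le[OF u] \<mu> q by (intro mult_left_mono) auto
  moreover have "0 \<le> b / (2 * p) * (E u)\<^sup>2" using b p by simp
  moreover have "a / p * E u = a / (2 * p) * E u + a / (2 * p) * E u"
    using p by (simp add: field_simps)
  ultimately show ?thesis unfolding J_def by linarith
qed

lemma J_pos_on_sphere:
  assumes \<mu>: "0 < \<mu>" "\<mu> < mu0" and u: "u \<in> V" "E u = e0"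
  shows "0 < J \<mu> u"
proof -
  let ?K = "F + C * e0 powr (r / p)"
  have K: "0 \<le> ?K" using F_nonneg C by simp
  have "\<mu> * (?K + 1) < q * (a * e0 / (2 * p))"
    using \<mu> K pos_less_divide_eq[of "?K + 1" \<mu> "q * (a * e0 / (2 * p))"] unfolding mu0_def by simp
  then have "\<mu> * ?K < q * (a * e0 / (2 * p))"
    using \<mu> by (simp add: distrib_left)
  then have "\<mu> / q * ?K < a / (2 * p) * e0"
    using q by (simp add: field_simps)
  moreover have "a / (2 * p) * e0 - \<mu> / q * ?K \<le> J \<mu> u"
    using J_lower_bound[OF \<mu>(1) u(1)] u(2) by simp
  ultimately show ?thesis by linarith
qed

section \<open>Existence of a nonnegative minimiser inside the ball\<close>

lemma V_scale: "u \<in> V \<Longrightarrow> (\<lambda>x. c * u x) \<in> V"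
  using V_lin[of u u "c - 1"] by (simp add: algebra_simps)

lemma D_scale: "D (\<lambda>x. c * u x) z = c * D u z"
  using D_lin[of u "c - 1" u z] by (simp add: algebra_simps)

text \<open>On the ray through \<open>\<phi>\<close> the subcritical term is of order
  \<open>t powr q\<close> and beats the energy terms, of orders \<open>t powr p\<close> and
  \<open>t powr (2 * p)\<close>, as \<open>t\<close> tends to 0. Division by \<open>t powr q\<close>
  turns this into a limit; the critical term has the favourable sign and is dropped.\<close>

lemma ex_J_neg:
  assumes \<mu>: "0 < \<mu>"
  shows "\<exists>u\<in>V. E u \<le> e0 \<and> J \<mu> u < 0"
proof -
  obtain \<phi> where \<phi>: "\<phi> \<in> V" "0 < P \<phi>" using f_pos by (auto simp: P_def)
  have "((\<lambda>t. a / p * (t powr (p - q) * E \<phi>) + b / (2 * p) * (t powr (2 * p - q) * (E \<phi>)\<^sup>2))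
      \<longlongrightarrow> a / p * (0 * E \<phi>) + b / (2 * p) * (0 * (E \<phi>)\<^sup>2)) (at_right 0)"
    using p q by (intro tendsto_intros tendsto_zero_powrI[where b="p - q"] tendsto_zero_powrI[where b="2 * p - q"])
      (auto simp: eventually_at_right_less intro: eventually_mono[OF eventually_at_right_less])
  then have "eventually (\<lambda>t. a / p * (t powr (p - q) * E \<phi>) + b / (2 * p) * (t powr (2 * p - q) * (E \<phi>)\<^sup>2)
      < \<mu> / q * P \<phi>) (at_right 0)"
    using \<mu> \<phi> q by (intro order_tendstoD(2)) auto
  moreover have "((\<lambda>t. t powr p * E \<phi>) \<longlongrightarrow> 0 * E \<phi>) (at_right 0)"
    using p by (intro tendsto_intros tendsto_zero_powrI[where b=p])
      (auto intro: eventually_mono[OF eventually_at_right_less])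
  then have "eventually (\<lambda>t. t powr p * E \<phi> < e0) (at_right 0)"
    using e0_pos by (intro order_tendstoD(2)) auto
  moreover have "eventually (\<lambda>t. t > (0::real)) (at_right 0)"
    by (rule eventually_at_right_less)
  ultimately have "eventually (\<lambda>t. t > 0 \<and> t powr p * E \<phi> < e0 \<and>
      a / p * (t powr (p - q) * E \<phi>) + b / (2 * p) * (t powr (2 * p - q) * (E \<phi>)\<^sup>2) < \<mu> / q * P \<phi>) (at_right 0)"
    by eventually_elim auto
  then obtain t :: real where t: "t > 0" "t powr p * E \<phi> < e0"
      "a / p * (t powr (p - q) * E \<phi>) + b / (2 * p) * (t powr (2 * p - q) * (E \<phi>)\<^sup>2) < \<mu> / q * P \<phi>"
    using eventually_happens'[OF trivial_limit_at_right_real] by blast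
  let ?u = "\<lambda>x. t * \<phi> x"
  have E: "E ?u = t powr p * E \<phi>"
    using t unfolding E_def D_scale by (simp add: abs_mult powr_mult)
  have P: "P ?u = t powr q * P \<phi>"
    using t unfolding P_def by (simp add: abs_mult powr_mult mult.left_commute[of _ "t powr q"])
  have le: "J \<mu> ?u \<le> a / p * E ?u + b / (2 * p) * (E ?u)\<^sup>2 - \<mu> / q * P ?u"
    using R_nonneg[of ?u] r p by (simp add: J_def)
  have tp: "t powr p = t powr q * t powr (p - q)"
    by (simp flip: powr_add)
  have tp2: "(t powr p)\<^sup>2 = t powr q * t powr (2 * p - q)"
    by (simp add: power2_eq_square flip: powr_add)
  note le
  also have "a / p * E ?u + b / (2 * p) * (E ?u)\<^sup>2 - \<mu> / q * P ?u =
      t powr q * (a / p * (t powr (p - q) * E \<phi>) + b / (2 * p) * (t powr (2 * p - q) * (E \<phi>)\<^sup>2) - \<mu> / q * P \<phi>)"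
    unfolding E P power_mult_distrib tp2 by (subst tp) (simp add: algebra_simps)
  also have "\<dots> < 0" using t by (intro mult_pos_neg) auto
  finally show ?thesis
    using V_scale[OF \<phi>(1), of t] t E by (intro bexI[of _ ?u]) auto
qed

lemma ex_minimizer:
  assumes \<mu>: "0 < \<mu>"
  shows "\<exists>v\<in>V. E v \<le> e0 \<and> (\<forall>u\<in>V. E u \<le> e0 \<longrightarrow> J \<mu> v \<le> J \<mu> u)"
proof -
  let ?B = "{u \<in> V. E u \<le> e0}"
  define m where "m = Inf (J \<mu> ` ?B)"
  have ne: "?B \<noteq> {}" using ex_J_neg[OF \<mu>] by auto
  have bdd: "bdd_below (J \<mu> ` ?B)"
  proof (rule bdd_belowI2)
    fix u assume "u \<in> ?B"
    then have "a / (2 * p) * E u - \<mu> / q * (F + C * e0 powr (r / p)) \<le> J \<mu> u"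
      by (intro J_lower_bound \<mu>) auto
    moreover have "0 \<le> a / (2 * p) * E u" using a p E_nonneg by simp
    ultimately show "- (\<mu> / q * (F + C * e0 powr (r / p))) \<le> J \<mu> u" by linarith
  qed
  have "\<exists>u\<in>?B. J \<mu> u < m + 1 / real (Suc k)" for k
    using cInf_lessD[of "J \<mu> ` ?B" "m + 1 / real (Suc k)"] ne unfolding m_def by auto
  then obtain u where u: "\<And>k. u k \<in> V" "\<And>k. E (u k) \<le> e0" "\<And>k. J \<mu> (u k) < m + 1 / real (Suc k)"
    by (metis (mono_tags, lifting) mem_Collect_eq)
  have m: "m \<le> J \<mu> w" if "w \<in> V" "E w \<le> e0" for w
    unfolding m_def using bdd that by (intro cInf_lower) auto
  obtain \<sigma> v where \<sigma>: "strict_mono \<sigma>" "v \<in> V" "AE x in M. (\<lambda>k. u (\<sigma> k) x) \<longlonglongrightarrow> v x"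
        "AE z in N. (\<lambda>k. D (u (\<sigma> k)) z) \<longlonglongrightarrow> D v z"
    using compact[of u e0] u unfolding E_def by blast
  have "(\<lambda>k. J \<mu> (u k)) \<longlonglongrightarrow> m"
  proof (rule tendsto_sandwich[of "\<lambda>_. m" _ _ "\<lambda>k. m + 1 / real (Suc k)"])
    show "(\<lambda>k. m + 1 / real (Suc k)) \<longlonglongrightarrow> m"
      using tendsto_add[OF tendsto_const LIMSEQ_inverse_real_of_nat, of m] by (simp add: inverse_eq_divide)
  qed (use u m in \<open>auto intro!: always_eventually less_imp_le\<close>)
  then have "(\<lambda>k. J \<mu> (u (\<sigma> k))) \<longlonglongrightarrow> m"
    using LIMSEQ_subseq_LIMSEQ[OF _ \<sigma>(1)] by (auto simp: comp_def)
  from J_lower_semicontinuous[OF \<mu> u(1) u(2) \<sigma>(2-4) this]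
  have "J \<mu> v \<le> m" "E v \<le> e0" .
  then show ?thesis using m \<sigma>(2) by (intro bexI[of _ v]) (auto intro: order_trans)
qed

text \<open>Passing to the absolute value leaves \<open>P\<close> and \<open>R\<close> unchanged and
  does not increase \<open>E\<close>. The negative minimum excludes both the sphere, where
  \<open>J\<close> is positive, and functions that vanish almost everywhere.\<close>

lemma ex_nonneg_minimizer:
  assumes \<mu>: "0 < \<mu>" "\<mu> < mu0"
  shows "\<exists>v\<in>V. (\<forall>x. 0 \<le> v x) \<and> \<not> (AE x in M. v x = 0) \<and> E v < e0 \<and>
    (\<forall>u\<in>V. E u \<le> e0 \<longrightarrow> J \<mu> v \<le> J \<mu> u)"
proof -
  obtain w where w: "w \<in> V" "E w \<le> e0" "\<And>u. u \<in> V \<Longrightarrow> E u \<le> e0 \<Longrightarrow> J \<mu> w \<le> J \<mu> u"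
    using ex_minimizer[OF \<mu>(1)] by auto
  define v where "v = (\<lambda>x. \<bar>w x\<bar>)"
  have v: "v \<in> V" unfolding v_def by (rule V_abs[OF w(1)])
  have Evw: "E v \<le> E w"
    unfolding E_def using D_int[OF v] D_int[OF w(1)] D_abs p
    by (intro integral_mono powr_mono2) (auto simp: v_def)
  have Ev: "E v \<le> e0" using Evw w(2) by simp
  have "(E v)\<^sup>2 \<le> (E w)\<^sup>2" using Evw E_nonneg by (intro power_mono) auto
  then have "J \<mu> v \<le> J \<mu> w"
    using Evw a b p q \<mu> unfolding J_def
    by (intro diff_mono add_mono mult_left_mono) (auto simp: P_def R_def v_def)
  then have min: "J \<mu> v \<le> J \<mu> u" if "u \<in> V" "E u \<le> e0" for u
    using w(3)[OF that] by simp
  have neg: "J \<mu> v < 0"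
    using ex_J_neg[OF \<mu>(1)] min by force
  have "E v \<noteq> e0"
    using J_pos_on_sphere[OF \<mu> v] neg by auto
  moreover have "\<not> (AE x in M. v x = 0)"
    using J_nonneg_of_AE_zero[OF \<mu>(1), of v] neg by auto
  ultimately show ?thesis
    using v Ev min by (intro bexI[of _ v]) (auto simp: v_def)
qed

theorem ex_nonneg_critical_point:
  "\<exists>\<mu>0>0. \<forall>\<mu>. 0 < \<mu> \<and> \<mu> < \<mu>0 \<longrightarrow>
    (\<exists>u\<in>V. (\<forall>x. 0 \<le> u x) \<and> \<not> (AE x in M. u x = 0) \<and>
      (\<forall>\<phi>\<in>V. (a + b * (\<integral>z. \<bar>D u z\<bar> powr p \<partial>N)) * (\<integral>z. spow p (D u z) * D \<phi> z \<partial>N) =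
        \<mu> * (\<integral>x. f x * (spow q (u x) * \<phi> x) \<partial>M) + (\<integral>x. spow r (u x) * \<phi> x \<partial>M)))"
proof (intro exI[of _ mu0] conjI allI impI mu0_pos)
  fix \<mu> assume "0 < \<mu> \<and> \<mu> < mu0"
  then obtain u where u: "u \<in> V" "\<And>x. 0 \<le> u x" "\<not> (AE x in M. u x = 0)" "E u < e0"
      "\<And>v. v \<in> V \<Longrightarrow> E v \<le> e0 \<Longrightarrow> J \<mu> u \<le> J \<mu> v"
    using ex_nonneg_minimizer[of \<mu>] by auto
  have "(a + b * E u) * (\<integral>z. spow p (D u z) * D \<phi> z \<partial>N) =
      \<mu> * (\<integral>x. f x * (spow q (u x) * \<phi> x) \<partial>M) + (\<integral>x. spow r (u x) * \<phi> x \<partial>M)" if \<phi>: "\<phi> \<in> V" for \<phi>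
  proof -
    define g where "g t = (\<lambda>x. u x + t * \<phi> x)" for t
    have g: "g t \<in> V" for t unfolding g_def by (intro V_lin u \<phi>)
    have g0: "g 0 = u" by (simp add: g_def)
    let ?E' = "\<integral>z. spow p (D u z) * D \<phi> z \<partial>N"
    have dE: "((\<lambda>t. E (g t)) has_real_derivative p * ?E') (at 0)"
      using has_real_derivative_integral_abs_powr[of p "\<lambda>_. 1" N "D u" "D \<phi>"] p u \<phi> D_meas D_int
      by (simp add: E_def g_def D_lin)
    have dP: "((\<lambda>t. P (g t)) has_real_derivative q * (\<integral>x. f x * (spow q (u x) * \<phi> x) \<partial>M)) (at 0)"
      unfolding P_def g_def
      by (intro has_real_derivative_integral_abs_powr integrable_subcritical(1)[of q r])
        (use q r f_meas f_int V_meas[OF u(1)] V_meas[OF \<phi>] V_int[OF u(1)] V_int[OF \<phi>] in simp_all)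
    have dR: "((\<lambda>t. R (g t)) has_real_derivative r * (\<integral>x. spow r (u x) * \<phi> x \<partial>M)) (at 0)"
      using has_real_derivative_integral_abs_powr[of r "\<lambda>_. 1" M u \<phi>] p r
        V_meas[OF u(1)] V_meas[OF \<phi>] V_int[OF u(1)] V_int[OF \<phi>]
      by (simp add: R_def g_def)
    have dJ: "((\<lambda>t. J \<mu> (g t)) has_real_derivative
        (a + b * E u) * ?E' - \<mu> * (\<integral>x. f x * (spow q (u x) * \<phi> x) \<partial>M) - (\<integral>x. spow r (u x) * \<phi> x \<partial>M)) (at 0)"
      unfolding J_def
      by (rule derivative_eq_intros dE dP dR refl | use p q r in \<open>simp add: g0 field_simps\<close>)+
    \<comment> \<open>Minimality is known only in the ball. As \<open>E u < e0\<close> and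
      \<open>E\<close> is continuous along the line, \<open>g t\<close> stays in the ball for small
      \<open>t\<close>, so \<open>t = 0\<close> is a local minimum in both directions.\<close>
    have "isCont (\<lambda>t. E (g t)) 0" using dE by (rule DERIV_isCont)
    then have "eventually (\<lambda>t. E (g t) < e0) (at 0)"
      using u(4) by (auto simp: isCont_def g0 intro: order_tendstoD(2))
    then obtain d where d: "d > 0" "\<And>t. t \<noteq> 0 \<Longrightarrow> \<bar>t\<bar> < d \<Longrightarrow> E (g t) < e0"
      by (auto simp: eventually_at dist_real_def)
    have "\<forall>t. \<bar>0 - t\<bar> < d \<longrightarrow> J \<mu> (g 0) \<le> J \<mu> (g t)"
      using d g g0 u(5) by (metis abs_minus_commute diff_zero less_imp_le order_refl)
    from DERIV_local_min[OF dJ d(1) this] show ?thesis by simp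
  qed
  then show "\<exists>u\<in>V. (\<forall>x. 0 \<le> u x) \<and> \<not> (AE x in M. u x = 0) \<and>
      (\<forall>\<phi>\<in>V. (a + b * (\<integral>z. \<bar>D u z\<bar> powr p \<partial>N)) * (\<integral>z. spow p (D u z) * D \<phi> z \<partial>N) =
        \<mu> * (\<integral>x. f x * (spow q (u x) * \<phi> x) \<partial>M) + (\<integral>x. spow r (u x) * \<phi> x \<partial>M))"
    using u unfolding E_def by (intro bexI[of _ u]) auto
qed

end

section \<open>Smooth functions and test functions\<close>

lemma Ck_on_Suc_imp: "Ck_on (Suc k) S g \<Longrightarrow> Ck_on k S g"
proof (induction k arbitrary: g)
  case 0
  then show ?case
    by (auto intro!: continuous_at_imp_continuous_on differentiable_imp_continuous_within)
next
  case (Suc k)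
  then show ?case by (metis Ck_on.simps(2))
qed

lemma Ck_on_SucI:
  assumes "\<And>x. (g has_derivative g' x) (at x)" "\<And>v. Ck_on k UNIV (\<lambda>x. g' x v)"
  shows "Ck_on (Suc k) UNIV g"
proof -
  have "frechet_derivative g (at x) = g' x" for x
    using frechet_derivative_at[OF assms(1)] by simp
  then show ?thesis
    using assms by (auto simp: differentiable_def)
qed

lemma Ck_on_SucD:
  assumes "Ck_on (Suc k) UNIV g"
  shows "(g has_derivative frechet_derivative g (at x)) (at x)" "Ck_on k UNIV (\<lambda>x. frechet_derivative g (at x) v)"
  using assms by (auto simp flip: frechet_derivative_works)

lemma smooth_onD:
  assumes "smooth_on UNIV g"
  shows "(g has_derivative frechet_derivative g (at x)) (at x)"
    and "smooth_on UNIV (\<lambda>x. frechet_derivative g (at x) v)"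
    and "continuous_on UNIV g"
proof -
  have C: "Ck_on k UNIV g" for k using assms by (simp add: smooth_on_def)
  show "(g has_derivative frechet_derivative g (at x)) (at x)" by (rule Ck_on_SucD(1)[OF C])
  show "smooth_on UNIV (\<lambda>x. frechet_derivative g (at x) v)"
    unfolding smooth_on_def using Ck_on_SucD(2)[OF C] by blast
  show "continuous_on UNIV g" using C[of 0] by simp
qed

lemma Ck_on_const: "Ck_on k UNIV (\<lambda>x. c)"
proof (induction k arbitrary: c)
  case (Suc k)
  then show ?case by (intro Ck_on_SucI[where g'="\<lambda>x v. 0"] has_derivative_const)
qed auto

lemma Ck_on_bounded_linear:
  assumes "bounded_linear L" shows "Ck_on k UNIV L"
proof (cases k)
  case 0
  then show ?thesis using linear_continuous_on[OF assms] by simp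
next
  case (Suc j)
  show ?thesis unfolding Suc
    by (intro Ck_on_SucI[where g'="\<lambda>x. L"] bounded_linear_imp_has_derivative assms Ck_on_const)
qed

lemma Ck_on_add: "Ck_on k UNIV g \<Longrightarrow> Ck_on k UNIV h \<Longrightarrow> Ck_on k UNIV (\<lambda>x. g x + h x)"
proof (induction k arbitrary: g h)
  case 0
  then show ?case by (auto intro: continuous_intros)
next
  case (Suc k)
  show ?case
    by (rule Ck_on_SucI[OF has_derivative_add[OF Ck_on_SucD(1)[OF Suc.prems(1)] Ck_on_SucD(1)[OF Suc.prems(2)]]])
      (intro Suc.IH Ck_on_SucD(2) Suc.prems)
qed

lemma Ck_on_mult:
  fixes g h :: "'a::euclidean_space \<Rightarrow> real"
  shows "Ck_on k UNIV g \<Longrightarrow> Ck_on k UNIV h \<Longrightarrow> Ck_on k UNIV (\<lambda>x. g x * h x)"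
proof (induction k arbitrary: g h)
  case 0
  then show ?case by (auto intro: continuous_intros)
next
  case (Suc k)
  show ?case
    by (rule Ck_on_SucI[OF has_derivative_mult[OF Ck_on_SucD(1)[OF Suc.prems(1)] Ck_on_SucD(1)[OF Suc.prems(2)]]])
      (intro Ck_on_add Suc.IH Ck_on_SucD(2) Suc.prems Ck_on_Suc_imp)
qed

lemma smooth_on_const: "smooth_on UNIV (\<lambda>x. c)"
  and smooth_on_bounded_linear: "bounded_linear L \<Longrightarrow> smooth_on UNIV L"
  and smooth_on_add: "smooth_on UNIV g \<Longrightarrow> smooth_on UNIV h \<Longrightarrow> smooth_on UNIV (\<lambda>x. g x + h x)"
  by (simp_all add: smooth_on_def Ck_on_const Ck_on_bounded_linear Ck_on_add)

lemma smooth_on_mult: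
  fixes g h :: "'a::euclidean_space \<Rightarrow> real"
  shows "smooth_on UNIV g \<Longrightarrow> smooth_on UNIV h \<Longrightarrow> smooth_on UNIV (\<lambda>x. g x * h x)"
  by (simp add: smooth_on_def Ck_on_mult)

lemma smooth_on_sum:
  assumes "\<And>i. i \<in> I \<Longrightarrow> smooth_on UNIV (g i)"
  shows "smooth_on UNIV (\<lambda>x. \<Sum>i\<in>I. g i x)"
  using assms by (induction I rule: infinite_finite_induct) (auto intro: smooth_on_add smooth_on_const)

text \<open>The chain rule produces \<open>F' (w x)\<close> times a smooth factor; since
  \<open>F'\<close> is again in \<open>H\<close>, the induction on the order runs through the family
  instead of through higher derivatives of one \<open>F\<close>. Powers and bump functions form such
  families.\<close>

lemma smooth_on_compose_family:
  fixes w :: "'a::euclidean_space \<Rightarrow> real" and H :: "(real \<Rightarrow> real) set"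
  assumes H: "\<And>F. F \<in> H \<Longrightarrow> \<exists>F'\<in>H. \<forall>t\<in>I. (F has_real_derivative F' t) (at t)"
    and w: "smooth_on UNIV w" "\<And>x. w x \<in> I" and F: "F \<in> H"
  shows "smooth_on UNIV (\<lambda>x. F (w x))"
proof -
  have "Ck_on k UNIV (\<lambda>x. F (w x))" for k
    using F
  proof (induction k arbitrary: F)
    case 0
    obtain F' where "\<forall>t\<in>I. (F has_real_derivative F' t) (at t)" using H[OF 0] by auto
    then have "continuous_on I F" by (intro DERIV_continuous_on) (auto intro: DERIV_subset)
    then have "continuous_on UNIV (\<lambda>x. F (w x))"
      by (rule continuous_on_compose2[OF _ smooth_onD(3)[OF w(1)]]) (use w(2) in auto)
    then show ?case by simp
  next
    case (Suc k)
    obtain F' where F': "F' \<in> H" "\<forall>t\<in>I. (F has_real_derivative F' t) (at t)" using H[OF Suc.prems] by auto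
    have "((\<lambda>x. F (w x)) has_derivative (\<lambda>v. frechet_derivative w (at x) v * F' (w x))) (at x)" for x
      using has_derivative_compose[OF smooth_onD(1)[OF w(1)], of F "(*) (F' (w x))" x] F'(2) w(2)
      by (simp add: has_field_derivative_def mult.commute)
    then show ?case
    proof (rule Ck_on_SucI)
      fix v
      show "Ck_on k UNIV (\<lambda>x. frechet_derivative w (at x) v * F' (w x))"
        using smooth_onD(2)[OF w(1), of v] by (intro Ck_on_mult Suc.IH F') (simp add: smooth_on_def)
    qed
  qed
  then show ?thesis by (simp add: smooth_on_def)
qed

lemma smooth_on_powr:
  fixes w :: "'a::euclidean_space \<Rightarrow> real"
  assumes "smooth_on UNIV w" "\<And>x. 0 < w x"
  shows "smooth_on UNIV (\<lambda>x. w x powr c)"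
proof -
  let ?H = "{\<lambda>t. d * t powr c |d c :: real. True}"
  have 1: "\<exists>F'\<in>?H. \<forall>t\<in>{0<..}. (F has_real_derivative F' t) (at t)" if F: "F \<in> ?H" for F
  proof -
    obtain d c where F: "F = (\<lambda>t. d * t powr c)" using F by blast
    have "(F has_real_derivative (d * c) * t powr (c - 1)) (at t)" if "t > 0" for t
      unfolding F using that by (auto intro!: derivative_eq_intros)
    then show ?thesis
      by (intro bexI[of _ "\<lambda>t. (d * c) * t powr (c - 1)"]) auto
  qed
  have 2: "(\<lambda>t. 1 * t powr c) \<in> ?H" by blast
  have 3: "w x \<in> {0<..}" for x using assms(2) by simp
  show ?thesis
    using smooth_on_compose_family[OF 1 assms(1) 3 2] by simp
qed

text \<open>The classical flat function \<open>exp (- (1 / t))\<close>, with a polynomial in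
  \<open>1 / t\<close> as factor so that the family is closed under differentiation.
  \<open>P = 1\<close> gives the cutoff itself.\<close>

definition bump_fun :: "real poly \<Rightarrow> real \<Rightarrow> real" where
  "bump_fun P t = (if t \<le> 0 then 0 else poly P (1 / t) * exp (- (1 / t)))"

lemma bump_fun_one: "bump_fun 1 t = (if t \<le> 0 then 0 else exp (- (1 / t)))"
  by (simp add: bump_fun_def)

lemma poly_times_exp_tendsto_0: "((\<lambda>x. poly P x * exp (- x)) \<longlongrightarrow> (0::real)) at_top"
proof -
  have "((\<lambda>x. \<Sum>i\<le>degree P. coeff P i * (x ^ i / exp x)) \<longlongrightarrow> (\<Sum>i\<le>degree P. coeff P i * 0)) at_top"
    by (intro tendsto_intros tendsto_power_div_exp_0)
  moreover have "(\<Sum>i\<le>degree P. coeff P i * (x ^ i / exp x)) = poly P x * exp (- x)" for x :: real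
    by (simp add: poly_altdef sum_distrib_right exp_minus divide_inverse mult.assoc)
  ultimately show ?thesis by simp
qed

lemma bump_fun_tendsto_0: "(bump_fun P \<longlongrightarrow> 0) (at 0)"
proof -
  have "((\<lambda>t. poly P (inverse t) * exp (- inverse t)) \<longlongrightarrow> 0) (at_right 0)"
    by (rule filterlim_compose[OF poly_times_exp_tendsto_0 filterlim_inverse_at_top_right])
  then have "(bump_fun P \<longlongrightarrow> 0) (at_right 0)"
    by (rule Lim_transform_eventually)
      (auto simp: eventually_at_right_less bump_fun_def inverse_eq_divide intro: eventually_mono[OF eventually_at_right_less])
  moreover have "(bump_fun P \<longlongrightarrow> 0) (at_left 0)"
    by (rule Lim_transform_eventually[OF tendsto_const])
      (auto simp: bump_fun_def eventually_at_filter)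
  ultimately show ?thesis by (simp add: filterlim_split_at)
qed

text \<open>In the variable \<open>x = 1 / t\<close> the derivative of P(x) exp(-x) with respect to
  t is x^2 (P - P')(x) exp(-x), and \<open>[:0, 0, 1:]\<close> is the factor x^2. At 0 the
  difference quotient is the bump function of \<open>[:0, 1:] * P\<close>, which tends to 0.\<close>

lemma bump_fun_has_derivative:
  "(bump_fun P has_real_derivative bump_fun ([:0, 0, 1:] * (P - pderiv P)) t) (at t)"
proof -
  consider "t < 0" | "t = 0" | "t > 0" by linarith
  then show ?thesis
  proof cases
    case 1
    have "eventually (\<lambda>x. x < 0) (nhds t)"
      using eventually_nhds_in_open[of "{..<0}" t] 1 by auto
    then have "eventually (\<lambda>x. bump_fun P x = 0) (nhds t)"
      by eventually_elim (auto simp: bump_fun_def)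
    then show ?thesis
      using 1 by (subst DERIV_cong_ev[OF refl _ refl]) (auto simp: bump_fun_def)
  next
    case 2
    have "(bump_fun P (0 + h) - bump_fun P 0) / h = bump_fun ([:0, 1:] * P) h" for h
      by (auto simp: bump_fun_def)
    then have "(\<lambda>h. (bump_fun P (0 + h) - bump_fun P 0) / h) \<midarrow>0\<rightarrow> 0"
      using bump_fun_tendsto_0[of "[:0, 1:] * P"] by simp
    moreover have "bump_fun Q 0 = 0" for Q by (simp add: bump_fun_def)
    ultimately show ?thesis
      unfolding DERIV_def 2 by simp
  next
    case 3
    have "((\<lambda>t. poly P (1 / t) * exp (- (1 / t))) has_real_derivative
        poly ([:0, 0, 1:] * (P - pderiv P)) (1 / t) * exp (- (1 / t))) (at t)"
      using 3 by (auto intro!: derivative_eq_intros DERIV_chain2[OF poly_DERIV] simp: field_simps power2_eq_square)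
    moreover have "eventually (\<lambda>x. x > 0) (nhds t)"
      using eventually_nhds_in_open[of "{0<..}" t] 3 by auto
    then have "eventually (\<lambda>x. bump_fun P x = poly P (1 / x) * exp (- (1 / x))) (nhds t)"
      by eventually_elim (auto simp: bump_fun_def)
    ultimately show ?thesis
      using 3 by (subst DERIV_cong_ev[OF refl _ refl]) (auto simp: bump_fun_def)
  qed
qed

lemma smooth_on_bump_fun:
  fixes w :: "'a::euclidean_space \<Rightarrow> real"
  assumes "smooth_on UNIV w"
  shows "smooth_on UNIV (\<lambda>x. bump_fun P (w x))"
  by (rule smooth_on_compose_family[where I=UNIV and H="range bump_fun"])
    (use assms bump_fun_has_derivative in auto)

lemma smooth_on_norm_diff_square: "smooth_on UNIV (\<lambda>x :: 'a::euclidean_space. (norm (x - c))\<^sup>2)"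
proof -
  have "smooth_on UNIV (\<lambda>x. \<Sum>i\<in>Basis. (x \<bullet> i + - (c \<bullet> i)) * (x \<bullet> i + - (c \<bullet> i)))"
    by (intro smooth_on_sum smooth_on_mult smooth_on_add smooth_on_const
        smooth_on_bounded_linear bounded_linear_inner_left)
  moreover have "(\<Sum>i\<in>Basis. (x \<bullet> i + - (c \<bullet> i)) * (x \<bullet> i + - (c \<bullet> i))) = (norm (x - c))\<^sup>2" for x
    unfolding power2_norm_eq_inner by (subst euclidean_inner) (simp add: inner_diff_left)
  ultimately show ?thesis by simp
qed

section \<open>Test functions: linearity, smoothed absolute value, Lipschitz bound\<close>

lemma test_functionsI:
  assumes "smooth_on UNIV g" "compact K" "K \<subseteq> \<Omega>" "\<And>x. x \<notin> K \<Longrightarrow> g x = 0"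
  shows "g \<in> test_functions \<Omega>"
proof -
  have "closure {x. g x \<noteq> 0} \<subseteq> K"
    using assms by (intro closure_minimal compact_imp_closed) auto
  then show ?thesis
    using assms compact_Int_closed[OF assms(2), of "closure {x. g x \<noteq> 0}"]
    by (auto simp: test_functions_def Int_absorb1)
qed

lemma test_functionsE:
  assumes "g \<in> test_functions \<Omega>"
  obtains K where "smooth_on UNIV g" "compact K" "K \<subseteq> \<Omega>" "\<And>x. x \<notin> K \<Longrightarrow> g x = 0"
proof (rule that)
  show "smooth_on UNIV g" "compact (closure {x. g x \<noteq> 0})" "closure {x. g x \<noteq> 0} \<subseteq> \<Omega>"
    using assms by (auto simp: test_functions_def)
  show "g x = 0" if "x \<notin> closure {x. g x \<noteq> 0}" for x
    using that closure_subset[of "{x. g x \<noteq> 0}"] by auto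
qed

lemma test_functions_lin:
  assumes "g \<in> test_functions \<Omega>" "h \<in> test_functions \<Omega>"
  shows "(\<lambda>x. g x + c * h x) \<in> test_functions \<Omega>"
proof -
  obtain K L where K: "smooth_on UNIV g" "compact K" "K \<subseteq> \<Omega>" "\<And>x. x \<notin> K \<Longrightarrow> g x = 0"
    and L: "smooth_on UNIV h" "compact L" "L \<subseteq> \<Omega>" "\<And>x. x \<notin> L \<Longrightarrow> h x = 0"
    using assms by (auto elim!: test_functionsE)
  show ?thesis
    by (rule test_functionsI[where K="K \<union> L"])
      (use K L in \<open>auto intro!: smooth_on_add smooth_on_mult smooth_on_const\<close>)
qed

text \<open>A smooth substitute for \<open>\<bar>g\<bar>\<close>: the term \<open>e\<^sup>2\<close>
  keeps the root away from its singularity, and subtracting \<open>e\<close> makes the function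
  vanish wherever \<open>g\<close> does, so the support does not grow.\<close>

lemma test_functions_smooth_abs:
  assumes "g \<in> test_functions \<Omega>" "0 < e"
  shows "(\<lambda>x. sqrt ((g x)\<^sup>2 + e\<^sup>2) - e) \<in> test_functions \<Omega>"
proof -
  obtain K where K: "smooth_on UNIV g" "compact K" "K \<subseteq> \<Omega>" "\<And>x. x \<notin> K \<Longrightarrow> g x = 0"
    using assms by (auto elim!: test_functionsE)
  have pos: "0 < g x * g x + e\<^sup>2" for x
    using assms by (intro add_nonneg_pos) auto
  have "smooth_on UNIV (\<lambda>x. (g x * g x + e\<^sup>2) powr (1/2) + - e)"
    by (intro smooth_on_add smooth_on_powr smooth_on_mult smooth_on_const K pos)
  then have "smooth_on UNIV (\<lambda>x. sqrt ((g x)\<^sup>2 + e\<^sup>2) - e)"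
    using pos by (simp add: powr_half_sqrt less_imp_le power2_eq_square)
  then show ?thesis
    by (rule test_functionsI[OF _ K(2,3)]) (use K assms in auto)
qed

text \<open>Directional derivatives are continuous and vanish off the compact support, hence are
  bounded; summing over the basis bounds the operator norm of the derivative.\<close>

lemma test_function_lipschitz:
  assumes "g \<in> test_functions \<Omega>"
  shows "\<exists>L\<ge>0. \<forall>x y. \<bar>g x - g y\<bar> \<le> L * norm (x - y)"
proof -
  obtain K where K: "smooth_on UNIV g" "compact K" "K \<subseteq> \<Omega>" "\<And>x. x \<notin> K \<Longrightarrow> g x = 0"
    using assms by (auto elim!: test_functionsE)
  let ?d = "\<lambda>x. frechet_derivative g (at x)"
  have "\<exists>B\<ge>0. \<forall>x. \<bar>?d x v\<bar> \<le> B" for v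
  proof -
    have "bounded ((\<lambda>x. ?d x v) ` K)"
      using smooth_onD(3)[OF smooth_onD(2)[OF K(1), of v]] K(2)
      by (intro compact_imp_bounded compact_continuous_image) (auto intro: continuous_on_subset)
    then obtain B where B: "\<And>x. x \<in> K \<Longrightarrow> \<bar>?d x v\<bar> \<le> B" by (auto simp: bounded_iff)
    have "?d x = (\<lambda>v. 0)" if "x \<notin> K" for x
    proof -
      have "open (- K)" using K(2) by (simp add: compact_imp_closed open_Compl)
      then have "(g has_derivative (\<lambda>v. 0)) (at x)"
        by (rule has_derivative_transform_within_open[OF has_derivative_const[of 0]]) (use K that in auto)
      from frechet_derivative_at[OF this] show ?thesis by simp
    qed
    then have "\<bar>?d x v\<bar> \<le> max B 0" for x
      using B by (cases "x \<in> K") force+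
    then show ?thesis by (intro exI[of _ "max B 0"]) auto
  qed
  then obtain B where B: "\<And>v. B v \<ge> 0" "\<And>v x. \<bar>?d x v\<bar> \<le> B v" by metis
  define L where "L = (\<Sum>b\<in>Basis. B b)"
  have "onorm (?d x) \<le> L" for x
  proof (rule onorm_le)
    fix v
    have lin: "linear (?d x)" using smooth_onD(1)[OF K(1)] has_derivative_linear by blast
    have "?d x v = ?d x (\<Sum>b\<in>Basis. (v \<bullet> b) *\<^sub>R b)" by (simp add: euclidean_representation)
    also have "\<dots> = (\<Sum>b\<in>Basis. (v \<bullet> b) * ?d x b)"
      using lin by (simp add: linear_sum linear_scale)
    finally have "\<bar>?d x v\<bar> \<le> (\<Sum>b\<in>Basis. \<bar>(v \<bullet> b) * ?d x b\<bar>)" by simp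
    also have "\<dots> \<le> (\<Sum>b\<in>Basis. norm v * B b)"
      by (intro sum_mono) (auto simp: abs_mult intro!: mult_mono Basis_le_norm B)
    finally show "norm (?d x v) \<le> L * norm v" by (simp add: L_def sum_distrib_left mult.commute)
  qed
  then have "norm (g x - g y) \<le> L * norm (x - y)" for x y
    using smooth_onD(1)[OF K(1)]
    by (intro differentiable_bound[of UNIV g ?d]) auto
  moreover have "L \<ge> 0" unfolding L_def using B by (simp add: sum_nonneg)
  ultimately show ?thesis by auto
qed

section \<open>Radial integrals and averages\<close>

text \<open>Replaces polar coordinates: away from 0 the function is dominated by the sum of the
  steps \<open>c j\<close> on the balls of radius \<open>\<rho> j\<close>, whose integrals form the
  given series up to the volume of the unit ball.\<close>

lemma nn_integral_finite_of_radial_bound: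
  fixes k :: "'a::euclidean_space \<Rightarrow> real" and c \<rho> :: "nat \<Rightarrow> real"
  assumes cov: "\<And>z. z \<noteq> 0 \<Longrightarrow> \<exists>j. k z \<le> 0 \<or> norm z \<le> \<rho> j \<and> k z \<le> c j"
    and c: "\<And>j. 0 \<le> c j" and \<rho>: "\<And>j. 0 \<le> \<rho> j"
    and sum: "summable (\<lambda>j. c j * \<rho> j ^ DIM('a))"
  shows "(\<integral>\<^sup>+z. ennreal (k z) \<partial>lborel) < \<infinity>"
proof -
  have "(\<integral>\<^sup>+z. ennreal (k z) \<partial>lborel) \<le> (\<integral>\<^sup>+z. (\<Sum>j. ennreal (c j) * indicator (cball 0 (\<rho> j)) z) \<partial>(lborel :: 'a measure))"
  proof (rule nn_integral_mono_AE, rule AE_I')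
    show "{0} \<in> null_sets (lborel :: 'a measure)" by (simp add: finite_imp_null_set_lborel)
    show "{z \<in> space lborel. \<not> ennreal (k z) \<le> (\<Sum>j. ennreal (c j) * indicator (cball 0 (\<rho> j)) z)} \<subseteq> {0 :: 'a}"
    proof (rule ccontr)
      assume "\<not> ?thesis"
      then obtain z :: 'a where z: "z \<noteq> 0" "\<not> ennreal (k z) \<le> (\<Sum>j. ennreal (c j) * indicator (cball 0 (\<rho> j)) z)" by auto
      obtain j where j: "k z \<le> 0 \<or> norm z \<le> \<rho> j \<and> k z \<le> c j" using cov[OF z(1)] by auto
      show False
      proof (cases "k z \<le> 0")
        case True
        then show False using z(2) by (simp add: ennreal_neg)
      next
        case False
        then have "ennreal (k z) \<le> ennreal (c j) * indicator (cball 0 (\<rho> j)) z"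
          using j by (auto intro: ennreal_leI)
        also have "\<dots> \<le> (\<Sum>j. ennreal (c j) * indicator (cball 0 (\<rho> j)) z)"
        proof -
          define F where "F i = ennreal (c i) * indicator (cball 0 (\<rho> i)) z" for i
          have "(\<Sum>i\<in>{j}. F i) \<le> (\<Sum>i. F i)" by (rule sum_le_suminf) auto
          then have "F j \<le> (\<Sum>i. F i)" by simp
          then show ?thesis unfolding F_def .
        qed
        finally show False using z(2) by simp
      qed
    qed
  qed
  also have "\<dots> = (\<Sum>j. \<integral>\<^sup>+z. ennreal (c j) * indicator (cball 0 (\<rho> j)) z \<partial>(lborel :: 'a measure))"
  proof (rule nn_integral_suminf)
    fix j
    have [measurable]: "cball (0::'a) (\<rho> j) \<in> sets borel" by (intro borel_closed closed_cball)
    show "(\<lambda>z. ennreal (c j) * indicator (cball (0::'a) (\<rho> j)) z) \<in> borel_measurable lborel" by measurable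
  qed
  also have "\<dots> = (\<Sum>j. ennreal (unit_ball_vol DIM('a) * (c j * \<rho> j ^ DIM('a))))"
  proof (intro suminf_cong)
    fix j
    have "cball (0::'a) (\<rho> j) \<in> sets lborel" by simp
    then have "(\<integral>\<^sup>+z. ennreal (c j) * indicator (cball 0 (\<rho> j)) z \<partial>(lborel :: 'a measure))
        = ennreal (c j) * emeasure lborel (cball (0::'a) (\<rho> j))"
      by (rule nn_integral_cmult_indicator)
    also have "\<dots> = ennreal (unit_ball_vol DIM('a) * (c j * \<rho> j ^ DIM('a)))"
      using \<rho>[of j] c[of j] by (simp add: emeasure_cball ennreal_mult'[symmetric] mult.left_commute)
    finally show "(\<integral>\<^sup>+z. ennreal (c j) * indicator (cball 0 (\<rho> j)) z \<partial>(lborel :: 'a measure))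
        = ennreal (unit_ball_vol DIM('a) * (c j * \<rho> j ^ DIM('a)))" .
  qed
  also have "\<dots> < \<infinity>"
    using c \<rho> sum by (subst suminf_ennreal2) (auto intro!: summable_mult)
  finally show ?thesis .
qed

lemma nn_integral_powr_near_zero:
  assumes "\<alpha> < real DIM('a)"
  shows "(\<integral>\<^sup>+z. ennreal (indicator (cball 0 1) z * norm z powr (- \<alpha>)) \<partial>(lborel :: 'a::euclidean_space measure)) < \<infinity>"
proof -
  \<comment> \<open>With a nonnegative exponent, \<open>norm z powr (- \<alpha>')\<close> decreases
    in \<open>norm z\<close>, so on a dyadic shell it is at most its value at the inner radius,
    which is \<open>c j\<close>.\<close>
  define \<alpha>' where "\<alpha>' = max \<alpha> 0"
  have \<alpha>': "0 \<le> \<alpha>'" "\<alpha> \<le> \<alpha>'" "\<alpha>' < real DIM('a)" using assms by (auto simp: \<alpha>'_def)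
  define c where "c j = ((1/2) ^ Suc j) powr (- \<alpha>')" for j :: nat
  show ?thesis
  proof (rule nn_integral_finite_of_radial_bound[where c=c and \<rho>="\<lambda>j. (1/2)^j"])
    fix z :: 'a assume z: "z \<noteq> 0"
    show "\<exists>j. indicator (cball 0 1) z * norm z powr (- \<alpha>) \<le> 0 \<or>
        norm z \<le> (1/2)^j \<and> indicator (cball 0 1) z * norm z powr (- \<alpha>) \<le> c j"
    proof (cases "norm z \<le> 1")
      case True
      \<comment> \<open>This locates the shell of \<open>z\<close>: minimality gives
        \<open>norm z \<le> (1/2) ^ j\<close>, membership gives the strict lower bound by the next
        radius.\<close>
      define j where "j = (LEAST j. (1/2 :: real) ^ Suc j < norm z)"
      obtain i where "(1/2 :: real) ^ i < norm z" using real_arch_pow_inv[of "norm z" "1/2"] z by auto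
      then have "(1/2 :: real) ^ Suc i < norm z"
        by (rule le_less_trans[rotated]) (simp add: power_one_over field_simps)
      then have j1: "(1/2 :: real) ^ Suc j < norm z" unfolding j_def by (rule LeastI)
      have j2: "norm z \<le> (1/2)^j"
      proof (cases j)
        case 0 then show ?thesis using True by simp
      next
        case (Suc i)
        then have "\<not> (1/2 :: real) ^ Suc i < norm z" unfolding j_def by (intro not_less_Least) simp
        then show ?thesis using Suc by simp
      qed
      have "norm z powr (- \<alpha>) \<le> norm z powr (- \<alpha>')"
        using True z \<alpha>' by (intro powr_mono') auto
      also have "\<dots> \<le> c j"
        unfolding c_def using j1 \<alpha>' by (intro powr_mono2') auto
      finally show ?thesis using j2 True by (intro exI[of _ j]) (auto simp: indicator_def)
    qed (auto simp: indicator_def)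
  next
    have "c j * ((1/2)^j) ^ DIM('a) = (1/2) powr (- \<alpha>') * ((1/2) powr (real DIM('a) - \<alpha>')) ^ j" for j
    proof -
      have "((1/2 :: real)^j) ^ DIM('a) = (1/2) powr (real j * real DIM('a))"
        by (simp add: powr_realpow[symmetric] powr_powr del: powr_realpow)
      moreover have "c j = (1/2) powr (real (Suc j) * - \<alpha>')"
        unfolding c_def by (simp only: powr_realpow[of "1/2", symmetric, simplified] powr_powr)
      moreover have "((1/2 :: real) powr (real DIM('a) - \<alpha>')) ^ j = (1/2) powr ((real DIM('a) - \<alpha>') * real j)"
        by (simp add: powr_powr powr_realpow[symmetric] del: powr_realpow)
      ultimately show ?thesis by (simp add: powr_add[symmetric] algebra_simps)
    qed
    moreover have "(1/2 :: real) powr (real DIM('a) - \<alpha>') < 1"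
      using \<alpha>' powr_less_mono'[of "1/2" 0 "real DIM('a) - \<alpha>'"] by simp
    ultimately show "summable (\<lambda>j. c j * ((1/2)^j) ^ DIM('a))"
      by (simp add: summable_geometric summable_mult)
  qed (auto simp: c_def)
qed

lemma nn_integral_powr_near_infinity:
  assumes "real DIM('a) < \<beta>"
  shows "(\<integral>\<^sup>+z. ennreal (indicator (- cball 0 1) z * norm z powr (- \<beta>)) \<partial>(lborel :: 'a::euclidean_space measure)) < \<infinity>"
proof -
  define c where "c j = (2 ^ j) powr (- \<beta>)" for j :: nat
  have \<beta>: "\<beta> > 0" using assms by (meson DIM_positive le_less_trans of_nat_0_le_iff)
  show ?thesis
  proof (rule nn_integral_finite_of_radial_bound[where c=c and \<rho>="\<lambda>j. 2 ^ Suc j"])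
    fix z :: 'a assume z: "z \<noteq> 0"
    show "\<exists>j. indicator (- cball 0 1) z * norm z powr (- \<beta>) \<le> 0 \<or>
        norm z \<le> 2 ^ Suc j \<and> indicator (- cball 0 1) z * norm z powr (- \<beta>) \<le> c j"
    proof (cases "norm z \<le> 1")
      case False
      define j where "j = (LEAST j. norm z < 2 ^ Suc j)"
      obtain i where "norm z < 2 ^ i" using real_arch_pow[of 2 "norm z"] by auto
      then have "norm z < 2 ^ Suc i"
        by (rule less_le_trans) simp
      then have j1: "norm z < 2 ^ Suc j" unfolding j_def by (rule LeastI)
      have j2: "2 ^ j \<le> norm z"
      proof (cases j)
        case 0 then show ?thesis using False by simp
      next
        case (Suc i)
        then have "\<not> norm z < 2 ^ Suc i" unfolding j_def by (intro not_less_Least) simp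
        then show ?thesis using Suc by simp
      qed
      have "norm z powr (- \<beta>) \<le> c j"
        unfolding c_def using j2 \<beta> by (intro powr_mono2') auto
      then show ?thesis using j1 False by (intro exI[of _ j]) (auto simp: indicator_def)
    qed (auto simp: indicator_def)
  next
    have eq: "c j * (2 ^ Suc j) ^ DIM('a) = 2 ^ DIM('a) * (2 powr (real DIM('a) - \<beta>)) ^ j" for j
    proof -
      have "((2 :: real)^j) ^ DIM('a) = 2 powr (real j * real DIM('a))"
        by (simp add: powr_realpow[symmetric] powr_powr del: powr_realpow)
      moreover have "c j = 2 powr (real j * - \<beta>)"
        unfolding c_def by (simp add: powr_realpow[symmetric] powr_powr del: powr_realpow)
      moreover have "((2 :: real) powr (real DIM('a) - \<beta>)) ^ j = 2 powr ((real DIM('a) - \<beta>) * real j)"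
        by (simp add: powr_powr powr_realpow[symmetric] del: powr_realpow)
      ultimately show ?thesis by (simp add: powr_add[symmetric] power_mult_distrib algebra_simps)
    qed
    have "(2 :: real) powr (real DIM('a) - \<beta>) < 1"
      using assms powr_less_mono[of "real DIM('a) - \<beta>" 0 2] by simp
    then show "summable (\<lambda>j. c j * (2 ^ Suc j) ^ DIM('a))"
      unfolding eq by (intro summable_mult summable_geometric) simp
  qed (auto simp: c_def)
qed

lemma powr_tangent_le:
  fixes t m p :: real
  assumes "1 \<le> p" "0 \<le> t" "0 < m"
  shows "m powr p + p * m powr (p - 1) * (t - m) \<le> t powr p"
proof (cases "t = 0")
  case True
  have "m powr (p - 1) * m = m powr p" using assms by (simp add: powr_diff)
  then have "m powr p + p * m powr (p - 1) * (t - m) = (1 - p) * m powr p"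
    using True by (simp add: algebra_simps)
  also have "\<dots> \<le> 0" using assms by (intro mult_nonpos_nonneg) auto
  finally show ?thesis using True by simp
next
  case False
  have "((\<lambda>x. x powr p) has_real_derivative p * m powr (p - 1)) (at m within {0<..})"
    using assms by (auto intro!: derivative_eq_intros)
  then have "p * m powr (p - 1) * (t - m) \<le> t powr p - m powr p"
    using assms False
    by (intro convex_on_imp_above_tangent[OF powr_convex[OF assms(1)]])
      (auto simp: interior_open connected_Ioi)
  then show ?thesis by simp
qed

text \<open>Integrate over \<open>A\<close> the tangent inequality for \<open>t powr p\<close> at
  the modulus \<open>m\<close> of the mean, applied to \<open>\<bar>\<phi> y\<bar>\<close>. The
  linear part integrates to something nonnegative because the mean of
  \<open>\<bar>\<phi>\<bar>\<close> is at least \<open>m\<close>. The case \<open>m = 0\<close> is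
  trivial.\<close>

lemma jensen_average:
  fixes \<phi> :: "'a \<Rightarrow> real"
  assumes p: "1 \<le> p" and A: "0 < measure M A" "emeasure M A < \<infinity>" and [measurable]: "A \<in> sets M"
    and i: "integrable M (\<lambda>y. indicator A y * \<phi> y)" "integrable M (\<lambda>y. indicator A y * \<bar>\<phi> y\<bar> powr p)"
  shows "\<bar>(\<integral>y. indicator A y * \<phi> y \<partial>M) / measure M A\<bar> powr p
    \<le> (\<integral>y. indicator A y * \<bar>\<phi> y\<bar> powr p \<partial>M) / measure M A"
proof -
  define m where "m = \<bar>(\<integral>y. indicator A y * \<phi> y \<partial>M) / measure M A\<bar>"
  show ?thesis
  proof (cases "m = 0")
    case True
    then show ?thesis unfolding m_def[symmetric]
      by (simp add: integral_nonneg_AE)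
  next
    case False
    moreover have "0 \<le> m" by (simp add: m_def)
    ultimately have m: "m > 0" by simp
    have iA: "integrable M (\<lambda>y. indicator A y :: real)" using A by simp
    have i1: "integrable M (\<lambda>y. indicator A y * \<bar>\<phi> y\<bar>)"
      using integrable_abs[OF i(1)] by (simp add: abs_mult)
    have i2: "integrable M (\<lambda>y. (m powr p - p * m powr (p - 1) * m) * indicator A y + p * m powr (p - 1) * (indicator A y * \<bar>\<phi> y\<bar>))"
      using iA i1 by simp
    have "m * measure M A = \<bar>\<integral>y. indicator A y * \<phi> y \<partial>M\<bar>"
      using A by (simp add: m_def abs_divide)
    also have "\<dots> \<le> (\<integral>y. indicator A y * \<bar>\<phi> y\<bar> \<partial>M)"
      using integral_abs_bound[of M "\<lambda>y. indicator A y * \<phi> y"] by (simp add: abs_mult)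
    finally have le: "m * measure M A \<le> (\<integral>y. indicator A y * \<bar>\<phi> y\<bar> \<partial>M)" .
    have "m powr p * measure M A = (m powr p - p * m powr (p - 1) * m) * measure M A + p * m powr (p - 1) * (m * measure M A)"
      by (simp add: algebra_simps)
    also have "\<dots> \<le> (m powr p - p * m powr (p - 1) * m) * measure M A + p * m powr (p - 1) * (\<integral>y. indicator A y * \<bar>\<phi> y\<bar> \<partial>M)"
      using le p by (intro add_left_mono mult_left_mono) auto
    also have "\<dots> = (\<integral>y. (m powr p - p * m powr (p - 1) * m) * indicator A y + p * m powr (p - 1) * (indicator A y * \<bar>\<phi> y\<bar>) \<partial>M)"
      using iA i1 A by simp
    also have "\<dots> \<le> (\<integral>y. indicator A y * \<bar>\<phi> y\<bar> powr p \<partial>M)"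
    proof (rule integral_mono[OF i2 i(2)])
      fix y
      show "(m powr p - p * m powr (p - 1) * m) * indicator A y + p * m powr (p - 1) * (indicator A y * \<bar>\<phi> y\<bar>)
          \<le> indicator A y * \<bar>\<phi> y\<bar> powr p"
        using powr_tangent_le[OF p _ m, of "\<bar>\<phi> y\<bar>"] by (simp add: indicator_def algebra_simps)
    qed
    finally show ?thesis unfolding m_def[symmetric] using A by (simp add: field_simps)
  qed
qed

section \<open>The fractional Sobolev inequality\<close>

text \<open>The integrand of the Gagliardo seminorm when \<open>\<beta>\<close> is n + p s; its
  value on the diagonal is 0.\<close>

definition gag :: "real \<Rightarrow> real \<Rightarrow> ('a::euclidean_space \<Rightarrow> real) \<Rightarrow> 'a \<Rightarrow> 'a \<Rightarrow> real" where
  "gag p \<beta> g x y = \<bar>g x - g y\<bar> powr p / norm (x - y) powr \<beta>"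

text \<open>The two features of test functions that the integral estimates use: Lipschitz continuity
  controls the integrand near the diagonal, compact support controls it far away.\<close>

definition lip_compact :: "('a::euclidean_space \<Rightarrow> real) \<Rightarrow> bool" where
  "lip_compact g \<longleftrightarrow> (\<exists>L\<ge>0. \<forall>x y. \<bar>g x - g y\<bar> \<le> L * norm (x - y)) \<and> (\<exists>R. \<forall>x. R < norm x \<longrightarrow> g x = 0)"

lemma lip_compactE:
  assumes "lip_compact g"
  obtains L R where "0 \<le> L" "\<And>x y. \<bar>g x - g y\<bar> \<le> L * norm (x - y)" "0 \<le> R" "\<And>x. x \<notin> cball 0 R \<Longrightarrow> g x = 0"
    "\<And>x. \<bar>g x\<bar> \<le> L * (2 * R + 1)" "continuous_on UNIV g"
proof -
  obtain L R0 where L: "0 \<le> L" "\<And>x y. \<bar>g x - g y\<bar> \<le> L * norm (x - y)" and R0: "\<And>x. R0 < norm x \<Longrightarrow> g x = 0"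
    using assms by (auto simp: lip_compact_def)
  define R where "R = max R0 0"
  have R: "0 \<le> R" "\<And>x. x \<notin> cball 0 R \<Longrightarrow> g x = 0" using R0 by (auto simp: R_def)
  \<comment> \<open>A point of norm \<open>R + 1\<close> is outside the support and at distance at
    most \<open>2 * R + 1\<close> from every point of the ball, so the Lipschitz bound becomes a
    bound on the values.\<close>
  obtain y :: 'a where y: "norm y = R + 1" using vector_choose_size[of "R + 1"] R by auto
  have bd: "\<bar>g x\<bar> \<le> L * (2 * R + 1)" for x
  proof (cases "x \<in> cball 0 R")
    case True
    have "\<bar>g x\<bar> = \<bar>g x - g y\<bar>" using R(2)[of y] y by simp
    also have "\<dots> \<le> L * norm (x - y)" by (rule L)
    also have "\<dots> \<le> L * (2 * R + 1)"
      using L(1) True y norm_triangle_ineq4[of x y] by (intro mult_left_mono) auto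
    finally show ?thesis .
  qed (use R L in auto)
  have "continuous_on UNIV g"
  proof (rule continuous_on_iff[THEN iffD2], intro ballI allI impI)
    fix x :: 'a and e :: real assume e: "0 < e"
    have "dist (g y) (g x) < e" if "dist y x < e / (L + 1)" for y
    proof -
      have "dist (g y) (g x) \<le> L * dist y x" using L(2)[of y x] by (simp add: dist_norm)
      also have "\<dots> \<le> (L + 1) * dist y x" by (intro mult_right_mono) auto
      also have "\<dots> < e" using that L(1) by (simp add: field_simps)
      finally show ?thesis .
    qed
    then show "\<exists>d>0. \<forall>x'\<in>UNIV. dist x' x < d \<longrightarrow> dist (g x') (g x) < e"
      using e L(1) by (intro exI[of _ "e / (L + 1)"]) auto
  qed
  with that L R bd show ?thesis by blast
qed

section \<open>Integrability of the Gagliardo integrand and of powers\<close>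

lemma sets_borel_cball [measurable]: "cball c h \<in> sets (borel :: 'a::euclidean_space measure)"
  by (intro borel_closed closed_cball)

lemma integrable_indicator_cball:
  "integrable lborel (\<lambda>x. C * indicator (cball (c::'a::euclidean_space) h) x :: real)"
  using emeasure_lborel_cball_finite[of c h] sets_borel_cball[of c h]
  by (intro integrable_mult_right integrable_real_indicator) auto

text \<open>The integrand lies below a kernel \<open>k (x - y)\<close>: near the diagonal with
  exponent \<open>\<beta> - p\<close>, that is n - p (1 - s) < n, by the Lipschitz bound, and far
  away with exponent \<open>\<beta> > n\<close> by boundedness. Here \<open>s < 1\<close> and
  \<open>0 < s\<close> enter.\<close>

lemma gag_integrable:
  fixes g :: "'a::euclidean_space \<Rightarrow> real"
  assumes g: "lip_compact g" and p: "0 < p" and s: "0 < s" "s < 1" and \<beta>: "\<beta> = real DIM('a) + p * s"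
  shows "integrable lborel (\<lambda>z. gag p \<beta> g (fst z) (snd z))" "integrable lborel (gag p \<beta> g x)"
proof -
  obtain L R where L: "0 \<le> L" "\<And>x y. \<bar>g x - g y\<bar> \<le> L * norm (x - y)"
    and R: "0 \<le> R" "\<And>x. x \<notin> cball 0 R \<Longrightarrow> g x = 0" and bd: "\<And>x. \<bar>g x\<bar> \<le> L * (2 * R + 1)"
    and cont: "continuous_on UNIV g"
    by (rule lip_compactE[OF g]) blast
  have [measurable]: "g \<in> borel_measurable borel" using cont by (rule borel_measurable_continuous_onI)
  define B where "B = L * (2 * R + 1)"
  define k :: "'a \<Rightarrow> real" where "k z = L powr p * (indicator (cball 0 1) z * norm z powr (- (\<beta> - p)))
     + (2 * B) powr p * (indicator (- cball 0 1) z * norm z powr (- \<beta>))" for z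
  have [measurable]: "- cball (0::'a) 1 \<in> sets borel" by (intro borel_open open_Compl closed_cball)
  have [measurable]: "k \<in> borel_measurable borel" unfolding k_def by measurable
  have k0: "0 \<le> k z" for z by (simp add: k_def)
  have "(\<integral>\<^sup>+z. ennreal (k z) \<partial>lborel) =
      (\<integral>\<^sup>+z. ennreal (L powr p) * ennreal (indicator (cball 0 1) z * norm z powr (- (\<beta> - p)))
        + ennreal ((2 * B) powr p) * ennreal (indicator (- cball 0 1) z * norm z powr (- \<beta>)) \<partial>(lborel :: 'a measure))"
    by (intro nn_integral_cong) (simp add: k_def ennreal_plus ennreal_mult)
  also have "\<dots> = ennreal (L powr p) * (\<integral>\<^sup>+z. ennreal (indicator (cball 0 1) z * norm z powr (- (\<beta> - p))) \<partial>(lborel :: 'a measure))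
        + ennreal ((2 * B) powr p) * (\<integral>\<^sup>+z. ennreal (indicator (- cball 0 1) z * norm z powr (- \<beta>)) \<partial>(lborel :: 'a measure))"
    by (subst nn_integral_add) (auto simp: nn_integral_cmult)
  also have "\<dots> < \<infinity>"
    using nn_integral_powr_near_zero[of "\<beta> - p", where 'a='a] nn_integral_powr_near_infinity[of \<beta>, where 'a='a] p s
    by (simp add: \<beta> ennreal_mult_less_top)
  finally have kfin: "(\<integral>\<^sup>+z. ennreal (k z) \<partial>lborel) < \<infinity>" .
  have gk: "gag p \<beta> g x y \<le> k (x - y)" for x y
  proof (cases "x = y")
    case True then show ?thesis using k0 by (simp add: gag_def)
  next
    case False
    then have n: "norm (x - y) > 0" by simp
    show ?thesis
    proof (cases "norm (x - y) \<le> 1")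
      case True
      have "\<bar>g x - g y\<bar> powr p \<le> (L * norm (x - y)) powr p"
        using L p by (intro powr_mono2) auto
      then have "gag p \<beta> g x y \<le> (L * norm (x - y)) powr p / norm (x - y) powr \<beta>"
        unfolding gag_def by (intro divide_right_mono) auto
      also have "\<dots> = L powr p * norm (x - y) powr (- (\<beta> - p))"
        using n L by (simp add: powr_mult powr_diff powr_minus divide_inverse)
      finally show ?thesis using True by (simp add: k_def)
    next
      case False
      have "\<bar>g x - g y\<bar> \<le> 2 * B" using bd[of x] bd[of y] unfolding B_def by linarith
      then have "\<bar>g x - g y\<bar> powr p \<le> (2 * B) powr p"
        using p by (intro powr_mono2) auto
      then have "gag p \<beta> g x y \<le> (2 * B) powr p / norm (x - y) powr \<beta>"
        unfolding gag_def by (intro divide_right_mono) auto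
      then show ?thesis using False by (simp add: k_def powr_minus divide_inverse)
    qed
  qed
  have ktrans: "(\<integral>\<^sup>+y. ennreal (k (x - y)) \<partial>lborel) = (\<integral>\<^sup>+z. ennreal (k z) \<partial>lborel)" for x
  proof -
    have "k (x - y) = k (- x + y)" for y
      by (simp add: k_def indicator_def norm_minus_commute)
    then have "(\<integral>\<^sup>+y. ennreal (k (x - y)) \<partial>lborel) = (\<integral>\<^sup>+z. ennreal (k z) \<partial>(distr lborel borel ((+) (- x))))"
      by (subst nn_integral_distr) auto
    then show ?thesis by (simp add: lborel_distr_plus)
  qed
  have gag0: "0 \<le> gag p \<beta> g x y" for x y by (simp add: gag_def)
  have gm [measurable]: "gag p \<beta> g x \<in> borel_measurable borel" for x unfolding gag_def by measurable
  have gm2 [measurable]: "(\<lambda>z. gag p \<beta> g (fst z) (snd z)) \<in> borel_measurable borel"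
    unfolding gag_def by (subst borel_prod[symmetric]) measurable
  show "integrable lborel (gag p \<beta> g x)"
  proof (rule integrableI_nonneg)
    have "(\<integral>\<^sup>+y. ennreal (gag p \<beta> g x y) \<partial>lborel) \<le> (\<integral>\<^sup>+y. ennreal (k (x - y)) \<partial>lborel)"
      by (intro nn_integral_mono ennreal_leI gk)
    then show "(\<integral>\<^sup>+y. ennreal (gag p \<beta> g x y) \<partial>lborel) < \<infinity>"
      using kfin ktrans[of x] by simp
  qed (auto simp: gag0)
  \<comment> \<open>Only pairs with a point in the support count, so the double integral is at most
    twice the volume of \<open>?K\<close> times the integral of \<open>k\<close>.\<close>
  let ?K = "cball (0::'a) R"
  have gK: "gag p \<beta> g x y \<le> indicator ?K x * k (x - y) + indicator ?K y * k (x - y)" for x y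
  proof (cases "x \<in> ?K \<or> y \<in> ?K")
    case True
    then show ?thesis using gk[of x y] k0[of "x - y"] by (auto simp: indicator_def)
  next
    case False
    then have "gag p \<beta> g x y = 0" using R(2)[of x] R(2)[of y] by (simp add: gag_def)
    then show ?thesis using k0 by simp
  qed
  have ksym: "k (x - y) = k (y - x)" for x y by (simp add: k_def indicator_def norm_minus_commute)
  show "integrable lborel (\<lambda>z. gag p \<beta> g (fst z) (snd z))"
  proof (rule integrableI_nonneg)
    have "(\<integral>\<^sup>+z. ennreal (gag p \<beta> g (fst z) (snd z)) \<partial>lborel) = (\<integral>\<^sup>+z. ennreal (gag p \<beta> g (fst z) (snd z)) \<partial>(lborel \<Otimes>\<^sub>M lborel))"
      by (simp add: lborel_prod)
    also have "\<dots> = (\<integral>\<^sup>+x. \<integral>\<^sup>+y. ennreal (gag p \<beta> g x y) \<partial>lborel \<partial>lborel)"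
      by (subst lborel.nn_integral_fst[symmetric]) (simp_all add: lborel_prod)
    also have "\<dots> \<le> (\<integral>\<^sup>+x. \<integral>\<^sup>+y. ennreal (indicator ?K x * k (x - y) + indicator ?K y * k (x - y)) \<partial>lborel \<partial>lborel)"
      by (intro nn_integral_mono ennreal_leI gK)
    also have "\<dots> = (\<integral>\<^sup>+x. \<integral>\<^sup>+y. indicator ?K x * ennreal (k (x - y)) + indicator ?K y * ennreal (k (y - x)) \<partial>lborel \<partial>lborel)"
      by (intro nn_integral_cong) (auto simp: indicator_def ksym ennreal_plus k0)
    also have "\<dots> = (\<integral>\<^sup>+x. (\<integral>\<^sup>+y. indicator ?K x * ennreal (k (x - y)) \<partial>lborel) + (\<integral>\<^sup>+y. indicator ?K y * ennreal (k (y - x)) \<partial>lborel) \<partial>lborel)"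
      by (intro nn_integral_cong nn_integral_add) auto
    also have "\<dots> = (\<integral>\<^sup>+x. (\<integral>\<^sup>+y. indicator ?K x * ennreal (k (x - y)) \<partial>lborel) \<partial>lborel) + (\<integral>\<^sup>+x. (\<integral>\<^sup>+y. indicator ?K y * ennreal (k (y - x)) \<partial>lborel) \<partial>lborel)"
      by (intro nn_integral_add) auto
    also have "(\<integral>\<^sup>+x. (\<integral>\<^sup>+y. indicator ?K y * ennreal (k (y - x)) \<partial>lborel) \<partial>lborel) = (\<integral>\<^sup>+y. (\<integral>\<^sup>+x. indicator ?K y * ennreal (k (y - x)) \<partial>lborel) \<partial>lborel)"
      by (rule lborel_pair.Fubini') measurable
    also have "(\<integral>\<^sup>+x. (\<integral>\<^sup>+y. indicator ?K x * ennreal (k (x - y)) \<partial>lborel) \<partial>lborel) = (\<integral>\<^sup>+x. indicator ?K x * (\<integral>\<^sup>+z. ennreal (k z) \<partial>lborel) \<partial>lborel)"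
      by (intro nn_integral_cong) (simp add: nn_integral_cmult ktrans)
    also have "\<dots> = emeasure lborel ?K * (\<integral>\<^sup>+z. ennreal (k z) \<partial>lborel)"
      by (simp add: nn_integral_multc)
    also have "\<dots> + \<dots> < \<infinity>"
      using kfin emeasure_lborel_cball_finite[of "0::'a" R] by (simp add: ennreal_mult_less_top)
    finally show "(\<integral>\<^sup>+z. ennreal (gag p \<beta> g (fst z) (snd z)) \<partial>lborel) < \<infinity>" .
  qed (auto simp: gag0)
qed

lemma gag_fubini:
  fixes g :: "'a::euclidean_space \<Rightarrow> real"
  assumes "lip_compact g" "0 < p" "0 < s" "s < 1" "\<beta> = real DIM('a) + p * s"
  shows "integrable lborel (\<lambda>x. \<integral>y. gag p \<beta> g x y \<partial>lborel)"
    and "(\<integral>x. (\<integral>y. gag p \<beta> g x y \<partial>lborel) \<partial>lborel) = (\<integral>z. gag p \<beta> g (fst z) (snd z) \<partial>lborel)"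
proof -
  have i: "integrable (lborel \<Otimes>\<^sub>M lborel) (\<lambda>z. gag p \<beta> g (fst z) (snd z))"
    using gag_integrable(1)[OF assms] by (simp add: lborel_prod)
  show "integrable lborel (\<lambda>x. \<integral>y. gag p \<beta> g x y \<partial>lborel)"
    using lborel_pair.integrable_fst'[OF i] by simp
  show "(\<integral>x. (\<integral>y. gag p \<beta> g x y \<partial>lborel) \<partial>lborel) = (\<integral>z. gag p \<beta> g (fst z) (snd z) \<partial>lborel)"
    using lborel_pair.integral_fst'[OF i] by (simp add: lborel_prod)
qed

lemma lip_compact_powr_integrable:
  fixes g :: "'a::euclidean_space \<Rightarrow> real"
  assumes g: "lip_compact g" and m: "0 < m"
  shows "integrable lborel (\<lambda>x. \<bar>g x\<bar> powr m)"
proof -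
  obtain L R where L: "0 \<le> L" and R: "0 \<le> R" "\<And>x. x \<notin> cball 0 R \<Longrightarrow> g x = 0"
    and bd: "\<And>x. \<bar>g x\<bar> \<le> L * (2 * R + 1)" and cont: "continuous_on UNIV g"
    by (rule lip_compactE[OF g]) blast
  have [measurable]: "g \<in> borel_measurable borel" using cont by (rule borel_measurable_continuous_onI)
  show ?thesis
  proof (rule Bochner_Integration.integrable_bound)
    show "integrable lborel (\<lambda>x. (L * (2 * R + 1)) powr m * indicator (cball 0 R) x :: real)"
      by (rule integrable_indicator_cball)
    show "AE x in lborel. norm (\<bar>g x\<bar> powr m) \<le> norm ((L * (2 * R + 1)) powr m * indicator (cball 0 R) x :: real)"
    proof (rule AE_I2)
      fix x
      have "\<bar>g x\<bar> powr m \<le> (L * (2 * R + 1)) powr m" using bd[of x] m by (intro powr_mono2) auto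
      then show "norm (\<bar>g x\<bar> powr m) \<le> norm ((L * (2 * R + 1)) powr m * indicator (cball 0 R) x :: real)"
        using R(2)[of x] by (cases "x \<in> cball 0 R") auto
    qed
  qed measurable
qed

lemma lip_compact_integrable_ball:
  fixes g :: "'a::euclidean_space \<Rightarrow> real"
  assumes g: "lip_compact g" and m: "0 < m"
  shows "integrable lborel (\<lambda>y. indicator (cball c h) y * \<bar>g y - d\<bar> powr m)"
    "integrable lborel (\<lambda>y. indicator (cball c h) y * (g y - d))"
proof -
  obtain L R where L: "0 \<le> L" and R: "0 \<le> R"
    and bd: "\<And>x. \<bar>g x\<bar> \<le> L * (2 * R + 1)" and cont: "continuous_on UNIV g"
    by (rule lip_compactE[OF g]) blast
  have [measurable]: "g \<in> borel_measurable borel" using cont by (rule borel_measurable_continuous_onI)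
  let ?B = "L * (2 * R + 1) + \<bar>d\<bar>"
  have bd': "\<bar>g y - d\<bar> \<le> ?B" for y using bd[of y] by linarith
  have bdm: "\<bar>g y - d\<bar> powr m \<le> ?B powr m" for y using bd'[of y] m by (intro powr_mono2) auto
  show "integrable lborel (\<lambda>y. indicator (cball c h) y * \<bar>g y - d\<bar> powr m)"
    by (rule Bochner_Integration.integrable_bound[OF integrable_indicator_cball[of "?B powr m" c h]])
      (auto simp: indicator_def intro!: bdm)
  show "integrable lborel (\<lambda>y. indicator (cball c h) y * (g y - d))"
    by (rule Bochner_Integration.integrable_bound[OF integrable_indicator_cball[of "?B" c h]])
      (auto simp: indicator_def intro!: order_trans[OF bd'])
qed

text \<open>Both the Sobolev inequality and the compactness of the embedding come from this estimate.\<close>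

lemma average_estimate:
  fixes g :: "'a::euclidean_space \<Rightarrow> real"
  assumes g: "lip_compact g" and p: "1 \<le> p" and s: "0 < s" "s < 1" and \<beta>: "\<beta> = real DIM('a) + p * s"
    and h: "0 < h" and x: "x \<in> cball c h"
  shows "\<bar>g x - (\<integral>y. indicator (cball c h) y * g y \<partial>lborel) / measure lborel (cball c h)\<bar> powr p
    \<le> 2 powr \<beta> / unit_ball_vol DIM('a) * h powr (p * s) * (\<integral>y. gag p \<beta> g x y \<partial>lborel)"
proof -
  let ?B = "cball c h" let ?A = "measure lborel ?B"
  have A: "0 < ?A" "emeasure lborel ?B < \<infinity>" using h emeasure_lborel_cball_finite[of c h] by auto
  have p0: "0 < p" using p by simp
  note i1 = lip_compact_integrable_ball[OF g p0, of c h "g x"]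
  have "integrable lborel (\<lambda>y. indicator ?B y * (g y - 0))" by (rule lip_compact_integrable_ball[OF g p0])
  then have ig: "integrable lborel (\<lambda>y. indicator ?B y * g y)" by simp
  have iB: "integrable lborel (\<lambda>y. indicator ?B y :: real)" using integrable_indicator_cball[of 1 c h] by simp
  have "(\<integral>y. indicator ?B y * (g y - g x) \<partial>lborel) = (\<integral>y. indicator ?B y * g y \<partial>lborel) - ?A * g x"
    using ig iB by (simp add: right_diff_distrib)
  then have "\<bar>g x - (\<integral>y. indicator ?B y * g y \<partial>lborel) / ?A\<bar> = \<bar>(\<integral>y. indicator ?B y * (g y - g x) \<partial>lborel) / ?A\<bar>"
    using A by (simp add: diff_divide_distrib abs_minus_commute)
  also have "\<dots> powr p \<le> (\<integral>y. indicator ?B y * \<bar>g y - g x\<bar> powr p \<partial>lborel) / ?A"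
    by (rule jensen_average[OF p A]) (use i1 in auto)
  \<comment> \<open>Two points of the ball are at distance at most \<open>2 * h\<close>, so the
    singular kernel can be inserted at the price of \<open>(2 * h) powr \<beta>\<close>; division by
    the volume of the ball then leaves the power \<open>p * s\<close> of \<open>h\<close>.\<close>
  also have "\<dots> \<le> (\<integral>y. (2 * h) powr \<beta> * gag p \<beta> g x y \<partial>lborel) / ?A"
  proof (intro divide_right_mono integral_mono i1)
    show "integrable lborel (\<lambda>y. (2 * h) powr \<beta> * gag p \<beta> g x y)"
      using gag_integrable(2)[OF g p0 s \<beta>] by simp
    fix y
    show "indicator ?B y * \<bar>g y - g x\<bar> powr p \<le> (2 * h) powr \<beta> * gag p \<beta> g x y"
    proof (cases "y \<in> ?B \<and> x \<noteq> y")
      case True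
      then have n: "norm (x - y) > 0" by simp
      have "norm (x - y) \<le> 2 * h"
        using True x dist_triangle2[of x y c] by (simp add: dist_norm norm_minus_commute)
      then have "norm (x - y) powr \<beta> \<le> (2 * h) powr \<beta>"
        using p0 s \<beta> by (intro powr_mono2) auto
      then have "1 \<le> (2 * h) powr \<beta> / norm (x - y) powr \<beta>" using n by (simp add: field_simps)
      then have "\<bar>g x - g y\<bar> powr p * 1 \<le> \<bar>g x - g y\<bar> powr p * ((2 * h) powr \<beta> / norm (x - y) powr \<beta>)"
        by (intro mult_left_mono) auto
      then show ?thesis using True by (simp add: gag_def abs_minus_commute mult.commute)
    qed (auto simp: gag_def)
  qed (use A in auto)
  also have "\<dots> = (2 * h) powr \<beta> / ?A * (\<integral>y. gag p \<beta> g x y \<partial>lborel)" by simp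
  also have "(2 * h) powr \<beta> / ?A = 2 powr \<beta> / unit_ball_vol DIM('a) * h powr (p * s)"
  proof -
    have "?A = unit_ball_vol DIM('a) * h powr real DIM('a)"
      using h by (simp add: content_cball powr_realpow)
    moreover have "(2 * h) powr \<beta> = 2 powr \<beta> * (h powr real DIM('a) * h powr (p * s))"
      using h by (simp add: powr_mult \<beta> powr_add)
    ultimately show ?thesis using h by simp
  qed
  finally show ?thesis .
qed

text \<open>Choosing the radius that balances the oscillation against the mean gives a pointwise bound of
  \<open>\<bar>g x\<bar>\<^sup>r\<close> by the Gagliardo integral at \<open>x\<close>, which is then integrated.\<close>

lemma fractional_sobolev:
  assumes p: "1 \<le> p" and s: "0 < s" "s < 1" and ps: "p * s < real DIM('a)"
    and r: "r = real DIM('a) * p / (real DIM('a) - p * s)" and \<beta>: "\<beta> = real DIM('a) + p * s"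
  shows "\<exists>C>0. \<forall>g :: 'a::euclidean_space \<Rightarrow> real. lip_compact g \<longrightarrow>
    (\<integral>x. \<bar>g x\<bar> powr r \<partial>lborel) \<le> C * (\<integral>z. gag p \<beta> g (fst z) (snd z) \<partial>lborel) powr (r / p)"
proof -
  let ?n = "real DIM('a)" and ?\<omega> = "unit_ball_vol DIM('a)"
  have n: "?n > 0" by simp
  have \<omega>: "?\<omega> > 0" by simp
  then have \<omega>0: "?\<omega> \<noteq> 0" by (rule less_imp_neq[symmetric])
  \<comment> \<open>The critical exponent makes \<open>1 - \<theta> = p * s / n\<close>, which lets
    a single radius bring both terms of \<open>est\<close> to the same power of
    \<open>X\<close>.\<close>
  define \<theta> where "\<theta> = p / r"
  have r0: "0 < r" using p ps n unfolding r by simp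
  have th: "\<theta> = 1 - p * s / ?n" using p ps n unfolding \<theta>_def r by (simp add: field_simps)
  have th01: "0 < \<theta>" "\<theta> < 1"
  proof -
    show "0 < \<theta>" unfolding th using ps n by (simp add: field_simps)
    show "\<theta> < 1" unfolding th using p s n by simp
  qed
  have pr: "p < r" using th01 r0 p unfolding \<theta>_def by (simp add: field_simps)
  define K where "K = (2 powr \<beta> / ?\<omega>) powr (1 / p) + (1 / ?\<omega>) powr (1 / r)"
  have "2 powr \<beta> / ?\<omega> > 0" using \<omega> by (intro divide_pos_pos) auto
  then have "0 < (2 powr \<beta> / ?\<omega>) powr (1 / p)" by (metis less_irrefl powr_gt_zero)
  then have K: "K > 0" by (simp add: K_def add_pos_nonneg)
  show ?thesis
  proof (intro exI[of _ "(K powr r) powr (r / p)"] conjI allI impI)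
    show "(K powr r) powr (r / p) > 0" using K by simp
    fix g :: "'a \<Rightarrow> real" assume g: "lip_compact g"
    have p0: "0 < p" using p by simp
    define S where "S = (\<integral>x. \<bar>g x\<bar> powr r \<partial>lborel)"
    define G where "G x = (\<integral>y. gag p \<beta> g x y \<partial>lborel)" for x
    define E where "E = (\<integral>z. gag p \<beta> g (fst z) (snd z) \<partial>lborel)"
    have G0: "0 \<le> G x" for x unfolding G_def by (simp add: gag_def integral_nonneg_AE)
    have E0: "0 \<le> E" unfolding E_def by (simp add: gag_def integral_nonneg_AE)
    have S0: "0 \<le> S" unfolding S_def by (simp add: integral_nonneg_AE)
    note ir = lip_compact_powr_integrable[OF g r0]
    \<comment> \<open>At every radius, the oscillation about the mean is bounded by
      \<open>average_estimate\<close> and the mean itself by Jensen with exponent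
      \<open>r\<close>.\<close>
    have est: "\<bar>g x\<bar> \<le> (2 powr \<beta> / ?\<omega> * h powr (p * s) * G x) powr (1 / p) + (S / (?\<omega> * h powr ?n)) powr (1 / r)"
      if h: "0 < h" for x h
    proof -
      let ?m = "(\<integral>y. indicator (cball x h) y * g y \<partial>lborel) / measure lborel (cball x h)"
      have A: "measure lborel (cball x h) = ?\<omega> * h powr ?n" using h by (simp add: content_cball powr_realpow)
      have 1: "\<bar>g x - ?m\<bar> powr p \<le> 2 powr \<beta> / ?\<omega> * h powr (p * s) * G x"
        unfolding G_def using h by (intro average_estimate[OF g p s \<beta>]) auto
      have "\<bar>g x - ?m\<bar> = (\<bar>g x - ?m\<bar> powr p) powr (1 / p)" using p0 by (simp add: powr_powr)
      also have "\<dots> \<le> (2 powr \<beta> / ?\<omega> * h powr (p * s) * G x) powr (1 / p)"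
        using 1 p0 by (intro powr_mono2) auto
      finally have 1: "\<bar>g x - ?m\<bar> \<le> (2 powr \<beta> / ?\<omega> * h powr (p * s) * G x) powr (1 / p)" .
      have i2: "integrable lborel (\<lambda>y. indicator (cball x h) y * \<bar>g y\<bar> powr r)"
        and i3: "integrable lborel (\<lambda>y. indicator (cball x h) y * g y)"
        using lip_compact_integrable_ball[OF g r0, of x h 0] by auto
      have "\<bar>?m\<bar> powr r \<le> (\<integral>y. indicator (cball x h) y * \<bar>g y\<bar> powr r \<partial>lborel) / measure lborel (cball x h)"
        by (rule jensen_average) (use i2 i3 p pr h emeasure_lborel_cball_finite[of x h] in auto)
      also have "\<dots> \<le> S / measure lborel (cball x h)"
        unfolding S_def by (intro divide_right_mono integral_mono i2 ir) (auto simp: indicator_def)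
      finally have "(\<bar>?m\<bar> powr r) powr (1 / r) \<le> (S / (?\<omega> * h powr ?n)) powr (1 / r)"
        unfolding A using r0 by (intro powr_mono2) auto
      then have "\<bar>?m\<bar> \<le> (S / (?\<omega> * h powr ?n)) powr (1 / r)" using r0 by (simp add: powr_powr)
      with 1 show ?thesis by linarith
    qed
    have pt: "\<bar>g x\<bar> powr r \<le> K powr r * S powr (1 - \<theta>) * G x" if S: "0 < S" for x
    proof (cases "G x = 0")
      case False
      then have G: "G x > 0" using G0[of x] by simp
      \<comment> \<open>\<open>Y\<close> is the value of h^n at which both terms of
        \<open>est\<close> become constants times \<open>X powr (1 / r)\<close>; the constants add
        up to \<open>K\<close>.\<close>
      define Y where "Y = S powr \<theta> / G x"
      define X where "X = S powr (1 - \<theta>) * G x"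
      have Y: "Y > 0" and X: "X > 0" using S G by (auto simp: Y_def X_def)
      define h where "h = Y powr (1 / ?n)"
      have h: "h > 0" using Y by (simp add: h_def)
      have hn: "h powr ?n = Y" using Y by (simp add: h_def powr_powr)
      have SY: "S / Y = X" using S G by (simp add: Y_def X_def powr_diff)
      have t2: "S / (?\<omega> * h powr ?n) = 1 / ?\<omega> * X" unfolding hn SY[symmetric] by simp
      have "h powr (p * s) = Y powr (1 - \<theta>)" unfolding h_def using n by (simp add: powr_powr th)
      also have "\<dots> * G x = X powr \<theta>"
        using S G by (simp add: Y_def X_def powr_divide powr_mult powr_powr powr_diff mult.commute)
      finally have t1: "2 powr \<beta> / ?\<omega> * h powr (p * s) * G x = 2 powr \<beta> / ?\<omega> * X powr \<theta>" by (simp add: mult.assoc)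
      have "(X powr \<theta>) powr (1 / p) = X powr (1 / r)" using p0 by (simp add: powr_powr \<theta>_def)
      moreover have "(2 powr \<beta> / ?\<omega> * X powr \<theta>) powr (1 / p) = (2 powr \<beta> / ?\<omega>) powr (1 / p) * (X powr \<theta>) powr (1 / p)"
        by (rule powr_mult)
      moreover have "(1 / ?\<omega> * X) powr (1 / r) = (1 / ?\<omega>) powr (1 / r) * X powr (1 / r)"
        by (rule powr_mult)
      ultimately have "\<bar>g x\<bar> \<le> K * X powr (1 / r)"
        using est[OF h, of x] unfolding t1 t2 K_def distrib_right by presburger
      then have "\<bar>g x\<bar> powr r \<le> (K * X powr (1 / r)) powr r"
        using r0 by (intro powr_mono2) auto
      also have "\<dots> = K powr r * X" using K X r0 by (simp add: powr_mult powr_powr)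
      finally show ?thesis by (simp add: X_def)
    next
      \<comment> \<open>Without oscillation only the mean remains in \<open>est\<close>, and its
        bound is arbitrarily small for large radii. The \<open>h\<close> below is so large that the
        bound drops below \<open>\<bar>g x\<bar>\<close>.\<close>
      case True
      have "g x = 0"
      proof (rule ccontr)
        assume gx: "g x \<noteq> 0"
        define h where "h = ((S + 1) / (?\<omega> * \<bar>g x\<bar> powr r)) powr (1 / ?n)"
        have pos: "0 < (S + 1) / (?\<omega> * \<bar>g x\<bar> powr r)" using S0 \<omega> \<omega>0 gx by simp
        have h: "h > 0" using pos unfolding h_def by (metis less_numeral_extra(3) powr_gt_zero)
        have hn: "h powr ?n = (S + 1) / (?\<omega> * \<bar>g x\<bar> powr r)" using pos n S0 unfolding h_def by (simp add: powr_powr)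
        have "\<bar>g x\<bar> \<le> (S / (?\<omega> * h powr ?n)) powr (1 / r)" using est[OF h, of x] True by simp
        also have "S / (?\<omega> * h powr ?n) = S / (S + 1) * \<bar>g x\<bar> powr r"
          unfolding hn using \<omega> \<omega>0 gx S0 by simp
        also have "(S / (S + 1) * \<bar>g x\<bar> powr r) powr (1 / r) = (S / (S + 1)) powr (1 / r) * \<bar>g x\<bar>"
          using r0 by (subst powr_mult) (simp add: powr_powr)
        also have "\<dots> < 1 * \<bar>g x\<bar>"
        proof (rule mult_strict_right_mono)
          have "S / (S + 1) < 1" using S0 by simp
          then show "(S / (S + 1)) powr (1 / r) < 1"
            using S0 r0 powr_less_mono2[of "1 / r" "S / (S + 1)" 1] by simp
        qed (use gx in auto)
        finally show False by simp
      qed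
      then show ?thesis using K G0 S0 by simp
    qed
    show "(\<integral>x. \<bar>g x\<bar> powr r \<partial>lborel) \<le> (K powr r) powr (r / p) * (\<integral>z. gag p \<beta> g (fst z) (snd z) \<partial>lborel) powr (r / p)"
      unfolding S_def[symmetric] E_def[symmetric]
    proof (cases "S = 0")
      case False
      then have S: "S > 0" using S0 by simp
      have "S \<le> (\<integral>x. K powr r * S powr (1 - \<theta>) * G x \<partial>lborel)"
        unfolding S_def using ir gag_fubini(1)[OF g p0 s \<beta>] pt[OF S]
        by (intro integral_mono) (auto simp: G_def[abs_def] S_def)
      also have "\<dots> = K powr r * S powr (1 - \<theta>) * E"
        unfolding E_def G_def using gag_fubini(2)[OF g p0 s \<beta>] by simp
      finally have le: "S \<le> K powr r * S powr (1 - \<theta>) * E" .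
      \<comment> \<open>\<open>S\<close> occurs on both sides of \<open>le\<close>; as it is a
        positive real number, its power \<open>1 - \<theta>\<close> can be divided out.\<close>
      have "S powr \<theta> * S powr (1 - \<theta>) \<le> (K powr r * E) * S powr (1 - \<theta>)"
        using le S by (simp add: powr_add[symmetric] mult_ac)
      then have "S powr \<theta> \<le> K powr r * E" using S by simp
      then have "(S powr \<theta>) powr (r / p) \<le> (K powr r * E) powr (r / p)"
        using r0 p0 by (intro powr_mono2) auto
      moreover have "(S powr \<theta>) powr (r / p) = S"
        using r0 p0 S by (simp add: powr_powr \<theta>_def)
      moreover have "(K powr r * E) powr (r / p) = (K powr r) powr (r / p) * E powr (r / p)"
        by (rule powr_mult)
      ultimately show "S \<le> (K powr r) powr (r / p) * E powr (r / p)"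
        by metis
    qed simp
  qed
qed

section \<open>The space of functions vanishing outside the domain\<close>

lemma AE_lebesgue_pair:
  assumes "AE x in (lebesgue :: 'a::euclidean_space measure). P x"
  shows "AE z in (lebesgue :: ('a \<times> 'a) measure). P (fst z) \<and> P (snd z)"
proof -
  have "AE x in (lborel :: 'a measure). P x" using assms by (simp add: AE_completion_iff)
  then obtain A where A: "{x \<in> space lborel. \<not> P x} \<subseteq> A" "A \<in> null_sets (lborel :: 'a measure)"
    unfolding eventually_ae_filter by blast
  have "A \<times> UNIV \<in> null_sets (lborel \<Otimes>\<^sub>M (lborel :: 'a measure))"
    "UNIV \<times> A \<in> null_sets ((lborel :: 'a measure) \<Otimes>\<^sub>M lborel)"
    using A(2) by auto
  then have "A \<times> UNIV \<union> UNIV \<times> A \<in> null_sets (lborel :: ('a \<times> 'a) measure)"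
    by (simp add: lborel_prod null_sets.Un)
  then have "AE z in (lborel :: ('a \<times> 'a) measure). P (fst z) \<and> P (snd z)"
    by (rule AE_I') (use A(1) in auto)
  then show ?thesis by (simp add: AE_completion_iff)
qed

text \<open>Between completions it suffices that the projections are Borel measurable and that
  preimages of null sets are null; these preimages are products of a null set with the whole
  space.\<close>

lemma measurable_fst_lebesgue: "fst \<in> (lebesgue :: ('a::euclidean_space \<times> 'a) measure) \<rightarrow>\<^sub>M lebesgue"
  and measurable_snd_lebesgue: "snd \<in> (lebesgue :: ('a::euclidean_space \<times> 'a) measure) \<rightarrow>\<^sub>M lebesgue"
proof -
  have b: "fst \<in> (lborel :: ('a \<times> 'a) measure) \<rightarrow>\<^sub>M lborel" "snd \<in> (lborel :: ('a \<times> 'a) measure) \<rightarrow>\<^sub>M lborel"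
    by (simp_all add: borel_measurable_continuous_onI continuous_on_fst continuous_on_snd)
  then have m: "fst \<in> (lebesgue :: ('a \<times> 'a) measure) \<rightarrow>\<^sub>M lborel" "snd \<in> (lebesgue :: ('a \<times> 'a) measure) \<rightarrow>\<^sub>M lborel"
    by (auto intro: measurable_completion)
  have "fst -` A \<in> null_sets (lebesgue :: ('a \<times> 'a) measure)" "snd -` A \<in> null_sets (lebesgue :: ('a \<times> 'a) measure)"
    if A: "A \<in> null_sets (lborel :: 'a measure)" for A
  proof -
    have "A \<times> UNIV \<in> null_sets (lborel \<Otimes>\<^sub>M (lborel :: 'a measure))"
      "UNIV \<times> A \<in> null_sets ((lborel :: 'a measure) \<Otimes>\<^sub>M lborel)"
      using A by auto
    moreover have "fst -` A = A \<times> (UNIV :: 'a set)" "snd -` A = (UNIV :: 'a set) \<times> A" by auto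
    ultimately show "fst -` A \<in> null_sets (lebesgue :: ('a \<times> 'a) measure)" "snd -` A \<in> null_sets (lebesgue :: ('a \<times> 'a) measure)"
      by (auto simp: lborel_prod intro: null_sets_completionI)
  qed
  then have "null_sets lborel \<subseteq> null_sets (distr lebesgue lborel (fst :: 'a \<times> 'a \<Rightarrow> 'a))"
    "null_sets lborel \<subseteq> null_sets (distr lebesgue lborel (snd :: 'a \<times> 'a \<Rightarrow> 'a))"
    using m null_setsD2[of _ "lborel :: 'a measure"] by (auto simp: null_sets_distr_iff)
  then show "fst \<in> (lebesgue :: ('a \<times> 'a) measure) \<rightarrow>\<^sub>M lebesgue" "snd \<in> (lebesgue :: ('a \<times> 'a) measure) \<rightarrow>\<^sub>M lebesgue"
    using m by (auto intro: completion.measurable_completion2)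
qed

lemma Lp_tendsto_zero_AE_subseq:
  fixes w :: "nat \<Rightarrow> 'a \<Rightarrow> real"
  assumes p: "0 < p" and i: "\<And>k. integrable M (\<lambda>x. \<bar>w k x\<bar> powr p)"
    and l: "(\<lambda>k. \<integral>x. \<bar>w k x\<bar> powr p \<partial>M) \<longlonglongrightarrow> 0"
  shows "\<exists>\<sigma>. strict_mono \<sigma> \<and> (AE x in M. (\<lambda>k. w (\<sigma> k) x) \<longlonglongrightarrow> 0)"
proof -
  obtain \<sigma> where \<sigma>: "strict_mono \<sigma>" "AE x in M. (\<lambda>k. \<bar>w (\<sigma> k) x\<bar> powr p) \<longlonglongrightarrow> 0"
    using tendsto_L1_AE_subseq[of M "\<lambda>k x. \<bar>w k x\<bar> powr p"] i l by auto
  have "AE x in M. (\<lambda>k. w (\<sigma> k) x) \<longlonglongrightarrow> 0"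
    using \<sigma>(2)
  proof eventually_elim
    case (elim x)
    have "(\<lambda>k. \<bar>\<bar>w (\<sigma> k) x\<bar> powr p\<bar> powr (1 / p)) \<longlonglongrightarrow> \<bar>0\<bar> powr (1 / p)"
      by (rule abs_powr_tendsto[OF _ elim]) (use p in simp)
    moreover have "\<bar>\<bar>y\<bar> powr p\<bar> powr (1 / p) = \<bar>y\<bar>" for y :: real using p by (simp add: powr_powr)
    ultimately have "(\<lambda>k. \<bar>w (\<sigma> k) x\<bar>) \<longlonglongrightarrow> 0" by simp
    then show ?case by (rule tendsto_rabs_zero_cancel)
  qed
  with \<sigma>(1) show ?thesis by blast
qed

lemma test_function_lip_compact:
  assumes "g \<in> test_functions \<Omega>" shows "lip_compact g"
proof -
  obtain K where K: "compact K" "\<And>x. x \<notin> K \<Longrightarrow> g x = 0"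
    using assms by (auto elim!: test_functionsE)
  obtain R where "\<And>x. x \<in> K \<Longrightarrow> norm x \<le> R"
    using compact_imp_bounded[OF K(1)] by (auto simp: bounded_iff)
  then show ?thesis
    using test_function_lipschitz[OF assms] K(2) unfolding lip_compact_def by (metis not_le)
qed

lemma test_function_zero_outside: "g \<in> test_functions \<Omega> \<Longrightarrow> x \<notin> \<Omega> \<Longrightarrow> g x = 0"
  by (auto elim!: test_functionsE)

lemma lebesgue_on_eq_lborel:
  fixes h :: "'a::euclidean_space \<Rightarrow> real"
  assumes i: "integrable lborel h" and 0: "\<And>x. x \<notin> S \<Longrightarrow> h x = 0" and S: "S \<in> sets lebesgue"
  shows "integrable (lebesgue_on S) h" "(\<integral>x. h x \<partial>lebesgue_on S) = (\<integral>x. h x \<partial>lborel)"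
proof -
  have h: "h \<in> borel_measurable lborel" using i by auto
  have eq: "(\<lambda>x. indicator S x * h x) = h" 
  proof
    fix x show "indicator S x * h x = h x" using 0[of x] by (cases "x \<in> S") auto
  qed
  show "integrable (lebesgue_on S) h"
    using i S h by (subst integrable_restrict_space) (simp_all add: eq integrable_completion)
  show "(\<integral>x. h x \<partial>lebesgue_on S) = (\<integral>x. h x \<partial>lborel)"
    using S h by (subst integral_restrict_space) (simp_all add: eq integral_completion)
qed

locale fractional_setting =
  fixes \<Omega> :: "(real ^ 'n) set" and s p r :: real
  assumes s: "0 < s" "s < 1" and p: "2 \<le> p" and ps: "p * s < real CARD('n)"
    and r: "r = crit_exponent (real CARD('n)) s p"
    and \<Omega>: "open \<Omega>" "bounded \<Omega>" "\<Omega> \<noteq> {}"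
begin

abbreviation M :: "(real ^ 'n) measure" where "M \<equiv> lebesgue_on \<Omega>"
abbreviation N :: "((real ^ 'n) \<times> (real ^ 'n)) measure" where "N \<equiv> lebesgue_on (Qset \<Omega>)"
abbreviation T :: "(real ^ 'n \<Rightarrow> real) set" where "T \<equiv> test_functions \<Omega>"
abbreviation X0 :: "(real ^ 'n \<Rightarrow> real) set" where "X0 \<equiv> X0space s p \<Omega>"

text \<open>The signed quotient, linear in \<open>u\<close>; the exponent n / p + s makes
  \<open>\<bar>D u z\<bar> powr p\<close> the Gagliardo integrand.\<close>

definition D :: "(real ^ 'n \<Rightarrow> real) \<Rightarrow> (real ^ 'n) \<times> (real ^ 'n) \<Rightarrow> real" where
  "D u z = (u (fst z) - u (snd z)) / norm (fst z - snd z) powr (real CARD('n) / p + s)"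

definition E :: "(real ^ 'n \<Rightarrow> real) \<Rightarrow> real" where "E u = (\<integral>z. \<bar>D u z\<bar> powr p \<partial>N)"
definition L :: "(real ^ 'n \<Rightarrow> real) \<Rightarrow> real" where "L u = (\<integral>x. \<bar>u x\<bar> powr p \<partial>M)"

lemma r_gt: "p < r" "0 < r"
proof -
  have "1 < real CARD('n) / (real CARD('n) - p * s)" using ps s p by (simp add: field_simps)
  then have "p * 1 < p * (real CARD('n) / (real CARD('n) - p * s))" using p by (intro mult_strict_left_mono) auto
  then show "p < r" by (simp add: r crit_exponent_def mult.commute)
  then show "0 < r" using p by simp
qed

section \<open>The spaces in terms of the p-th powers \<open>L\<close> and \<open>E\<close>\<close>

lemma E_nonneg: "0 \<le> E u" and L_nonneg: "0 \<le> L u"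
  by (simp_all add: E_def L_def integral_nonneg_AE)

lemma \<Omega>_lebesgue: "\<Omega> \<in> sets lebesgue" using \<Omega> by (simp add: borel_open)

lemma Q_lebesgue: "Qset \<Omega> \<in> sets lebesgue"
proof -
  have "Qset \<Omega> = (\<Omega> \<times> UNIV) \<union> (UNIV \<times> \<Omega>)" by (auto simp: Qset_def)
  then have "open (Qset \<Omega>)" using \<Omega> by (auto intro: open_Times)
  then show ?thesis by (simp add: borel_open)
qed

lemma finite_M: "emeasure M \<Omega> < \<infinity>" "finite_measure M"
proof -
  have "\<Omega> \<in> lmeasurable" using \<Omega> by (intro lmeasurable_open)
  then show "finite_measure M" by (rule finite_measure_lebesgue_on)
  then show "emeasure M \<Omega> < \<infinity>"
    using finite_measure.emeasure_finite[of M \<Omega>] by (simp add: less_top)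
qed

lemma D_powr: "\<bar>D u z\<bar> powr p = \<bar>u (fst z) - u (snd z)\<bar> powr p / norm (fst z - snd z) powr (real CARD('n) + p * s)"
proof -
  have "(real CARD('n) / p + s) * p = real CARD('n) + p * s" using p by (simp add: field_simps)
  then show ?thesis by (simp add: D_def abs_divide powr_divide powr_powr)
qed

lemma D_lin: "D (\<lambda>x. u x + c * v x) z = D u z + c * D v z"
  by (simp add: D_def add_divide_distrib[symmetric] diff_divide_distrib algebra_simps)

lemma D_diff: "D (\<lambda>x. u x - v x) z = D u z - D v z"
  using D_lin[of u "-1" v z] by simp

lemma D_contraction:
  assumes "\<And>x y. \<bar>v x - v y\<bar> \<le> \<bar>u x - u y\<bar>"
  shows "\<bar>D v z\<bar> \<le> \<bar>D u z\<bar>"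
  using assms by (simp add: D_def abs_divide divide_right_mono)

lemma lebesgue_M: "u \<in> borel_measurable lebesgue \<Longrightarrow> u \<in> borel_measurable M"
  by (simp add: measurable_restrict_space1)

lemma D_measurable:
  assumes [measurable]: "u \<in> borel_measurable lebesgue"
  shows "D u \<in> borel_measurable N"
proof -
  have [measurable]: "(\<lambda>z. u (fst z)) \<in> borel_measurable (lebesgue :: ((real ^ 'n) \<times> (real ^ 'n)) measure)"
    "(\<lambda>z. u (snd z)) \<in> borel_measurable (lebesgue :: ((real ^ 'n) \<times> (real ^ 'n)) measure)"
    using measurable_compose[OF measurable_fst_lebesgue assms] measurable_compose[OF measurable_snd_lebesgue assms] by auto
  have [measurable]: "(\<lambda>z. norm (fst z - snd z)) \<in> borel_measurable (lebesgue :: ((real ^ 'n) \<times> (real ^ 'n)) measure)"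
    by (intro measurable_completion) (auto intro!: borel_measurable_continuous_onI continuous_intros)
  have "D u \<in> borel_measurable lebesgue" unfolding D_def by measurable
  then show ?thesis by (rule measurable_restrict_space1)
qed

lemma Xspace_iff:
  "u \<in> Xspace s p \<Omega> \<longleftrightarrow> u \<in> borel_measurable lebesgue \<and> integrable M (\<lambda>x. \<bar>u x\<bar> powr p) \<and>
     integrable N (\<lambda>z. \<bar>D u z\<bar> powr p)"
proof -
  have "(\<lambda>(x, y). (u x - u y) / norm (x - y) powr (real CARD('n) / p + s)) = D u"
    by (auto simp: D_def)
  then show ?thesis
    using lebesgue_M D_measurable by (auto simp: Xspace_def Lspace_on_def)
qed

lemma Qenergy_eq: "Qenergy s p \<Omega> u = E u"
  unfolding Qenergy_def E_def D_powr by (simp add: case_prod_unfold)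

lemma Xnorm_less_iff: assumes "0 < e" shows "Xnorm s p \<Omega> u < e \<longleftrightarrow> L u + E u < e powr p"
proof -
  have 0: "0 \<le> L u + E u" using L_nonneg E_nonneg by simp
  have eq: "Xnorm s p \<Omega> u = (L u + E u) powr (1 / p)"
    by (simp add: Xnorm_def Qenergy_eq L_def)
  have e: "e = (e powr p) powr (1 / p)" using assms p by (simp add: powr_powr)
  show ?thesis
  proof
    assume "Xnorm s p \<Omega> u < e"
    then have "((L u + E u) powr (1 / p)) powr p < e powr p"
      unfolding eq using p by (intro powr_less_mono2) auto
    then show "L u + E u < e powr p" using 0 p by (simp add: powr_powr)
  next
    assume "L u + E u < e powr p"
    then have "(L u + E u) powr (1 / p) < (e powr p) powr (1 / p)"
      using 0 p by (intro powr_less_mono2) auto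
    then show "Xnorm s p \<Omega> u < e" unfolding eq using e by simp
  qed
qed

text \<open>The closure is rewritten without p-th roots. For the sums of p-th powers
  \<open>Xspace_lin\<close>, with its factor \<open>2 powr p\<close>, plays the role of the triangle
  inequality.\<close>

lemma X0_iff: "u \<in> X0 \<longleftrightarrow> u \<in> Xspace s p \<Omega> \<and> (\<forall>e>0. \<exists>\<phi>\<in>T. L (\<lambda>x. u x - \<phi> x) + E (\<lambda>x. u x - \<phi> x) < e)"
proof -
  have "(\<forall>e>0. \<exists>\<phi>\<in>T. Xnorm s p \<Omega> (\<lambda>x. u x - \<phi> x) < e) \<longleftrightarrow> (\<forall>e>0. \<exists>\<phi>\<in>T. L (\<lambda>x. u x - \<phi> x) + E (\<lambda>x. u x - \<phi> x) < e)"
    (is "?A \<longleftrightarrow> ?B")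
  proof
    assume A: ?A
    show ?B
    proof (intro allI impI)
      fix e :: real assume e: "0 < e"
      then have "0 < e powr (1 / p)" by simp
      with A obtain \<phi> where "\<phi> \<in> T" "Xnorm s p \<Omega> (\<lambda>x. u x - \<phi> x) < e powr (1 / p)" by blast
      then show "\<exists>\<phi>\<in>T. L (\<lambda>x. u x - \<phi> x) + E (\<lambda>x. u x - \<phi> x) < e"
        using e p by (intro bexI[of _ \<phi>]) (auto simp: Xnorm_less_iff powr_powr)
    qed
  next
    assume B: ?B
    show ?A
    proof (intro allI impI)
      fix e :: real assume e: "0 < e"
      then have "0 < e powr p" by simp
      with B obtain \<phi> where "\<phi> \<in> T" "L (\<lambda>x. u x - \<phi> x) + E (\<lambda>x. u x - \<phi> x) < e powr p" by blast
      then show "\<exists>\<phi>\<in>T. Xnorm s p \<Omega> (\<lambda>x. u x - \<phi> x) < e"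
        using e by (intro bexI[of _ \<phi>]) (auto simp: Xnorm_less_iff)
    qed
  qed
  then show ?thesis by (simp add: X0space_def)
qed

lemma X0D:
  assumes "u \<in> X0"
  shows "u \<in> borel_measurable lebesgue" "u \<in> borel_measurable M" "D u \<in> borel_measurable N"
    "integrable M (\<lambda>x. \<bar>u x\<bar> powr p)" "integrable N (\<lambda>z. \<bar>D u z\<bar> powr p)"
  using assms lebesgue_M D_measurable by (auto simp: X0_iff Xspace_iff)

lemma Xspace_lin:
  assumes u: "u \<in> Xspace s p \<Omega>" and v: "v \<in> Xspace s p \<Omega>"
  shows "(\<lambda>x. u x + c * v x) \<in> Xspace s p \<Omega>"
    and "L (\<lambda>x. u x + c * v x) \<le> 2 powr p * (L u + \<bar>c\<bar> powr p * L v)"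
    and "E (\<lambda>x. u x + c * v x) \<le> 2 powr p * (E u + \<bar>c\<bar> powr p * E v)"
proof -
  have [measurable]: "u \<in> borel_measurable lebesgue" "v \<in> borel_measurable lebesgue"
    and i: "integrable M (\<lambda>x. \<bar>u x\<bar> powr p)" "integrable M (\<lambda>x. \<bar>v x\<bar> powr p)"
      "integrable N (\<lambda>z. \<bar>D u z\<bar> powr p)" "integrable N (\<lambda>z. \<bar>D v z\<bar> powr p)"
    using u v by (auto simp: Xspace_iff)
  have j: "integrable M (\<lambda>x. \<bar>c * v x\<bar> powr p)" "integrable N (\<lambda>z. \<bar>c * D v z\<bar> powr p)"
    using i by (simp_all add: abs_mult powr_mult)
  have k: "(\<integral>x. \<bar>c * v x\<bar> powr p \<partial>M) = \<bar>c\<bar> powr p * L v" "(\<integral>z. \<bar>c * D v z\<bar> powr p \<partial>N) = \<bar>c\<bar> powr p * E v"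
    by (simp_all add: abs_mult powr_mult L_def E_def)
  have m: "u \<in> borel_measurable M" "(\<lambda>x. c * v x) \<in> borel_measurable M" "D u \<in> borel_measurable N" "(\<lambda>z. c * D v z) \<in> borel_measurable N"
    using lebesgue_M[of u] lebesgue_M[of v] D_measurable[of u] D_measurable[of v] by auto
  note A = integrable_abs_add_powr[OF _ m(1,2) i(1) j(1)] and B = integrable_abs_add_powr[OF _ m(3,4) i(3) j(2)]
  show "(\<lambda>x. u x + c * v x) \<in> Xspace s p \<Omega>"
    using A B p by (simp add: Xspace_iff D_lin)
  show "L (\<lambda>x. u x + c * v x) \<le> 2 powr p * (L u + \<bar>c\<bar> powr p * L v)"
    using A(2) p by (simp add: k) (simp add: L_def)
  show "E (\<lambda>x. u x + c * v x) \<le> 2 powr p * (E u + \<bar>c\<bar> powr p * E v)"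
    using B(2) p by (simp add: k) (simp add: E_def D_lin)
qed

lemma Xspace_diff:
  assumes "u \<in> Xspace s p \<Omega>" "v \<in> Xspace s p \<Omega>"
  shows "(\<lambda>x. u x - v x) \<in> Xspace s p \<Omega>"
    and "L (\<lambda>x. u x - v x) \<le> 2 powr p * (L u + L v)"
    and "E (\<lambda>x. u x - v x) \<le> 2 powr p * (E u + E v)"
  using Xspace_lin[OF assms, of "-1"] by simp_all

text \<open>Since \<open>g\<close> vanishes outside \<open>\<Omega>\<close>, the integrals may be
  taken over the whole space, where the estimates for Lipschitz functions apply.\<close>

lemma lip_compact_energy:
  assumes g: "lip_compact g" and 0: "\<And>x. x \<notin> \<Omega> \<Longrightarrow> g x = 0"
  shows "g \<in> Xspace s p \<Omega>"
    and "E g = (\<integral>z. gag p (real CARD('n) + p * s) g (fst z) (snd z) \<partial>lborel)"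
    and "0 < m \<Longrightarrow> integrable M (\<lambda>x. \<bar>g x\<bar> powr m)"
    and "0 < m \<Longrightarrow> (\<integral>x. \<bar>g x\<bar> powr m \<partial>M) = (\<integral>x. \<bar>g x\<bar> powr m \<partial>lborel)"
proof -
  have i: "integrable M (\<lambda>x. \<bar>g x\<bar> powr m)" if "0 < m" for m
    using lip_compact_powr_integrable[OF g that] 0 \<Omega>_lebesgue that by (intro lebesgue_on_eq_lborel) auto
  then show "0 < m \<Longrightarrow> integrable M (\<lambda>x. \<bar>g x\<bar> powr m)" .
  show "(\<integral>x. \<bar>g x\<bar> powr m \<partial>M) = (\<integral>x. \<bar>g x\<bar> powr m \<partial>lborel)" if "0 < m"
    using lip_compact_powr_integrable[OF g that] 0 \<Omega>_lebesgue that by (intro lebesgue_on_eq_lborel) auto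
  have Dg: "\<bar>D g z\<bar> powr p = gag p (real CARD('n) + p * s) g (fst z) (snd z)" for z by (simp add: D_powr gag_def)
  have ig: "integrable lborel (\<lambda>z. gag p (real CARD('n) + p * s) g (fst z) (snd z))"
    using g p s by (intro gag_integrable(1)) auto
  have z0: "gag p (real CARD('n) + p * s) g (fst z) (snd z) = 0" if "z \<notin> Qset \<Omega>" for z
    using that 0 by (auto simp: Qset_def gag_def)
  show "E g = (\<integral>z. gag p (real CARD('n) + p * s) g (fst z) (snd z) \<partial>lborel)"
    unfolding E_def Dg by (rule lebesgue_on_eq_lborel[OF ig z0 Q_lebesgue])
  have "integrable N (\<lambda>z. \<bar>D g z\<bar> powr p)"
    unfolding Dg by (rule lebesgue_on_eq_lborel[OF ig z0 Q_lebesgue])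
  moreover have "g \<in> borel_measurable lebesgue"
    by (rule lip_compactE[OF g]) (auto intro!: measurable_completion borel_measurable_continuous_onI)
  ultimately show "g \<in> Xspace s p \<Omega>"
    using i[of p] p by (auto simp: Xspace_iff)
qed

lemma T_lip_compact: assumes "\<phi> \<in> T" shows "lip_compact \<phi>" "\<And>x. x \<notin> \<Omega> \<Longrightarrow> \<phi> x = 0"
  using assms test_function_lip_compact test_function_zero_outside by auto

lemma T_Xspace: "\<phi> \<in> T \<Longrightarrow> \<phi> \<in> Xspace s p \<Omega>"
  by (intro lip_compact_energy T_lip_compact)

lemma T_subset_X0: "\<phi> \<in> T \<Longrightarrow> \<phi> \<in> X0"
  unfolding X0_iff using p by (auto intro!: T_Xspace bexI[of _ \<phi>] simp: L_def E_def D_def)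

lemma X0_lin:
  assumes u: "u \<in> X0" and v: "v \<in> X0"
  shows "(\<lambda>x. u x + c * v x) \<in> X0"
  unfolding X0_iff
proof (intro conjI allI impI)
  have X: "u \<in> Xspace s p \<Omega>" "v \<in> Xspace s p \<Omega>" using u v by (auto simp: X0_iff)
  then show "(\<lambda>x. u x + c * v x) \<in> Xspace s p \<Omega>" by (rule Xspace_lin)
  fix e :: real assume e: "0 < e"
  define d where "d = e / (2 powr p * (1 + \<bar>c\<bar> powr p))"
  have c: "0 < 1 + \<bar>c\<bar> powr p" by (simp add: add_pos_nonneg)
  have d: "0 < d" using e c by (simp add: d_def)
  obtain \<phi> where \<phi>: "\<phi> \<in> T" "L (\<lambda>x. u x - \<phi> x) + E (\<lambda>x. u x - \<phi> x) < d" using u d unfolding X0_iff by blast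
  obtain \<psi> where \<psi>: "\<psi> \<in> T" "L (\<lambda>x. v x - \<psi> x) + E (\<lambda>x. v x - \<psi> x) < d" using v d unfolding X0_iff by blast
  let ?a = "\<lambda>x. u x - \<phi> x" and ?b = "\<lambda>x. v x - \<psi> x"
  have ab: "?a \<in> Xspace s p \<Omega>" "?b \<in> Xspace s p \<Omega>" using Xspace_diff X T_Xspace \<phi> \<psi> by auto
  have eq: "(\<lambda>x. u x + c * v x - (\<phi> x + c * \<psi> x)) = (\<lambda>x. ?a x + c * ?b x)" by (auto simp: algebra_simps)
  have "L (\<lambda>x. ?a x + c * ?b x) + E (\<lambda>x. ?a x + c * ?b x) \<le> 2 powr p * (L ?a + \<bar>c\<bar> powr p * L ?b) + 2 powr p * (E ?a + \<bar>c\<bar> powr p * E ?b)"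
    by (intro add_mono Xspace_lin ab)
  also have "\<dots> = 2 powr p * ((L ?a + E ?a) + \<bar>c\<bar> powr p * (L ?b + E ?b))" by (simp add: algebra_simps)
  also have "\<dots> < 2 powr p * (d + \<bar>c\<bar> powr p * d)"
    using \<phi>(2) \<psi>(2) by (intro mult_strict_left_mono add_less_le_mono mult_left_mono) auto
  also have "\<dots> = 2 powr p * (1 + \<bar>c\<bar> powr p) * d" by (simp add: algebra_simps)
  also have "\<dots> = e" using c by (simp add: d_def)
  finally have "L (\<lambda>x. ?a x + c * ?b x) + E (\<lambda>x. ?a x + c * ?b x) < e" .
  then show "\<exists>\<eta>\<in>T. L (\<lambda>x. u x + c * v x - \<eta> x) + E (\<lambda>x. u x + c * v x - \<eta> x) < e"
    unfolding eq[symmetric] by (intro bexI[OF _ test_functions_lin[OF \<phi>(1) \<psi>(1), of c]])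
qed

section \<open>Almost everywhere limits, Sobolev and Poincare inequalities on
  \<open>X0\<close>\<close>

lemma AE_N_of_lebesgue:
  assumes "AE x in lebesgue. P x"
  shows "AE z in N. P (fst z) \<and> P (snd z)"
  using AE_lebesgue_pair[OF assms] by (subst AE_restrict_space_iff) (auto simp: Q_lebesgue)

lemma AE_M_of_lebesgue:
  assumes "AE x in lebesgue. P x"
  shows "AE x in M. P x"
  using assms \<Omega>_lebesgue by (subst AE_restrict_space_iff) auto

lemma D_tendsto:
  assumes "(\<lambda>k. u k (fst z)) \<longlonglongrightarrow> v (fst z)" "(\<lambda>k. u k (snd z)) \<longlonglongrightarrow> v (snd z)"
  shows "(\<lambda>k. D (u k) z) \<longlonglongrightarrow> D v z"
proof (cases "norm (fst z - snd z) powr (real CARD('n) / p + s) = 0")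
  case False
  then show ?thesis unfolding D_def by (intro tendsto_intros assms)
qed (simp add: D_def)

lemma D_AE_tendsto:
  assumes "AE x in lebesgue. (\<lambda>k. u k x) \<longlonglongrightarrow> v x"
  shows "AE z in N. (\<lambda>k. D (u k) z) \<longlonglongrightarrow> D v z"
  using AE_N_of_lebesgue[OF assms] by eventually_elim (auto intro: D_tendsto)

text \<open>Letting \<open>D\<close> of the approximating test functions converge almost everywhere on
  \<open>\<Omega> \<times> (UNIV - \<Omega>)\<close>, where they see only their values in \<open>\<Omega>\<close>, forces \<open>u = 0\<close> outside.\<close>

lemma X0_approx:
  assumes u: "u \<in> X0"
  shows "AE x in lebesgue. x \<notin> \<Omega> \<longrightarrow> u x = 0"
    and "\<exists>\<phi>. (\<forall>k. \<phi> k \<in> T) \<and> (AE x in lebesgue. (\<lambda>k. \<phi> k x) \<longlonglongrightarrow> u x) \<and>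
      (\<lambda>k. E (\<phi> k)) \<longlonglongrightarrow> E u \<and> (\<lambda>k. L (\<lambda>x. u x - \<phi> k x) + E (\<lambda>x. u x - \<phi> k x)) \<longlonglongrightarrow> 0"
proof -
  have X: "u \<in> Xspace s p \<Omega>" using u by (simp add: X0_iff)
  have p0: "0 < p" using p by simp
  have "\<forall>k. \<exists>\<phi>\<in>T. L (\<lambda>x. u x - \<phi> x) + E (\<lambda>x. u x - \<phi> x) < 1 / real (Suc k)"
    using u unfolding X0_iff by simp
  then obtain f where f: "\<And>k. f k \<in> T" "\<And>k. L (\<lambda>x. u x - f k x) + E (\<lambda>x. u x - f k x) < 1 / real (Suc k)"
    by metis
  have lim: "(\<lambda>k. L (\<lambda>x. u x - f k x) + E (\<lambda>x. u x - f k x)) \<longlonglongrightarrow> 0"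
    by (rule tendsto_sandwich[OF _ _ tendsto_const LIMSEQ_inverse_real_of_nat])
      (use f(2) L_nonneg E_nonneg in \<open>auto intro!: always_eventually less_imp_le simp: inverse_eq_divide\<close>)
  have limL: "(\<lambda>k. L (\<lambda>x. u x - f k x)) \<longlonglongrightarrow> 0"
    by (rule tendsto_sandwich[OF _ _ tendsto_const lim]) (use L_nonneg E_nonneg in auto)
  have limE: "(\<lambda>k. E (\<lambda>x. u x - f k x)) \<longlonglongrightarrow> 0"
    by (rule tendsto_sandwich[OF _ _ tendsto_const lim]) (use L_nonneg E_nonneg in auto)
  have fX: "(\<lambda>x. u x - f k x) \<in> Xspace s p \<Omega>" for k using X f(1) T_Xspace Xspace_diff by auto
  obtain \<sigma>1 where \<sigma>1: "strict_mono \<sigma>1" "AE x in M. (\<lambda>k. u x - f (\<sigma>1 k) x) \<longlonglongrightarrow> 0"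
    using Lp_tendsto_zero_AE_subseq[OF p0, of M "\<lambda>k x. u x - f k x"] fX limL by (auto simp: Xspace_iff L_def)
  have "(\<lambda>k. E (\<lambda>x. u x - f (\<sigma>1 k) x)) \<longlonglongrightarrow> 0"
    using LIMSEQ_subseq_LIMSEQ[OF limE \<sigma>1(1)] by (simp add: comp_def)
  then obtain \<sigma>2 where \<sigma>2: "strict_mono \<sigma>2" "AE z in N. (\<lambda>k. D (\<lambda>x. u x - f (\<sigma>1 (\<sigma>2 k)) x) z) \<longlonglongrightarrow> 0"
    using Lp_tendsto_zero_AE_subseq[OF p0, of N "\<lambda>k. D (\<lambda>x. u x - f (\<sigma>1 k) x)"] fX by (auto simp: Xspace_iff E_def)
  define \<phi> where "\<phi> k = f (\<sigma>1 (\<sigma>2 k))" for k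
  have sm: "strict_mono (\<lambda>k. \<sigma>1 (\<sigma>2 k))" using \<sigma>1(1) \<sigma>2(1) by (simp add: strict_mono_def)
  have \<phi>T: "\<phi> k \<in> T" for k unfolding \<phi>_def by (rule f)
  have \<phi>\<Omega>: "AE x in lebesgue. x \<in> \<Omega> \<longrightarrow> (\<lambda>k. \<phi> k x) \<longlonglongrightarrow> u x"
  proof -
    have "AE x in lebesgue. x \<in> \<Omega> \<longrightarrow> (\<lambda>k. u x - f (\<sigma>1 k) x) \<longlonglongrightarrow> 0"
      using \<sigma>1(2) \<Omega>_lebesgue by (subst (asm) AE_restrict_space_iff) auto
    then show ?thesis
    proof eventually_elim
      case (elim x)
      show ?case
      proof
        assume "x \<in> \<Omega>"
        then have "(\<lambda>k. u x - f (\<sigma>1 k) x) \<longlonglongrightarrow> 0" using elim by simp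
        from LIMSEQ_subseq_LIMSEQ[OF this \<sigma>2(1)] have "(\<lambda>k. u x - \<phi> k x) \<longlonglongrightarrow> 0"
          by (simp add: comp_def \<phi>_def)
        from tendsto_diff[OF tendsto_const this, of "u x"] show "(\<lambda>k. \<phi> k x) \<longlonglongrightarrow> u x" by simp
      qed
    qed
  qed
  have "AE z in lebesgue. z \<in> Qset \<Omega> \<longrightarrow> (\<lambda>k. D (\<lambda>x. u x - \<phi> k x) z) \<longlonglongrightarrow> 0"
    using \<sigma>2(2) Q_lebesgue unfolding \<phi>_def by (subst (asm) AE_restrict_space_iff) auto
  then have "AE z in lebesgue. fst z \<in> \<Omega> \<longrightarrow> snd z \<notin> \<Omega> \<longrightarrow> u (snd z) = 0"
    using AE_lebesgue_pair[OF \<phi>\<Omega>]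
  proof eventually_elim
    case (elim z)
    show ?case
    proof (intro impI)
      assume z: "fst z \<in> \<Omega>" "snd z \<notin> \<Omega>"
      then have "z \<in> Qset \<Omega>" by (cases z) (auto simp: Qset_def)
      then have 1: "(\<lambda>k. D (\<lambda>x. u x - \<phi> k x) z) \<longlonglongrightarrow> 0" using elim by simp
      have 2: "(\<lambda>k. \<phi> k (fst z)) \<longlonglongrightarrow> u (fst z)" using elim z by simp
      \<comment> \<open>Multiplying by \<open>c\<close> undoes the quotient. The test function
        vanishes at \<open>snd z\<close> and converges at \<open>fst z\<close>, so only
        \<open>u (snd z)\<close> survives in the limit.\<close>
      define c where "c = norm (fst z - snd z) powr (real CARD('n) / p + s)"
      have c: "c > 0" using z by (auto simp: c_def)
      have "D (\<lambda>x. u x - \<phi> k x) z * c = u (fst z) - \<phi> k (fst z) - u (snd z)" for k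
        using c test_function_zero_outside[OF \<phi>T z(2)] by (simp add: D_def c_def)
      then have "(\<lambda>k. u (fst z) - \<phi> k (fst z) - u (snd z)) \<longlonglongrightarrow> 0"
        using tendsto_mult[OF 1 tendsto_const, of c] by simp
      moreover have "(\<lambda>k. u (fst z) - \<phi> k (fst z) - u (snd z)) \<longlonglongrightarrow> u (fst z) - u (fst z) - u (snd z)"
        by (intro tendsto_intros 2)
      ultimately show "u (snd z) = 0" using LIMSEQ_unique by fastforce
    qed
  qed
  then have "AE z in lborel \<Otimes>\<^sub>M lborel. fst z \<in> \<Omega> \<longrightarrow> snd z \<notin> \<Omega> \<longrightarrow> u (snd z) = 0"
    by (subst lborel_prod) (simp add: AE_completion_iff)
  then have "AE x in lborel. AE y in lborel. x \<in> \<Omega> \<longrightarrow> y \<notin> \<Omega> \<longrightarrow> u y = 0"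
    using lborel_pair.AE_pair by fastforce
  \<comment> \<open>The property holds on almost every slice. A slice through some point of
    \<open>\<Omega>\<close> is wanted, so \<open>\<Omega>\<close> must not be a null set.\<close>
  moreover have "\<not> (AE x in lborel. x \<notin> \<Omega>)"
  proof
    assume "AE x in lborel. x \<notin> \<Omega>"
    then have z: "\<Omega> \<in> null_sets lborel" using \<Omega> by (subst AE_iff_null_sets) (auto simp: borel_open)
    obtain x0 e where e: "e > 0" "cball x0 e \<subseteq> \<Omega>"
      using \<Omega> open_contains_cball[of \<Omega>] by blast
    then have "cball x0 e \<in> null_sets lborel" using z null_sets_subset[OF z] by auto
    then have "measure lborel (cball x0 e) = 0" by (auto simp: measure_def null_sets_def)
    then show False using e by simp
  qed
  ultimately obtain x where x: "x \<in> \<Omega>" "AE y in lborel. x \<in> \<Omega> \<longrightarrow> y \<notin> \<Omega> \<longrightarrow> u y = 0"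
    by (metis (mono_tags, lifting) eventually_mono)
  then show out: "AE x in lebesgue. x \<notin> \<Omega> \<longrightarrow> u x = 0"
    by (simp add: AE_completion_iff)
  have ae: "AE x in lebesgue. (\<lambda>k. \<phi> k x) \<longlonglongrightarrow> u x"
    using out \<phi>\<Omega>
  proof eventually_elim
    case (elim x)
    show ?case
    proof (cases "x \<in> \<Omega>")
      case False
      then have "\<phi> k x = 0" for k using test_function_zero_outside[OF \<phi>T] by auto
      then show ?thesis using elim False by simp
    qed (use elim in auto)
  qed
  have lim': "(\<lambda>k. L (\<lambda>x. u x - \<phi> k x) + E (\<lambda>x. u x - \<phi> k x)) \<longlonglongrightarrow> 0"
    using LIMSEQ_subseq_LIMSEQ[OF lim sm] by (simp add: comp_def \<phi>_def)
  have Elim: "(\<lambda>k. E (\<lambda>x. u x - \<phi> k x)) \<longlonglongrightarrow> 0"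
    using LIMSEQ_subseq_LIMSEQ[OF limE sm] by (simp add: comp_def \<phi>_def)
  have \<phi>X: "\<phi> k \<in> Xspace s p \<Omega>" for k using \<phi>T T_Xspace by auto
  obtain K where K: "\<And>k. E (\<phi> k) \<le> K"
  proof -
    obtain B where B: "\<And>k. E (\<lambda>x. u x - \<phi> k x) \<le> B"
      using convergent_imp_Bseq[of "\<lambda>k. E (\<lambda>x. u x - \<phi> k x)"] Elim E_nonneg
      unfolding convergent_def Bseq_def by auto
    have "E (\<phi> k) \<le> 2 powr p * (E u + B)" for k
    proof -
      have "E (\<phi> k) = E (\<lambda>x. u x - (u x - \<phi> k x))" by simp
      also have "\<dots> \<le> 2 powr p * (E u + E (\<lambda>x. u x - \<phi> k x))"
        by (intro Xspace_diff X \<phi>X)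
      also have "\<dots> \<le> 2 powr p * (E u + B)" using B by (intro mult_left_mono add_left_mono) auto
      finally show ?thesis .
    qed
    then show ?thesis by (rule that)
  qed
  \<comment> \<open>Brezis--Lieb stands in for continuity of the norm: the defect tends to 0 by
    \<open>Elim\<close>, so the energies themselves converge to \<open>E u\<close>.\<close>
  have "(\<lambda>k. E (\<phi> k) - (\<integral>z. \<bar>D (\<phi> k) z - D u z\<bar> powr p \<partial>N)) \<longlonglongrightarrow> E u"
    using brezis_lieb[of p "\<lambda>k. D (\<phi> k)" N "D u" K] p \<phi>X X K D_AE_tendsto[OF ae] D_measurable
    by (simp add: Xspace_iff E_def)
  then have "(\<lambda>k. E (\<phi> k) - E (\<lambda>x. u x - \<phi> k x)) \<longlonglongrightarrow> E u"
    by (simp add: E_def[of "\<lambda>x. u x - \<phi> k x" for k] D_diff abs_minus_commute)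
  from tendsto_add[OF this Elim] have "(\<lambda>k. E (\<phi> k)) \<longlonglongrightarrow> E u" by simp
  with \<phi>T ae lim' show "\<exists>\<phi>. (\<forall>k. \<phi> k \<in> T) \<and> (AE x in lebesgue. (\<lambda>k. \<phi> k x) \<longlonglongrightarrow> u x) \<and>
      (\<lambda>k. E (\<phi> k)) \<longlonglongrightarrow> E u \<and> (\<lambda>k. L (\<lambda>x. u x - \<phi> k x) + E (\<lambda>x. u x - \<phi> k x)) \<longlonglongrightarrow> 0"
    by blast
qed

text \<open>Density and Fatou. As the energies of the approximating test functions converge to
  \<open>E u\<close>, the constant survives up to \<open>e\<close>, along a tail whose start depends
  on \<open>e\<close>.\<close>

lemma X0_sobolev:
  "\<exists>C>0. \<forall>u\<in>X0. integrable M (\<lambda>x. \<bar>u x\<bar> powr r) \<and> (\<integral>x. \<bar>u x\<bar> powr r \<partial>M) \<le> C * E u powr (r / p)"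
proof -
  obtain C where C: "C > 0" "\<And>g :: real ^ 'n \<Rightarrow> real. lip_compact g \<Longrightarrow> (\<integral>x. \<bar>g x\<bar> powr r \<partial>lborel)
      \<le> C * (\<integral>z. gag p (real CARD('n) + p * s) g (fst z) (snd z) \<partial>lborel) powr (r / p)"
    using fractional_sobolev[where 'a="real ^ 'n", of p s r "real CARD('n) + p * s"] p s ps
    by (auto simp: r crit_exponent_def)
  have TS: "(\<integral>x. \<bar>g x\<bar> powr r \<partial>M) \<le> C * E g powr (r / p)" if "g \<in> T" for g
    using C(2)[OF T_lip_compact(1)[OF that]] lip_compact_energy(2,4)[OF T_lip_compact[OF that]] r_gt by simp
  have "integrable M (\<lambda>x. \<bar>u x\<bar> powr r) \<and> (\<integral>x. \<bar>u x\<bar> powr r \<partial>M) \<le> C * E u powr (r / p)" if u: "u \<in> X0" for u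
  proof -
    obtain \<phi> where \<phi>: "\<And>k. \<phi> k \<in> T" "AE x in lebesgue. (\<lambda>k. \<phi> k x) \<longlonglongrightarrow> u x" "(\<lambda>k. E (\<phi> k)) \<longlonglongrightarrow> E u"
      using X0_approx(2)[OF u] by blast
    have lim: "(\<lambda>k. C * E (\<phi> k) powr (r / p)) \<longlonglongrightarrow> C * E u powr (r / p)"
      using r_gt p E_nonneg by (intro tendsto_intros tendsto_powr2 \<phi>) (auto intro: always_eventually)
    have bound: "integrable M (\<lambda>x. \<bar>u x\<bar> powr r) \<and> (\<integral>x. \<bar>u x\<bar> powr r \<partial>M) \<le> C * E u powr (r / p) + e" if e: "0 < e" for e
    proof -
      have "eventually (\<lambda>k. C * E (\<phi> k) powr (r / p) < C * E u powr (r / p) + e) sequentially"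
        by (rule order_tendstoD(2)[OF lim]) (use e in simp)
      then obtain k0 where k0: "\<And>k. k \<ge> k0 \<Longrightarrow> C * E (\<phi> k) powr (r / p) < C * E u powr (r / p) + e"
        by (auto simp: eventually_sequentially)
      have le: "(\<integral>x. \<bar>\<phi> (k + k0) x\<bar> powr r \<partial>M) \<le> C * E u powr (r / p) + e" for k
        using TS[OF \<phi>(1), of "k + k0"] k0[of "k + k0"] by simp
      have i: "integrable M (\<lambda>x. \<bar>\<phi> (k + k0) x\<bar> powr r)" for k
        using lip_compact_energy(3)[OF T_lip_compact[OF \<phi>(1)]] r_gt by simp
      have ae: "AE x in M. (\<lambda>k. \<phi> (k + k0) x) \<longlonglongrightarrow> u x"
        using AE_M_of_lebesgue[OF \<phi>(2)] by eventually_elim (rule LIMSEQ_ignore_initial_segment)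
      show ?thesis
        using Lp_fatou_bound[of r u M "\<lambda>k. \<phi> (k + k0)", OF r_gt(2) X0D(2)[OF u] i le ae] by simp
    qed
    show ?thesis
    proof
      show "integrable M (\<lambda>x. \<bar>u x\<bar> powr r)" using bound[of 1] by simp
      show "(\<integral>x. \<bar>u x\<bar> powr r \<partial>M) \<le> C * E u powr (r / p)"
        by (rule field_le_epsilon) (use bound in blast)
    qed
  qed
  with C(1) show ?thesis by blast
qed

definition sobolev_const :: real where
  "sobolev_const = (SOME C. C > 0 \<and> (\<forall>u\<in>X0. integrable M (\<lambda>x. \<bar>u x\<bar> powr r) \<and> (\<integral>x. \<bar>u x\<bar> powr r \<partial>M) \<le> C * E u powr (r / p)))"

lemma sobolev_const: "sobolev_const > 0" "u \<in> X0 \<Longrightarrow> integrable M (\<lambda>x. \<bar>u x\<bar> powr r)"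
  "u \<in> X0 \<Longrightarrow> (\<integral>x. \<bar>u x\<bar> powr r \<partial>M) \<le> sobolev_const * E u powr (r / p)"
proof -
  have "sobolev_const > 0 \<and> (\<forall>u\<in>X0. integrable M (\<lambda>x. \<bar>u x\<bar> powr r) \<and> (\<integral>x. \<bar>u x\<bar> powr r \<partial>M) \<le> sobolev_const * E u powr (r / p))"
    unfolding sobolev_const_def by (rule someI_ex) (use X0_sobolev in blast)
  then show "sobolev_const > 0" "u \<in> X0 \<Longrightarrow> integrable M (\<lambda>x. \<bar>u x\<bar> powr r)"
    "u \<in> X0 \<Longrightarrow> (\<integral>x. \<bar>u x\<bar> powr r \<partial>M) \<le> sobolev_const * E u powr (r / p)" by auto
qed

text \<open>Where \<open>\<bar>u x\<bar> \<le> A\<close> the p-th power is at most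
  \<open>A powr p\<close>, elsewhere at most \<open>A powr (p - r) * \<bar>u x\<bar> powr r\<close>.
  With the level \<open>A powr p = E u\<close> the Sobolev inequality makes both contributions
  multiples of \<open>E u\<close>.\<close>

lemma poincare:
  assumes u: "u \<in> X0" shows "L u \<le> (measure M \<Omega> + sobolev_const) * E u"
proof -
  have p0: "0 < p" using p by simp
  have i1: "integrable M (\<lambda>_. c)" for c :: real
    using finite_measure.integrable_const[OF finite_M(2)] .
  have sp: "space M = \<Omega>" by simp
  have *: "L u \<le> measure M \<Omega> * A powr p + A powr (p - r) * (\<integral>x. \<bar>u x\<bar> powr r \<partial>M)" if A: "0 < A" for A
  proof -
    have "L u \<le> (\<integral>x. A powr p + A powr (p - r) * \<bar>u x\<bar> powr r \<partial>M)"
      unfolding L_def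
    proof (rule integral_mono)
      show "integrable M (\<lambda>x. A powr p + A powr (p - r) * \<bar>u x\<bar> powr r)"
        using i1 sobolev_const(2)[OF u] by simp
      fix x
      show "\<bar>u x\<bar> powr p \<le> A powr p + A powr (p - r) * \<bar>u x\<bar> powr r"
      proof (cases "\<bar>u x\<bar> \<le> A")
        case True
        then have "\<bar>u x\<bar> powr p \<le> A powr p" using p0 by (intro powr_mono2) auto
        then show ?thesis by (smt (verit) mult_nonneg_nonneg powr_ge_zero)
      next
        case False
        then have "\<bar>u x\<bar> powr p = \<bar>u x\<bar> powr (p - r) * \<bar>u x\<bar> powr r"
          using A by (simp flip: powr_add)
        also have "\<dots> \<le> A powr (p - r) * \<bar>u x\<bar> powr r"
          using False A r_gt by (intro mult_right_mono powr_mono2') auto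
        finally show ?thesis by (smt (verit) powr_ge_zero)
      qed
    qed (use X0D[OF u] in auto)
    also have "\<dots> = measure M \<Omega> * A powr p + A powr (p - r) * (\<integral>x. \<bar>u x\<bar> powr r \<partial>M)"
      using i1 sobolev_const(2)[OF u] by (simp add: mult.commute)
    finally show ?thesis .
  qed
  show ?thesis
  proof (cases "E u = 0")
    case True
    then have R0: "(\<integral>x. \<bar>u x\<bar> powr r \<partial>M) \<le> 0" using sobolev_const(3)[OF u] by simp
    moreover have "0 \<le> (\<integral>x. \<bar>u x\<bar> powr r \<partial>M)" by (simp add: integral_nonneg_AE)
    ultimately have R0: "(\<integral>x. \<bar>u x\<bar> powr r \<partial>M) = 0" by simp
    have "AE x in M. \<bar>u x\<bar> powr r = 0"
      using integral_nonneg_eq_0_iff_AE[OF sobolev_const(2)[OF u]] R0 by auto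
    then have "AE x in M. \<bar>u x\<bar> powr p = 0" by eventually_elim auto
    then have "L u = 0" unfolding L_def by (rule integral_eq_zero_AE)
    then show ?thesis using True by simp
  next
    case False
    then have E: "E u > 0" using E_nonneg[of u] by simp
    define A where "A = E u powr (1 / p)"
    have A: "A > 0" "A powr p = E u" using E p0 by (auto simp: A_def powr_powr)
    have "A powr (p - r) * (\<integral>x. \<bar>u x\<bar> powr r \<partial>M) \<le> A powr (p - r) * (sobolev_const * E u powr (r / p))"
      using sobolev_const(3)[OF u] by (intro mult_left_mono) auto
    also have "\<dots> = sobolev_const * (A powr (p - r) * A powr r)" using p0 by (simp add: A_def powr_powr)
    also have "\<dots> = sobolev_const * E u" using A by (simp flip: powr_add)
    finally show ?thesis using *[OF A(1)] A(2) by (simp add: algebra_simps)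
  qed
qed

text \<open>Closed under midpoints only, the one convex combination about which Clarkson's
  inequality speaks.\<close>

inductive_set tail_hull :: "(nat \<Rightarrow> real ^ 'n \<Rightarrow> real) \<Rightarrow> nat \<Rightarrow> (real ^ 'n \<Rightarrow> real) set"
  for u :: "nat \<Rightarrow> real ^ 'n \<Rightarrow> real" and m :: nat where
  base: "m \<le> k \<Longrightarrow> u k \<in> tail_hull u m"
| midpoint: "v \<in> tail_hull u m \<Longrightarrow> w \<in> tail_hull u m \<Longrightarrow> (\<lambda>x. (v x + w x) / 2) \<in> tail_hull u m"

lemma tail_hull_mono: "w \<in> tail_hull u l \<Longrightarrow> m \<le> l \<Longrightarrow> w \<in> tail_hull u m"
  by (induction rule: tail_hull.induct) (auto intro: tail_hull.intros)

lemma X0_midpoint: "v \<in> X0 \<Longrightarrow> w \<in> X0 \<Longrightarrow> (\<lambda>x. (v x + w x) / 2) \<in> X0"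
  using X0_lin[of v "\<lambda>x. v x + (-1) * w x" "- 1 / 2"] X0_lin[of v w "-1"]
  by (simp add: field_simps)

lemma E_clarkson:
  assumes "v \<in> X0" "w \<in> X0"
  shows "E (\<lambda>x. (v x + w x) / 2) + E (\<lambda>x. (v x - w x) / 2) \<le> (E v + E w) / 2"
proof -
  have D1: "D (\<lambda>x. (v x + w x) / 2) z = (D v z + D w z) / 2"
    and D2: "D (\<lambda>x. (v x - w x) / 2) z = (D v z - D w z) / 2" for z
    by (simp_all add: D_def add_divide_distrib[symmetric] diff_divide_distrib[symmetric] algebra_simps)
  have "(\<lambda>x. - 1 * w x) \<in> X0" using X0_lin[OF assms(2,2), of "-2"] by simp
  then have "(\<lambda>x. (v x + - 1 * w x) / 2) \<in> X0" by (rule X0_midpoint[OF assms(1)])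
  then have i2: "integrable N (\<lambda>z. \<bar>(D v z - D w z) / 2\<bar> powr p)"
    using X0D(5)[of "\<lambda>x. (v x - w x) / 2"] by (simp add: D2)
  have i1: "integrable N (\<lambda>z. \<bar>(D v z + D w z) / 2\<bar> powr p)"
    using X0D(5)[OF X0_midpoint[OF assms]] by (simp add: D1)
  have "E (\<lambda>x. (v x + w x) / 2) + E (\<lambda>x. (v x - w x) / 2) =
      (\<integral>z. \<bar>(D v z + D w z) / 2\<bar> powr p + \<bar>(D v z - D w z) / 2\<bar> powr p \<partial>N)"
    using i1 i2 by (simp add: E_def D1 D2)
  also have "\<dots> \<le> (\<integral>z. (\<bar>D v z\<bar> powr p + \<bar>D w z\<bar> powr p) / 2 \<partial>N)"
    using i1 i2 X0D(5)[OF assms(1)] X0D(5)[OF assms(2)] clarkson_pointwise[OF p]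
    by (intro integral_mono) auto
  also have "\<dots> = (E v + E w) / 2"
    using X0D(5)[OF assms(1)] X0D(5)[OF assms(2)] by (simp add: E_def)
  finally show ?thesis .
qed

text \<open>Mazur's argument without weak topology: in the midpoint-convex hulls of the tails, near
  minimisers of \<open>E\<close> form a Cauchy sequence by Clarkson's inequality, and they inherit the almost
  everywhere limit.\<close>

lemma X0_AE_closed:
  assumes u: "\<And>k. u k \<in> X0" and K: "\<And>k. E (u k) \<le> K"
    and v: "v \<in> borel_measurable lebesgue" and ae: "AE x in lebesgue. (\<lambda>k. u k x) \<longlonglongrightarrow> v x"
  shows "v \<in> X0"
proof -
  have p0: "0 < p" using p by simp
  let ?H = "tail_hull u"
  \<comment> \<open>Clarkson's inequality with the difference term dropped: a midpoint has at most
    the average energy.\<close>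
  have HX: "w \<in> X0 \<and> E w \<le> K" if "w \<in> ?H m" for w m
    using that
  proof induction
    case (base k) then show ?case using u K by auto
  next
    case (midpoint w1 w2)
    then show ?case
      using X0_midpoint[of w1 w2] E_clarkson[of w1 w2] E_nonneg[of "\<lambda>x. (w1 x - w2 x) / 2"] by auto
  qed
  \<comment> \<open>Intervals are convex, so closeness to \<open>c\<close> on a tail passes to its
    hull; this carries the almost everywhere limit over to the near minimisers.\<close>
  have Hpt: "\<bar>w x - c\<bar> \<le> e" if "w \<in> ?H m" "\<And>k. m \<le> k \<Longrightarrow> \<bar>u k x - c\<bar> \<le> e" for w m x c e
    using that(1)
  proof induction
    case (midpoint w1 w2)
    then show ?case by (simp add: abs_le_iff field_simps)
  qed (rule that(2))
  \<comment> \<open>The hulls shrink with \<open>m\<close>, so these infima increase; bounded by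
    \<open>K\<close>, they converge.\<close>
  define d where "d m = Inf (E ` ?H m)" for m
  have ne: "?H m \<noteq> {}" for m using tail_hull.base[of m m u] by auto
  have bdd: "bdd_below (E ` ?H m)" for m using E_nonneg by (intro bdd_belowI2[of _ 0]) auto
  have dK: "d m \<le> K" for m
    unfolding d_def using HX[OF tail_hull.base[OF order_refl]] bdd tail_hull.base[of m m u]
    by (metis (no_types, lifting) cINF_lower order_trans order_refl)
  have dle: "d m \<le> E w" if "w \<in> ?H m" for w m
    unfolding d_def using bdd that by (intro cINF_lower)
  have dmono: "d m \<le> d l" if "m \<le> l" for m l
    unfolding d_def using ne bdd tail_hull_mono[OF _ that] by (intro cINF_superset_mono) auto
  have "incseq d" using dmono by (simp add: incseq_def)
  then have "convergent d"
    using dK incseq_convergent[of d K] unfolding convergent_def by blast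
  then have dC: "Cauchy d" by (simp add: Cauchy_convergent_iff)
  have "\<exists>w\<in>?H m. E w < d m + 1 / real (Suc m)" for m
    using cInf_lessD[of "E ` ?H m" "d m + 1 / real (Suc m)"] ne unfolding d_def by auto
  then obtain w where w: "\<And>m. w m \<in> ?H m" "\<And>m. E (w m) < d m + 1 / real (Suc m)" by metis
  have wX: "w m \<in> X0" for m using HX w by blast
  \<comment> \<open>The midpoint of \<open>w m\<close> and \<open>w l\<close> belongs to the hull of
    the tail from \<open>m\<close>, so its energy is at least \<open>d m\<close>. In Clarkson's
    inequality only the gap between the infima and the error of near minimality are left for the
    difference.\<close>
  have diff: "E (\<lambda>x. w m x - w l x) \<le> 2 powr p * (\<bar>d l - d m\<bar> + 1 / real (Suc m))" if "m \<le> l" for m l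
  proof -
    have "w l \<in> ?H m" using w(1)[of l] tail_hull_mono that by blast
    then have "d m \<le> E (\<lambda>x. (w m x + w l x) / 2)" using w(1) by (intro dle tail_hull.midpoint)
    moreover have "1 / real (Suc l) \<le> 1 / real (Suc m)" using that by (intro divide_left_mono) auto
    ultimately have "E (\<lambda>x. (w m x - w l x) / 2) \<le> \<bar>d l - d m\<bar> + 1 / real (Suc m)"
      using E_clarkson[OF wX wX, of m l] w(2)[of m] w(2)[of l] abs_ge_self[of "d l - d m"] abs_ge_zero[of "d l - d m"]
      by argo
    moreover have "E (\<lambda>x. w m x - w l x) = 2 powr p * E (\<lambda>x. (w m x - w l x) / 2)"
    proof -
      have "D (\<lambda>x. w m x - w l x) z = 2 * D (\<lambda>x. (w m x - w l x) / 2) z" for z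
        using D_lin[of "\<lambda>x. (w m x - w l x) / 2" 1 "\<lambda>x. (w m x - w l x) / 2" z]
        unfolding mult_1 field_sum_of_halves by simp
      then show ?thesis by (simp add: E_def abs_mult powr_mult)
    qed
    ultimately show ?thesis by simp
  qed
  have wae: "AE x in lebesgue. (\<lambda>m. w m x) \<longlonglongrightarrow> v x"
    using ae
  proof eventually_elim
    case (elim x)
    show ?case
    proof (rule LIMSEQ_I)
      fix e :: real assume e: "0 < e"
      then obtain k0 where k0: "\<And>k. k \<ge> k0 \<Longrightarrow> \<bar>u k x - v x\<bar> < e / 2"
        using LIMSEQ_D[OF elim, of "e / 2"] by auto
      have "\<bar>w m x - v x\<bar> \<le> e / 2" if "m \<ge> k0" for m
        using Hpt[OF w(1), of m x "v x" "e / 2"] k0 that by (meson less_imp_le order_trans)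
      then show "\<exists>m0. \<forall>m\<ge>m0. norm (w m x - v x) < e"
        using e by (intro exI[of _ k0]) (auto intro: le_less_trans[of _ "e / 2"])
    qed
  qed
  \<comment> \<open>With \<open>m\<close> fixed, Fatou in \<open>l\<close> turns the Cauchy bound
    into a bound on the distance from \<open>w m\<close> to \<open>v\<close>;
    \<open>poincare\<close> supplies the bound for \<open>L\<close>.\<close>
  have main: "v \<in> Xspace s p \<Omega> \<and> L (\<lambda>x. v x - w m x) + E (\<lambda>x. v x - w m x) \<le> (measure M \<Omega> + sobolev_const + 1) * e"
    if e: "\<And>l. l \<ge> m \<Longrightarrow> E (\<lambda>x. w m x - w l x) \<le> e" for m e
  proof -
    let ?c = "measure M \<Omega> + sobolev_const"
    have c: "0 \<le> ?c" using sobolev_const(1) by (intro add_nonneg_nonneg) auto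
    have zX: "(\<lambda>x. w (l + m) x - w m x) \<in> X0" for l
      using X0_lin[OF wX wX, of "l + m" "-1" m] by simp
    have Ee: "E (\<lambda>x. w (l + m) x - w m x) \<le> e" for l
      using e[of "l + m"] by (simp add: E_def D_diff abs_minus_commute)
    have Le: "L (\<lambda>x. w (l + m) x - w m x) \<le> ?c * e" for l
      using poincare[OF zX, of l] mult_left_mono[OF Ee[of l] c] by linarith
    have ae1: "AE x in lebesgue. (\<lambda>l. w (l + m) x - w m x) \<longlonglongrightarrow> v x - w m x"
      using wae by eventually_elim (intro tendsto_diff tendsto_const LIMSEQ_ignore_initial_segment)
    have vm: "(\<lambda>x. v x - w m x) \<in> borel_measurable lebesgue" using v X0D(1)[OF wX, of m] by measurable
    note f1 = Lp_fatou_bound[OF p0 lebesgue_M[OF vm] X0D(4)[OF zX] Le[unfolded L_def] AE_M_of_lebesgue[OF ae1]]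
    note f2 = Lp_fatou_bound[OF p0 D_measurable[OF vm] X0D(5)[OF zX] Ee[unfolded E_def] D_AE_tendsto[OF ae1]]
    have X: "(\<lambda>x. v x - w m x) \<in> Xspace s p \<Omega>" using vm f1(1) f2(1) by (simp add: Xspace_iff)
    have "w m \<in> Xspace s p \<Omega>" using wX by (simp add: X0_iff)
    from Xspace_lin(1)[OF X this, of 1] have "v \<in> Xspace s p \<Omega>" by simp
    moreover have "L (\<lambda>x. v x - w m x) + E (\<lambda>x. v x - w m x) \<le> ?c * e + e"
      using f1(2) f2(2) by (intro add_mono) (simp_all add: L_def E_def)
    ultimately show ?thesis by (simp add: distrib_right)
  qed
  have small: "\<exists>m. \<forall>l\<ge>m. E (\<lambda>x. w m x - w l x) \<le> e" if e: "0 < e" for e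
  proof -
    define e' where "e' = e / (2 powr p * 2)"
    have e': "0 < e'" using e by (simp add: e'_def)
    obtain m0 where m0: "\<And>m l. m \<ge> m0 \<Longrightarrow> l \<ge> m0 \<Longrightarrow> \<bar>d m - d l\<bar> < e'"
      using dC e' unfolding Cauchy_iff by (metis real_norm_def)
    obtain m1 where m1: "1 / real (Suc m1) < e'" using reals_Archimedean[OF e'] by (auto simp: inverse_eq_divide)
    define m where "m = max m0 m1"
    have "1 / real (Suc m) \<le> 1 / real (Suc m1)" by (intro divide_left_mono) (auto simp: m_def)
    then have m: "1 / real (Suc m) \<le> e'" using m1 by simp
    have "E (\<lambda>x. w m x - w l x) \<le> e" if l: "l \<ge> m" for l
    proof -
      have "E (\<lambda>x. w m x - w l x) \<le> 2 powr p * (\<bar>d l - d m\<bar> + 1 / real (Suc m))" by (rule diff[OF l])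
      also have "\<dots> \<le> 2 powr p * (e' + e')"
        using m m0[of l m] l by (intro mult_left_mono add_mono) (auto simp: m_def)
      also have "\<dots> = e" by (simp add: e'_def)
      finally show ?thesis .
    qed
    then show ?thesis by blast
  qed
  show ?thesis
    unfolding X0_iff
  proof (intro conjI allI impI)
    show vX: "v \<in> Xspace s p \<Omega>" using small[of 1] main by auto
    fix e :: real assume e: "0 < e"
    define c where "c = measure M \<Omega> + sobolev_const + 1"
    have c: "0 < c" using sobolev_const(1) unfolding c_def by (intro add_nonneg_pos add_nonneg_nonneg) auto
    define e' where "e' = e / (2 powr p * 2)"
    have e': "0 < e'" using e by (simp add: e'_def)
    obtain m where "\<And>l. l \<ge> m \<Longrightarrow> E (\<lambda>x. w m x - w l x) \<le> e' / c" using small[of "e' / c"] e' c by auto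
    then have m: "L (\<lambda>x. v x - w m x) + E (\<lambda>x. v x - w m x) \<le> e'"
      using main[of m "e' / c"] c by (simp add: c_def)
    obtain \<phi> where \<phi>: "\<phi> \<in> T" "L (\<lambda>x. w m x - \<phi> x) + E (\<lambda>x. w m x - \<phi> x) < e'"
      using wX[of m] e' unfolding X0_iff by blast
    have X: "(\<lambda>x. v x - w m x) \<in> Xspace s p \<Omega>" "(\<lambda>x. w m x - \<phi> x) \<in> Xspace s p \<Omega>"
      using vX wX[of m] T_Xspace[OF \<phi>(1)] by (auto simp: X0_iff intro: Xspace_diff)
    have eq: "(\<lambda>x. v x - \<phi> x) = (\<lambda>x. (v x - w m x) + 1 * (w m x - \<phi> x))" by auto
    have "L (\<lambda>x. v x - \<phi> x) + E (\<lambda>x. v x - \<phi> x) \<le>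
        2 powr p * (L (\<lambda>x. v x - w m x) + \<bar>1\<bar> powr p * L (\<lambda>x. w m x - \<phi> x)) + 2 powr p * (E (\<lambda>x. v x - w m x) + \<bar>1\<bar> powr p * E (\<lambda>x. w m x - \<phi> x))"
      unfolding eq by (intro add_mono Xspace_lin X)
    also have "\<dots> = 2 powr p * ((L (\<lambda>x. v x - w m x) + E (\<lambda>x. v x - w m x)) + (L (\<lambda>x. w m x - \<phi> x) + E (\<lambda>x. w m x - \<phi> x)))"
      by (simp add: algebra_simps)
    also have "\<dots> < 2 powr p * (e' + e')"
      using m \<phi>(2) by (intro mult_strict_left_mono add_le_less_mono) auto
    also have "\<dots> = e" by (simp add: e'_def)
    finally show "\<exists>\<phi>\<in>T. L (\<lambda>x. v x - \<phi> x) + E (\<lambda>x. v x - \<phi> x) < e" using \<phi>(1) by blast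
  qed
qed

end

section \<open>Compactness and absolute values\<close>

context fractional_setting
begin

section \<open>Compactness through means over small balls\<close>

definition ball_mean :: "(real ^ 'n \<Rightarrow> real) \<Rightarrow> real ^ 'n \<Rightarrow> real \<Rightarrow> real" where
  "ball_mean g c h = (\<integral>y. indicator (cball c h) y * g y \<partial>lborel) / measure lborel (cball c h)"

definition gag_at :: "(real ^ 'n \<Rightarrow> real) \<Rightarrow> real ^ 'n \<Rightarrow> real" where
  "gag_at g x = (\<integral>y. gag p (real CARD('n) + p * s) g x y \<partial>lborel)"

definition mean_const :: real where
  "mean_const = 2 powr (real CARD('n) + p * s) / unit_ball_vol (real CARD('n))"

lemma mean_const_nonneg: "0 \<le> mean_const" by (simp add: mean_const_def)

lemma integral_M_le:
  fixes h :: "real ^ 'n \<Rightarrow> real"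
  assumes i: "integrable lborel h" and 0: "\<And>x. 0 \<le> h x"
  shows "integrable M h" "(\<integral>x. h x \<partial>M) \<le> (\<integral>x. h x \<partial>lborel)"
proof -
  have hm: "h \<in> borel_measurable lborel" using i by auto
  then have il: "integrable lebesgue h" using i by (rule integrable_completion[THEN iffD2])
  have ii: "integrable lebesgue (\<lambda>x. indicator \<Omega> x * h x)"
    using integrable_mult_indicator[OF \<Omega>_lebesgue il] by simp
  show "integrable M h"
    using ii \<Omega>_lebesgue by (subst integrable_restrict_space) auto
  have "(\<integral>x. h x \<partial>M) = (\<integral>x. indicator \<Omega> x * h x \<partial>lebesgue)"
    using \<Omega>_lebesgue by (subst integral_restrict_space) auto
  also have "\<dots> \<le> (\<integral>x. h x \<partial>lebesgue)"
    by (rule integral_mono[OF ii il]) (use 0 in \<open>auto simp: indicator_def\<close>)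
  finally show "(\<integral>x. h x \<partial>M) \<le> (\<integral>x. h x \<partial>lborel)"
    using integral_completion[OF hm] by simp
qed

lemma T_gag:
  assumes "\<phi> \<in> T"
  shows "0 \<le> gag_at \<phi> x" "integrable M (gag_at \<phi>)" "(\<integral>x. gag_at \<phi> x \<partial>M) \<le> E \<phi>"
    and "0 < h \<Longrightarrow> x \<in> cball c h \<Longrightarrow> \<bar>\<phi> x - ball_mean \<phi> c h\<bar> powr p \<le> mean_const * h powr (p * s) * gag_at \<phi> x"
proof -
  note g = T_lip_compact(1)[OF assms]
  show G0: "0 \<le> gag_at \<phi> x" for x by (simp add: gag_at_def gag_def integral_nonneg_AE)
  have i: "integrable lborel (gag_at \<phi>)" "(\<integral>x. gag_at \<phi> x \<partial>lborel) = E \<phi>"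
    using gag_fubini[OF g, of p s "real CARD('n) + p * s"] lip_compact_energy(2)[OF T_lip_compact[OF assms]] p s
    by (simp_all add: gag_at_def[abs_def])
  show "integrable M (gag_at \<phi>)" "(\<integral>x. gag_at \<phi> x \<partial>M) \<le> E \<phi>"
    using integral_M_le[OF i(1) G0] i(2) by auto
  show "0 < h \<Longrightarrow> x \<in> cball c h \<Longrightarrow> \<bar>\<phi> x - ball_mean \<phi> c h\<bar> powr p \<le> mean_const * h powr (p * s) * gag_at \<phi> x"
    using average_estimate[OF g, of p s "real CARD('n) + p * s" h x c] p s by (simp add: ball_mean_def mean_const_def gag_at_def)
qed

text \<open>The difference splits into two oscillations about the means over a ball containing the
  point, and the difference of the means. The ball depends on the point, hence the sum over all
  centres; \<open>4 powr p\<close> comes from using \<open>abs_add_powr_le\<close> twice.\<close>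

lemma T_oscillation:
  assumes \<phi>: "\<phi> \<in> T" "\<psi> \<in> T" and h: "0 < h" and F: "finite F" "\<Omega> \<subseteq> (\<Union>c\<in>F. cball c h)"
  shows "L (\<lambda>x. \<phi> x - \<psi> x) \<le> 4 powr p * (mean_const * h powr (p * s) * (E \<phi> + E \<psi>)
    + measure M \<Omega> * (\<Sum>c\<in>F. \<bar>ball_mean \<phi> c h - ball_mean \<psi> c h\<bar> powr p))"
proof -
  let ?S = "\<Sum>c\<in>F. \<bar>ball_mean \<phi> c h - ball_mean \<psi> c h\<bar> powr p" and ?C = "mean_const * h powr (p * s)"
  have p0: "0 \<le> p" using p by simp
  have i1: "integrable M (\<lambda>_. c)" for c :: real
    using finite_measure.integrable_const[OF finite_M(2)] .
  have pt: "\<bar>\<phi> x - \<psi> x\<bar> powr p \<le> 4 powr p * (?C * (gag_at \<phi> x + gag_at \<psi> x) + ?S)" if x: "x \<in> \<Omega>" for x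
  proof -
    obtain c where c: "c \<in> F" "x \<in> cball c h" using F x by auto
    let ?a = "\<phi> x - ball_mean \<phi> c h" and ?b = "\<psi> x - ball_mean \<psi> c h" and ?d = "ball_mean \<phi> c h - ball_mean \<psi> c h"
    have "\<bar>\<phi> x - \<psi> x\<bar> powr p = \<bar>?a + (?d + - ?b)\<bar> powr p" by simp
    also have "\<dots> \<le> 2 powr p * (\<bar>?a\<bar> powr p + \<bar>?d + - ?b\<bar> powr p)"
      by (rule abs_add_powr_le[OF p0])
    also have "\<dots> \<le> 2 powr p * (\<bar>?a\<bar> powr p + 2 powr p * (\<bar>?d\<bar> powr p + \<bar>- ?b\<bar> powr p))"
      by (intro mult_left_mono add_left_mono abs_add_powr_le p0) auto
    also have "\<dots> \<le> 2 powr p * (2 powr p * \<bar>?a\<bar> powr p + 2 powr p * (\<bar>?d\<bar> powr p + \<bar>?b\<bar> powr p))"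
    proof -
      have "1 * \<bar>?a\<bar> powr p \<le> 2 powr p * \<bar>?a\<bar> powr p"
        using ge_one_powr_ge_zero[of 2 p] p0 by (intro mult_right_mono) auto
      then show ?thesis by (intro mult_left_mono add_mono) (auto simp: abs_minus_commute)
    qed
    also have "\<dots> = 4 powr p * (\<bar>?a\<bar> powr p + \<bar>?b\<bar> powr p + \<bar>?d\<bar> powr p)"
    proof -
      have "(4::real) powr p = 2 powr p * 2 powr p" by (simp flip: powr_mult)
      then show ?thesis by (simp add: algebra_simps)
    qed
    also have "\<dots> \<le> 4 powr p * (?C * gag_at \<phi> x + ?C * gag_at \<psi> x + ?S)"
      using c F(1) by (intro mult_left_mono add_mono T_gag \<phi> h member_le_sum) auto
    finally show ?thesis by (simp add: distrib_left)
  qed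
  have "L (\<lambda>x. \<phi> x - \<psi> x) \<le> (\<integral>x. 4 powr p * (?C * (gag_at \<phi> x + gag_at \<psi> x) + ?S) \<partial>M)"
    unfolding L_def
  proof (rule integral_mono)
    show "integrable M (\<lambda>x. \<bar>\<phi> x - \<psi> x\<bar> powr p)"
      using Xspace_diff(1)[OF T_Xspace T_Xspace] \<phi> by (simp add: Xspace_iff)
    show "integrable M (\<lambda>x. 4 powr p * (?C * (gag_at \<phi> x + gag_at \<psi> x) + ?S))"
      using T_gag(2) \<phi> i1 by simp
  qed (use pt in simp)
  also have "\<dots> = 4 powr p * (?C * ((\<integral>x. gag_at \<phi> x \<partial>M) + (\<integral>x. gag_at \<psi> x \<partial>M)) + measure M \<Omega> * ?S)"
    using T_gag(2) \<phi> i1 by simp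
  also have "\<dots> \<le> 4 powr p * (?C * (E \<phi> + E \<psi>) + measure M \<Omega> * ?S)"
    using mean_const_nonneg by (intro mult_left_mono add_mono order_refl T_gag(3) \<phi>) auto
  finally show ?thesis .
qed

text \<open>Along a subsequence the means over countably many covering balls all converge. In
  \<open>T_oscillation\<close> the radius is chosen first, uniformly by the energy bound, and then
  the index, for the finitely many means at that radius.\<close>

lemma T_compact:
  fixes \<phi> :: "nat \<Rightarrow> real ^ 'n \<Rightarrow> real"
  assumes \<phi>: "\<And>k. \<phi> k \<in> T" and K: "\<And>k. E (\<phi> k) \<le> K"
  shows "\<exists>\<sigma> :: nat \<Rightarrow> nat. strict_mono \<sigma> \<and> (\<forall>e>0. \<exists>n. \<forall>k\<ge>n. \<forall>l\<ge>n. L (\<lambda>x. \<phi> (\<sigma> k) x - \<phi> (\<sigma> l) x) < e)"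
proof -
  define h where "h j = 1 / real (Suc j)" for j
  have h: "0 < h j" for j by (simp add: h_def)
  have "\<forall>j. \<exists>F. finite F \<and> \<Omega> \<subseteq> (\<Union>c\<in>F. cball c (h j))"
  proof
    fix j
    have co: "compact (closure \<Omega>)" using \<Omega> by simp
    have cov: "closure \<Omega> \<subseteq> (\<Union>c\<in>closure \<Omega>. ball c (h j))" using h[of j] by force
    obtain F where F: "finite F" "closure \<Omega> \<subseteq> (\<Union>c\<in>F. ball c (h j))"
      by (rule compactE_image[OF co _ cov]) auto
    have "\<Omega> \<subseteq> (\<Union>c\<in>F. cball c (h j))"
    proof
      fix x assume "x \<in> \<Omega>"
      then have "x \<in> (\<Union>c\<in>F. ball c (h j))" using F(2) closure_subset by blast
      then obtain c where "c \<in> F" "x \<in> ball c (h j)" by blast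
      then show "x \<in> (\<Union>c\<in>F. cball c (h j))" using ball_subset_cball by blast
    qed
    with F(1) show "\<exists>F. finite F \<and> \<Omega> \<subseteq> (\<Union>c\<in>F. cball c (h j))" by blast
  qed
  then obtain F where F: "\<And>j. finite (F j)" "\<And>j. \<Omega> \<subseteq> (\<Union>c\<in>F j. cball c (h j))" by metis
  define S where "S = (SIGMA j:UNIV. F j)"
  have "countable S" unfolding S_def using F(1) by (intro countable_SIGMA) (auto intro: countable_finite)
  define a where "a k z = (\<integral>y. indicator (cball (snd z) (h (fst z))) y * \<phi> k y \<partial>lborel)" for k z
  \<comment> \<open>The diagonal extraction requires bounded sequences: the integral over a ball is
    at most the L^1 norm, which is controlled by the integral of
    \<open>1 + \<bar>\<phi> k x\<bar> powr p\<close> and by \<open>poincare\<close>.\<close>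
  have bound: "norm (a k z) \<le> measure M \<Omega> + (measure M \<Omega> + sobolev_const) * K" for k z
  proof -
    note g = T_lip_compact[OF \<phi>[of k]]
    have i0: "integrable lborel (\<lambda>x. \<bar>\<phi> k x\<bar>)" using lip_compact_powr_integrable[OF g(1), of 1] by simp
    have i2: "integrable lborel (\<lambda>y. indicator (cball (snd z) (h (fst z))) y * \<phi> k y)"
      using lip_compact_integrable_ball(2)[OF g(1), of 1 "snd z" "h (fst z)" 0] by simp
    have "norm (a k z) \<le> (\<integral>y. \<bar>indicator (cball (snd z) (h (fst z))) y * \<phi> k y\<bar> \<partial>lborel)"
      unfolding a_def real_norm_def by (rule integral_abs_bound)
    also have "\<dots> \<le> (\<integral>x. \<bar>\<phi> k x\<bar> \<partial>lborel)"
      using i2 by (intro integral_mono integrable_abs i0) (auto simp: indicator_def)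
    also have "\<dots> = (\<integral>x. \<bar>\<phi> k x\<bar> \<partial>M)" using lip_compact_energy(4)[OF g, of 1] by simp
    also have "\<dots> \<le> (\<integral>x. 1 + \<bar>\<phi> k x\<bar> powr p \<partial>M)"
    proof (rule integral_mono)
      show "integrable M (\<lambda>x. \<bar>\<phi> k x\<bar>)" using lip_compact_energy(3)[OF g, of 1] by simp
      show "integrable M (\<lambda>x. 1 + \<bar>\<phi> k x\<bar> powr p)"
        using lip_compact_energy(3)[OF g, of p] p finite_measure.integrable_const[OF finite_M(2), of "1::real"]
        by (intro Bochner_Integration.integrable_add) auto
      fix x
      show "\<bar>\<phi> k x\<bar> \<le> 1 + \<bar>\<phi> k x\<bar> powr p"
      proof (cases "\<bar>\<phi> k x\<bar> \<le> 1")
        case True then show ?thesis by (smt (verit) powr_ge_zero)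
      next
        case False
        then have "\<bar>\<phi> k x\<bar> powr 1 \<le> \<bar>\<phi> k x\<bar> powr p" using p by (intro powr_mono) auto
        then show ?thesis by simp
      qed
    qed
    also have "\<dots> = measure M \<Omega> + L (\<phi> k)"
      unfolding L_def using lip_compact_energy(3)[OF g, of p] p finite_measure.integrable_const[OF finite_M(2), of "1::real"]
      by (subst Bochner_Integration.integral_add) auto
    also have "\<dots> \<le> measure M \<Omega> + (measure M \<Omega> + sobolev_const) * K"
    proof -
      have "L (\<phi> k) \<le> (measure M \<Omega> + sobolev_const) * E (\<phi> k)" by (intro poincare T_subset_X0 \<phi>)
      also have "\<dots> \<le> (measure M \<Omega> + sobolev_const) * K"
        using sobolev_const(1) K by (intro mult_left_mono add_nonneg_nonneg) auto
      finally show ?thesis by simp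
    qed
    finally show ?thesis .
  qed
  obtain \<sigma> where \<sigma>: "strict_mono \<sigma>" "\<And>z. z \<in> S \<Longrightarrow> \<exists>l. (\<lambda>n. a (\<sigma> n) z) \<longlonglongrightarrow> l"
    by (rule function_convergent_subsequence[where f=a, OF \<open>countable S\<close> bound]) blast
  have lim: "\<exists>l. (\<lambda>k. ball_mean (\<phi> (\<sigma> k)) c (h j)) \<longlonglongrightarrow> l" if "c \<in> F j" for c j
  proof -
    have "(j, c) \<in> S" using that by (simp add: S_def)
    then obtain l where "(\<lambda>n. a (\<sigma> n) (j, c)) \<longlonglongrightarrow> l" using \<sigma>(2) by blast
    then have "(\<lambda>k. ball_mean (\<phi> (\<sigma> k)) c (h j)) \<longlonglongrightarrow> l / measure lborel (cball c (h j))"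
      unfolding ball_mean_def a_def using h[of j] by (intro tendsto_divide tendsto_const) auto
    then show ?thesis by blast
  qed
  have main: "\<exists>n. \<forall>k\<ge>n. \<forall>l\<ge>n. L (\<lambda>x. \<phi> (\<sigma> k) x - \<phi> (\<sigma> l) x) < e" if e: "0 < e" for e
  proof -
    have "(\<lambda>j. 4 powr p * (mean_const * h j powr (p * s) * (K + K))) \<longlonglongrightarrow> 4 powr p * (mean_const * 0 powr (p * s) * (K + K))"
      unfolding h_def using p s LIMSEQ_inverse_real_of_nat
      by (intro tendsto_intros tendsto_powr2) (auto simp: inverse_eq_divide)
    then have "eventually (\<lambda>j. 4 powr p * (mean_const * h j powr (p * s) * (K + K)) < e / 2) sequentially"
      by (rule order_tendstoD) (use e in simp)
    then obtain j where j: "4 powr p * (mean_const * h j powr (p * s) * (K + K)) < e / 2"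
      using eventually_happens'[OF sequentially_bot] by blast
    have "\<forall>c\<in>F j. \<exists>l. (\<lambda>k. ball_mean (\<phi> (\<sigma> k)) c (h j)) \<longlonglongrightarrow> l" using lim by blast
    then obtain m where m: "\<And>c. c \<in> F j \<Longrightarrow> (\<lambda>k. ball_mean (\<phi> (\<sigma> k)) c (h j)) \<longlonglongrightarrow> m c" by metis
    define R where "R k = (\<Sum>c\<in>F j. \<bar>ball_mean (\<phi> (\<sigma> k)) c (h j) - m c\<bar> powr p)" for k
    have "R \<longlonglongrightarrow> (\<Sum>c\<in>F j. \<bar>m c - m c\<bar> powr p)"
      unfolding R_def using p by (intro tendsto_sum abs_powr_tendsto tendsto_diff m tendsto_const) auto
    then have R: "R \<longlonglongrightarrow> 0" by simp
    \<comment> \<open>\<open>B - 1\<close> is the factor with which the threshold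
      \<open>e / 2 / B\<close> enters below; the summand 1 keeps \<open>B\<close> positive and makes
      the final inequality strict.\<close>
    define B where "B = 4 powr p * (measure M \<Omega> * (2 powr p * 2)) + 1"
    have B: "0 < B" unfolding B_def by (intro add_nonneg_pos) auto
    have "eventually (\<lambda>k. R k < e / 2 / B) sequentially"
      by (rule order_tendstoD(2)[OF R]) (use e B in simp)
    then obtain n where n: "\<And>k. k \<ge> n \<Longrightarrow> R k < e / 2 / B" by (auto simp: eventually_sequentially)
    have "L (\<lambda>x. \<phi> (\<sigma> k) x - \<phi> (\<sigma> l) x) < e" if kl: "k \<ge> n" "l \<ge> n" for k l
    proof -
      let ?t = "e / 2 / B"
      have "(\<Sum>c\<in>F j. \<bar>ball_mean (\<phi> (\<sigma> k)) c (h j) - ball_mean (\<phi> (\<sigma> l)) c (h j)\<bar> powr p) \<le>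
          (\<Sum>c\<in>F j. 2 powr p * (\<bar>ball_mean (\<phi> (\<sigma> k)) c (h j) - m c\<bar> powr p + \<bar>ball_mean (\<phi> (\<sigma> l)) c (h j) - m c\<bar> powr p))"
      proof (rule sum_mono)
        fix c
        show "\<bar>ball_mean (\<phi> (\<sigma> k)) c (h j) - ball_mean (\<phi> (\<sigma> l)) c (h j)\<bar> powr p \<le>
          2 powr p * (\<bar>ball_mean (\<phi> (\<sigma> k)) c (h j) - m c\<bar> powr p + \<bar>ball_mean (\<phi> (\<sigma> l)) c (h j) - m c\<bar> powr p)"
          using abs_add_powr_le[of p "ball_mean (\<phi> (\<sigma> k)) c (h j) - m c" "m c - ball_mean (\<phi> (\<sigma> l)) c (h j)"] p
          by (simp add: abs_minus_commute)
      qed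
      also have "\<dots> = 2 powr p * (R k + R l)" by (simp add: R_def sum_distrib_left[symmetric] sum.distrib)
      also have "\<dots> \<le> 2 powr p * (?t + ?t)"
        using n kl by (intro mult_left_mono add_mono less_imp_le) auto
      finally have s1: "(\<Sum>c\<in>F j. \<bar>ball_mean (\<phi> (\<sigma> k)) c (h j) - ball_mean (\<phi> (\<sigma> l)) c (h j)\<bar> powr p) \<le> 2 powr p * 2 * ?t" by simp
      have "L (\<lambda>x. \<phi> (\<sigma> k) x - \<phi> (\<sigma> l) x) \<le> 4 powr p * (mean_const * h j powr (p * s) * (E (\<phi> (\<sigma> k)) + E (\<phi> (\<sigma> l)))
          + measure M \<Omega> * (\<Sum>c\<in>F j. \<bar>ball_mean (\<phi> (\<sigma> k)) c (h j) - ball_mean (\<phi> (\<sigma> l)) c (h j)\<bar> powr p))"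
        by (intro T_oscillation \<phi> h F)
      also have "\<dots> \<le> 4 powr p * (mean_const * h j powr (p * s) * (K + K) + measure M \<Omega> * (2 powr p * 2 * ?t))"
        using s1 K mean_const_nonneg by (intro mult_left_mono add_mono) auto
      also have "\<dots> = 4 powr p * (mean_const * h j powr (p * s) * (K + K)) + (B - 1) * ?t"
        by (simp add: B_def algebra_simps)
      also have "\<dots> < e / 2 + B * ?t"
        using j e B by (intro add_strict_mono mult_strict_right_mono) auto
      also have "\<dots> = e" using B by simp
      finally show ?thesis .
    qed
    then show ?thesis by blast
  qed
  show ?thesis by (rule exI[of _ \<sigma>], rule conjI[OF \<sigma>(1)], intro allI impI, rule main)
qed

text \<open>Each \<open>u k\<close> is replaced by a test function with error below
  \<open>1 / real (Suc k)\<close>, so the Cauchy property found for test functions returns to the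
  \<open>u k\<close>. A further subsequence converges almost everywhere, and
  \<open>X0_AE_closed\<close> puts its limit into the space.\<close>

lemma X0_compact:
  fixes u :: "nat \<Rightarrow> real ^ 'n \<Rightarrow> real"
  assumes u: "\<And>k. u k \<in> X0" and K: "\<And>k. E (u k) \<le> K"
  shows "\<exists>\<sigma> v. strict_mono \<sigma> \<and> v \<in> X0 \<and> (AE x in M. (\<lambda>k. u (\<sigma> k) x) \<longlonglongrightarrow> v x) \<and>
    (AE z in N. (\<lambda>k. D (u (\<sigma> k)) z) \<longlonglongrightarrow> D v z)"
proof -
  have p0: "0 < p" using p by simp
  have "\<forall>k. \<exists>\<phi>\<in>T. L (\<lambda>x. u k x - \<phi> x) + E (\<lambda>x. u k x - \<phi> x) < 1 / real (Suc k)"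
    using u unfolding X0_iff by simp
  then obtain \<phi> where \<phi>: "\<And>k. \<phi> k \<in> T" "\<And>k. L (\<lambda>x. u k x - \<phi> k x) + E (\<lambda>x. u k x - \<phi> k x) < 1 / real (Suc k)"
    by metis
  have uX: "u k \<in> Xspace s p \<Omega>" for k using u[of k] by (simp add: X0_iff)
  have dX: "(\<lambda>x. u k x - \<phi> k x) \<in> Xspace s p \<Omega>" for k by (intro Xspace_diff uX T_Xspace \<phi>)
  have small: "L (\<lambda>x. u k x - \<phi> k x) < 1 / real (Suc k)" "E (\<lambda>x. u k x - \<phi> k x) \<le> 1" for k
  proof -
    show "L (\<lambda>x. u k x - \<phi> k x) < 1 / real (Suc k)"
      using \<phi>(2)[of k] E_nonneg[of "\<lambda>x. u k x - \<phi> k x"] by linarith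
    have "1 / real (Suc k) \<le> 1" by simp
    then show "E (\<lambda>x. u k x - \<phi> k x) \<le> 1"
      using \<phi>(2)[of k] L_nonneg[of "\<lambda>x. u k x - \<phi> k x"] by linarith
  qed
  have "E (\<phi> k) \<le> 2 powr p * (K + 1)" for k
  proof -
    have "E (\<phi> k) = E (\<lambda>x. u k x - (u k x - \<phi> k x))" by simp
    also have "\<dots> \<le> 2 powr p * (E (u k) + E (\<lambda>x. u k x - \<phi> k x))" by (intro Xspace_diff uX dX)
    also have "\<dots> \<le> 2 powr p * (K + 1)" using K small by (intro mult_left_mono add_mono) auto
    finally show ?thesis .
  qed
  from T_compact[where \<phi>=\<phi>, OF \<phi>(1) this] obtain \<sigma> :: "nat \<Rightarrow> nat" where \<sigma>: "strict_mono \<sigma>"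
    "\<forall>e>0. \<exists>n. \<forall>k\<ge>n. \<forall>l\<ge>n. L (\<lambda>x. \<phi> (\<sigma> k) x - \<phi> (\<sigma> l) x) < e"
    by blast
  define w where "w k = u (\<sigma> k)" for k
  have "\<exists>n. \<forall>k\<ge>n. \<forall>l\<ge>n. (\<integral>x. \<bar>w k x - w l x\<bar> powr p \<partial>M) < e" if e: "0 < e" for e
  proof -
    define t where "t = e / (2 powr p * (1 + 2 powr p * 2))"
    have den: "0 < 2 powr p * (1 + 2 powr p * 2)" by (intro mult_pos_pos add_pos_nonneg) auto
    have t: "0 < t" using e den by (simp add: t_def)
    obtain n1 where n1: "\<And>k l. k \<ge> n1 \<Longrightarrow> l \<ge> n1 \<Longrightarrow> L (\<lambda>x. \<phi> (\<sigma> k) x - \<phi> (\<sigma> l) x) < t" using \<sigma>(2)[rule_format, OF t] by blast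
    obtain n2 where n2: "1 / real (Suc n2) < t" using reals_Archimedean[OF t] by (auto simp: inverse_eq_divide)
    have Lk: "L (\<lambda>x. u (\<sigma> k) x - \<phi> (\<sigma> k) x) < t" if "k \<ge> n2" for k
    proof -
      have "n2 \<le> \<sigma> k" using that seq_suble[OF \<sigma>(1), of k] by simp
      then have "1 / real (Suc (\<sigma> k)) \<le> 1 / real (Suc n2)" by (intro divide_left_mono) auto
      then show ?thesis using small(1)[of "\<sigma> k"] n2 by linarith
    qed
    have "(\<integral>x. \<bar>w k x - w l x\<bar> powr p \<partial>M) < e" if kl: "k \<ge> max n1 n2" "l \<ge> max n1 n2" for k l
    proof -
      let ?a = "\<lambda>k x. u (\<sigma> k) x - \<phi> (\<sigma> k) x" and ?b = "\<lambda>x. \<phi> (\<sigma> k) x - \<phi> (\<sigma> l) x"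
      have bX: "?b \<in> Xspace s p \<Omega>" by (intro Xspace_diff T_Xspace \<phi>)
      have eq: "(\<lambda>x. w k x - w l x) = (\<lambda>x. ?a k x - (?a l x - ?b x))" by (auto simp: w_def)
      have "(\<integral>x. \<bar>w k x - w l x\<bar> powr p \<partial>M) = L (\<lambda>x. w k x - w l x)" by (simp add: L_def)
      also have "\<dots> \<le> 2 powr p * (L (?a k) + L (\<lambda>x. ?a l x - ?b x))"
        unfolding eq by (intro Xspace_diff dX bX)
      also have "\<dots> \<le> 2 powr p * (L (?a k) + 2 powr p * (L (?a l) + L ?b))"
        by (intro mult_left_mono add_left_mono Xspace_diff(2) dX bX) auto
      also have "\<dots> < 2 powr p * (t + 2 powr p * (t + t))"
        using Lk[of k] Lk[of l] n1[of k l] kl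
        by (intro mult_strict_left_mono add_strict_mono) auto
      also have "\<dots> = t * (2 powr p * (1 + 2 powr p * 2))" by (simp add: algebra_simps)
      also have "\<dots> = e" using den t_def by (metis less_irrefl nonzero_eq_divide_eq)
      finally show ?thesis .
    qed
    then show ?thesis by blast
  qed
  moreover have "integrable M (\<lambda>x. \<bar>w k x - w l x\<bar> powr p)" for k l
    using Xspace_diff(1)[OF uX uX] by (simp add: Xspace_iff w_def)
  moreover have wM: "w k \<in> borel_measurable M" for k unfolding w_def by (rule X0D(2)[OF u])
  ultimately obtain \<tau> where \<tau>: "strict_mono \<tau>" "AE x in M. convergent (\<lambda>k. w (\<tau> k) x)"
    using Lp_Cauchy_AE_convergent_subseq[OF p0, of w M] by blast
  define y where "y k = w (\<tau> k)" for k
  have y: "y k \<in> X0" "E (y k) \<le> K" for k unfolding y_def w_def using u K by auto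
  have [measurable]: "y k \<in> borel_measurable lebesgue" for k by (rule X0D(1)[OF y(1)])
  \<comment> \<open>Outside \<open>\<Omega>\<close> all \<open>y k\<close> vanish almost everywhere,
    so 0 is the limit there; inside, \<open>lim\<close> is arbitrary only on a null set.\<close>
  define v where "v x = indicator \<Omega> x * lim (\<lambda>k. y k x)" for x
  have vm: "v \<in> borel_measurable lebesgue" unfolding v_def using \<Omega>_lebesgue by measurable
  have "AE x in lebesgue. x \<in> \<Omega> \<longrightarrow> convergent (\<lambda>k. y k x)"
    using \<tau>(2) \<Omega>_lebesgue unfolding y_def by (subst (asm) AE_restrict_space_iff) auto
  moreover have "AE x in lebesgue. \<forall>k. x \<notin> \<Omega> \<longrightarrow> y k x = 0"
    unfolding AE_all_countable using X0_approx(1)[OF y(1)] by blast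
  ultimately have ae: "AE x in lebesgue. (\<lambda>k. y k x) \<longlonglongrightarrow> v x"
  proof eventually_elim
    case (elim x)
    then show ?case by (cases "x \<in> \<Omega>") (auto simp: v_def convergent_LIMSEQ_iff)
  qed
  have "v \<in> X0" by (rule X0_AE_closed[OF y vm ae])
  moreover have "strict_mono (\<lambda>k. \<sigma> (\<tau> k))" using \<sigma>(1) \<tau>(1) by (simp add: strict_mono_def)
  ultimately show ?thesis
    using AE_M_of_lebesgue[OF ae] D_AE_tendsto[OF ae] unfolding y_def w_def by blast
qed

text \<open>Smoothed absolute values of approximating test functions are again test functions, and
  being contractions of the originals they have bounded energy. They converge to
  \<open>\<bar>u x\<bar>\<close> almost everywhere, which is all that \<open>X0_AE_closed\<close>
  asks for.\<close>

lemma X0_abs: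
  assumes u: "u \<in> X0" shows "(\<lambda>x. \<bar>u x\<bar>) \<in> X0"
proof -
  obtain \<phi> where \<phi>: "\<And>k. \<phi> k \<in> T" "AE x in lebesgue. (\<lambda>k. \<phi> k x) \<longlonglongrightarrow> u x" "(\<lambda>k. E (\<phi> k)) \<longlonglongrightarrow> E u"
    using X0_approx(2)[OF u] by blast
  obtain K where K: "\<And>k. E (\<phi> k) \<le> K"
    using convergent_imp_Bseq[of "\<lambda>k. E (\<phi> k)"] \<phi>(3) E_nonneg unfolding convergent_def Bseq_def by auto
  define e where "e k = 1 / real (Suc k)" for k
  have e: "0 < e k" for k by (simp add: e_def)
  have elim0: "e \<longlonglongrightarrow> 0" unfolding e_def using LIMSEQ_inverse_real_of_nat by (simp add: inverse_eq_divide)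
  define \<psi> where "\<psi> k = (\<lambda>x. sqrt ((\<phi> k x)\<^sup>2 + (e k)\<^sup>2) - e k)" for k
  have \<psi>: "\<psi> k \<in> T" for k unfolding \<psi>_def by (intro test_functions_smooth_abs \<phi> e)
  have lip: "\<bar>\<psi> k x - \<psi> k y\<bar> \<le> \<bar>\<phi> k x - \<phi> k y\<bar>" for k x y
  proof -
    \<comment> \<open>Up to the constant \<open>e k\<close> the smoothed absolute value is the norm
      of the plane vector \<open>(\<phi> k x, e k)\<close>, so the reverse triangle inequality
      yields the contraction.\<close>
    have "\<bar>norm (\<phi> k x, e k) - norm (\<phi> k y, e k)\<bar> \<le> norm ((\<phi> k x, e k) - (\<phi> k y, e k))"
      by (rule norm_triangle_ineq3)
    then show ?thesis by (simp add: \<psi>_def norm_Pair)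
  qed
  have E\<psi>: "E (\<psi> k) \<le> K" for k
  proof -
    have "E (\<psi> k) \<le> E (\<phi> k)"
      unfolding E_def using T_Xspace[OF \<psi>, of k] T_Xspace[OF \<phi>(1), of k] D_contraction[OF lip, of k] p
      by (intro integral_mono powr_mono2) (auto simp: Xspace_iff)
    then show ?thesis using K[of k] by simp
  qed
  have "AE x in lebesgue. (\<lambda>k. \<psi> k x) \<longlonglongrightarrow> \<bar>u x\<bar>"
    using \<phi>(2)
  proof eventually_elim
    case (elim x)
    have "(\<lambda>k. \<psi> k x) \<longlonglongrightarrow> sqrt ((u x)\<^sup>2 + 0\<^sup>2) - 0"
      unfolding \<psi>_def by (intro tendsto_intros elim elim0)
    then show ?case by simp
  qed
  then show ?thesis
    using X0D(1)[OF u] by (intro X0_AE_closed[OF T_subset_X0[OF \<psi>] E\<psi>]) auto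
qed

end

section \<open>Test functions seeing the positive part of the weight\<close>

context fractional_setting
begin

text \<open>One bump in \<open>\<rho>\<^sup>2 - (norm (x - c))\<^sup>2\<close> per centre;
  nonnegative summands cannot cancel, so the sum is positive exactly on the union.\<close>

lemma test_function_positive_on_balls:
  assumes F: "finite F" and \<rho>: "0 < \<rho>" and sub: "\<And>c. c \<in> F \<Longrightarrow> cball c \<rho> \<subseteq> \<Omega>"
  obtains \<psi> :: "real ^ 'n \<Rightarrow> real" where "smooth_on UNIV \<psi>" "\<And>x. 0 \<le> \<psi> x" "\<And>x. 0 < \<psi> x \<longleftrightarrow> x \<in> (\<Union>c\<in>F. ball c \<rho>)"
    "compact (\<Union>c\<in>F. cball c \<rho>)" "(\<Union>c\<in>F. cball c \<rho>) \<subseteq> \<Omega>"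
proof -
  define b where "b c x = bump_fun 1 (\<rho>\<^sup>2 + (-1) * (norm (x - c))\<^sup>2)" for c x :: "real ^ 'n"
  define \<psi> where "\<psi> x = (\<Sum>c\<in>F. b c x)" for x
  have sb: "smooth_on UNIV (b c)" for c
    unfolding b_def by (intro smooth_on_bump_fun smooth_on_add smooth_on_mult smooth_on_const smooth_on_norm_diff_square)
  have 1: "smooth_on UNIV \<psi>" unfolding \<psi>_def by (intro smooth_on_sum) (rule sb)
  have b0: "0 \<le> b c x" for c x by (simp add: b_def bump_fun_one)
  then have 2: "0 \<le> \<psi> x" for x unfolding \<psi>_def by (intro sum_nonneg)
  have bp: "0 < b c x \<longleftrightarrow> x \<in> ball c \<rho>" for c x
  proof -
    have "0 < b c x \<longleftrightarrow> (norm (x - c))\<^sup>2 < \<rho>\<^sup>2" by (auto simp: b_def bump_fun_one)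
    also have "\<dots> \<longleftrightarrow> norm (x - c) < \<rho>" using \<rho> by (auto simp: power_strict_mono intro: power_less_imp_less_base)
    finally show ?thesis by (simp add: dist_norm norm_minus_commute)
  qed
  have 3: "0 < \<psi> x \<longleftrightarrow> x \<in> (\<Union>c\<in>F. ball c \<rho>)" for x
  proof
    assume "0 < \<psi> x"
    then obtain c where "c \<in> F" "b c x \<noteq> 0" unfolding \<psi>_def by (metis less_irrefl sum.neutral)
    then show "x \<in> (\<Union>c\<in>F. ball c \<rho>)" using b0[of c x] bp[of c x] by auto
  next
    assume "x \<in> (\<Union>c\<in>F. ball c \<rho>)"
    then obtain c where c: "c \<in> F" "x \<in> ball c \<rho>" by auto
    then have "0 < b c x" using bp by simp
    also have "\<dots> \<le> \<psi> x" unfolding \<psi>_def using c F b0 by (intro member_le_sum) auto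
    finally show "0 < \<psi> x" .
  qed
  have 4: "compact (\<Union>c\<in>F. cball c \<rho>)" using F by (intro compact_UN) auto
  have 5: "(\<Union>c\<in>F. cball c \<rho>) \<subseteq> \<Omega>" using sub by auto
  show thesis by (rule that[OF 1 2 3 4 5])
qed

text \<open>The set where \<open>f > 0\<close> contains a compact set of positive measure; the indicator of that set is
  approximated by indicators of finite unions of balls, and these by test functions.\<close>

lemma ex_test_function_pos:
  assumes f [measurable]: "f \<in> borel_measurable M" and fi: "integrable M f"
    and pos: "\<not> (AE x in M. max (f x) 0 = 0)" and q: "0 < q"
  shows "\<exists>\<phi>\<in>T. 0 < (\<integral>x. f x * \<bar>\<phi> x\<bar> powr q \<partial>M)"
proof -
  define A where "A = {x \<in> space M. 0 < f x}"
  have AM: "A \<in> sets M" unfolding A_def by measurable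
  then have A: "A \<in> sets lebesgue" "A \<subseteq> \<Omega>" using \<Omega>_lebesgue by (auto simp: sets_restrict_space A_def)
  have "A \<notin> null_sets M"
  proof
    assume "A \<in> null_sets M"
    then have "AE x in M. max (f x) 0 = 0" by (rule AE_I') (auto simp: A_def max_def)
    then show False using pos by simp
  qed
  then have "A \<notin> null_sets lebesgue" using A null_sets_restrict_space[OF \<Omega>_lebesgue] by blast
  then have eA: "0 < emeasure lebesgue A" using A by (simp add: null_sets_def zero_less_iff_neq_zero)
  have "emeasure lebesgue A \<le> emeasure lebesgue \<Omega>" using A \<Omega>_lebesgue by (intro emeasure_mono)
  also have "\<dots> < \<infinity>" using finite_M(1) \<Omega>_lebesgue by (simp add: emeasure_restrict_space)
  finally have fA: "emeasure lebesgue A < \<infinity>" .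
  define m where "m = measure lebesgue A"
  have mA: "emeasure lebesgue A = ennreal m" using fA by (simp add: m_def emeasure_eq_ennreal_measure less_top)
  then have m: "0 < m" using eA by simp
  \<comment> \<open>Inner regularity with an error below the measure of \<open>A\<close>, so that
    \<open>K\<close> cannot be a null set.\<close>
  obtain K where K: "closed K" "K \<subseteq> A" "A - K \<in> lmeasurable" "emeasure lebesgue (A - K) < ennreal m"
    using sets_lebesgue_inner_closed[OF A(1) m] by blast
  have Ks: "K \<in> sets lebesgue" using K(1) by (simp add: borel_closed)
  have "bounded K" using K(2) A(2) \<Omega>(2) by (meson bounded_subset subset_trans)
  then have Kc: "compact K" using K(1) by (simp add: compact_eq_bounded_closed)
  have KM: "K \<in> sets M" using Ks K(2) A(2) \<Omega>_lebesgue by (auto simp: sets_restrict_space_iff)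
  have iK: "integrable M (\<lambda>x. indicator K x * f x)" using integrable_mult_indicator[OF KM fi] by simp
  have "0 < (\<integral>x. indicator K x * f x \<partial>M)"
  proof (rule ccontr)
    assume "\<not> ?thesis"
    moreover have nn: "0 \<le> indicator K x * f x" for x
      using K(2) by (auto simp: indicator_def A_def intro: less_imp_le)
    then have "0 \<le> (\<integral>x. indicator K x * f x \<partial>M)" by (intro integral_nonneg_AE) simp
    ultimately have "(\<integral>x. indicator K x * f x \<partial>M) = 0" by simp
    then have "AE x in M. indicator K x * f x = 0"
      using integral_nonneg_eq_0_iff_AE[OF iK] nn by auto
    then have "AE x in M. x \<notin> K"
      by eventually_elim (use K(2) in \<open>auto simp: A_def indicator_def split: if_splits\<close>)
    then have "K \<in> null_sets M" using KM by (subst AE_iff_null_sets) auto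
    then have "K \<in> null_sets lebesgue" using null_sets_restrict_space[OF \<Omega>_lebesgue] by blast
    then have "emeasure lebesgue (A - K) = emeasure lebesgue A" using A by (intro emeasure_Diff_null_set)
    then show False using K(4) mA by simp
  qed
  note Kpos = this
  obtain \<delta> where \<delta>: "0 < \<delta>" "(\<Union>x\<in>K. cball x \<delta>) \<subseteq> \<Omega>"
    using compact_subset_open_imp_cball_epsilon_subset[OF Kc \<Omega>(1)] K(2) A(2) by blast
  define \<rho> where "\<rho> j = \<delta> / real (Suc j)" for j
  have \<rho>: "0 < \<rho> j" "\<rho> j \<le> \<delta>" for j using \<delta> by (auto simp: \<rho>_def field_simps)
  have "\<forall>j. \<exists>F. finite F \<and> F \<subseteq> K \<and> K \<subseteq> (\<Union>c\<in>F. ball c (\<rho> j))"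
  proof
    fix j
    have cov: "K \<subseteq> (\<Union>c\<in>K. ball c (\<rho> j))" using \<rho>(1)[of j] by force
    obtain F where "F \<subseteq> K" "finite F" "K \<subseteq> (\<Union>c\<in>F. ball c (\<rho> j))"
      by (rule compactE_image[OF Kc _ cov]) auto
    then show "\<exists>F. finite F \<and> F \<subseteq> K \<and> K \<subseteq> (\<Union>c\<in>F. ball c (\<rho> j))" by blast
  qed
  then obtain F where F: "\<And>j. finite (F j)" "\<And>j. F j \<subseteq> K" "\<And>j. K \<subseteq> (\<Union>c\<in>F j. ball c (\<rho> j))" by metis
  define W where "W j = (\<Union>c\<in>F j. ball c (\<rho> j))" for j
  have Wsub: "cball c (\<rho> j) \<subseteq> \<Omega>" if "c \<in> F j" for c j
    using that F(2)[of j] \<delta>(2) subset_cball[OF \<rho>(2)[of j], of c] by blast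
  have W\<Omega>: "W j \<subseteq> \<Omega>" for j using Wsub ball_subset_cball unfolding W_def by blast
  have "W j \<in> sets lebesgue" for j
  proof -
    have "open (W j)" unfolding W_def by auto
    then show ?thesis by (simp add: borel_open)
  qed
  then have WM: "W j \<in> sets M" for j using W\<Omega> \<Omega>_lebesgue by (auto simp: sets_restrict_space_iff)
  \<comment> \<open>A point outside the closed set \<open>K\<close> has positive distance from it
    and leaves \<open>W j\<close> once \<open>\<rho> j\<close> is smaller than this distance, as all
    centres lie in \<open>K\<close>.\<close>
  have "(\<lambda>j. \<integral>x. indicator (W j) x * f x \<partial>M) \<longlonglongrightarrow> (\<integral>x. indicator K x * f x \<partial>M)"
  proof (rule integral_dominated_convergence[where w="\<lambda>x. \<bar>f x\<bar>"])
    show "AE x in M. (\<lambda>j. indicator (W j) x * f x) \<longlonglongrightarrow> indicator K x * f x"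
    proof (rule AE_I2)
      fix x
      have "eventually (\<lambda>j. indicator (W j) x * f x = indicator K x * f x) sequentially"
      proof (cases "x \<in> K")
        case True
        then have "x \<in> W j" for j using F(3) unfolding W_def by blast
        then show ?thesis using True by simp
      next
        case False
        have "open (- K)" using K(1) by (simp add: open_Compl)
        then obtain e where e: "0 < e" "ball x e \<subseteq> - K" using False open_contains_ball[of "- K"] by blast
        have "\<rho> \<longlonglongrightarrow> \<delta> * 0"
          unfolding \<rho>_def using tendsto_mult[OF tendsto_const LIMSEQ_inverse_real_of_nat, of \<delta>] by (simp add: divide_inverse)
        then have "eventually (\<lambda>j. \<rho> j < e) sequentially" using e(1) by (intro order_tendstoD(2)) auto
        then show ?thesis
        proof eventually_elim
          case (elim j)
          have "x \<notin> W j"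
          proof
            assume "x \<in> W j"
            then obtain c where c: "c \<in> F j" "dist c x < \<rho> j" unfolding W_def by auto
            then have "c \<in> ball x e" using elim by (simp add: dist_commute)
            then show False using e(2) c(1) F(2) by blast
          qed
          then show ?case using False by simp
        qed
      qed
      then show "(\<lambda>j. indicator (W j) x * f x) \<longlonglongrightarrow> indicator K x * f x"
        by (rule tendsto_eventually)
    qed
    show "AE x in M. norm (indicator (W j) x * f x) \<le> \<bar>f x\<bar>" for j
      by (rule AE_I2) (auto simp: indicator_def)
    show "(\<lambda>x. indicator (W j) x * f x) \<in> borel_measurable M" for j
      using WM[of j] by measurable
    show "(\<lambda>x. indicator K x * f x) \<in> borel_measurable M" using iK by auto
  qed (use fi in auto)
  then have "eventually (\<lambda>j. 0 < (\<integral>x. indicator (W j) x * f x \<partial>M)) sequentially"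
    by (rule order_tendstoD(1)) (rule Kpos)
  then obtain j where j: "0 < (\<integral>x. indicator (W j) x * f x \<partial>M)"
    using eventually_happens'[OF sequentially_bot] by blast
  obtain \<psi> :: "real ^ 'n \<Rightarrow> real" where \<psi>: "smooth_on UNIV \<psi>" "\<And>x. 0 \<le> \<psi> x"
      "\<And>x. 0 < \<psi> x \<longleftrightarrow> x \<in> (\<Union>c\<in>F j. ball c (\<rho> j))"
      "compact (\<Union>c\<in>F j. cball c (\<rho> j))" "(\<Union>c\<in>F j. cball c (\<rho> j)) \<subseteq> \<Omega>"
  proof (rule test_function_positive_on_balls[OF F(1)[of j] \<rho>(1)[of j]])
    show "cball c (\<rho> j) \<subseteq> \<Omega>" if "c \<in> F j" for c by (rule Wsub[OF that])
  qed (rule that; assumption)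
  note \<psi>(3)[folded W_def]
  note \<psi> = \<psi>(1,2) this \<psi>(4,5)
  \<comment> \<open>With growing \<open>k\<close> the bump tends to 1 where \<open>\<psi>\<close> is
    positive and is 0 elsewhere: test functions with values in [0, 1] that converge to the indicator
    of \<open>W j\<close>.\<close>
  define \<phi> where "\<phi> k x = bump_fun 1 (real (Suc k) * \<psi> x)" for k x
  have \<phi>T: "\<phi> k \<in> T" for k
  proof (rule test_functionsI[OF _ \<psi>(4,5)])
    show "smooth_on UNIV (\<phi> k)" unfolding \<phi>_def by (intro smooth_on_bump_fun smooth_on_mult smooth_on_const \<psi>)
    fix x assume "x \<notin> (\<Union>c\<in>F j. cball c (\<rho> j))"
    then have "x \<notin> W j" unfolding W_def using ball_subset_cball by blast
    then have "\<psi> x = 0" using \<psi>(2,3)[of x] by auto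
    then show "\<phi> k x = 0" by (simp add: \<phi>_def bump_fun_one)
  qed
  have \<phi>01: "0 \<le> \<phi> k x" "\<phi> k x \<le> 1" for k x
  proof -
    have "0 < real (Suc k)" by simp
    then show "0 \<le> \<phi> k x" "\<phi> k x \<le> 1"
      using \<psi>(2)[of x] unfolding \<phi>_def bump_fun_one by (auto simp del: of_nat_Suc)
  qed
  have \<phi>m: "\<phi> k \<in> borel_measurable M" for k using X0D(2)[OF T_subset_X0[OF \<phi>T]] .
  have "(\<lambda>k. \<integral>x. f x * \<bar>\<phi> k x\<bar> powr q \<partial>M) \<longlonglongrightarrow> (\<integral>x. indicator (W j) x * f x \<partial>M)"
  proof (rule integral_dominated_convergence[where w="\<lambda>x. \<bar>f x\<bar>"])
    show "AE x in M. (\<lambda>k. f x * \<bar>\<phi> k x\<bar> powr q) \<longlonglongrightarrow> indicator (W j) x * f x"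
    proof (rule AE_I2)
      fix x
      show "(\<lambda>k. f x * \<bar>\<phi> k x\<bar> powr q) \<longlonglongrightarrow> indicator (W j) x * f x"
      proof (cases "x \<in> W j")
        case True
        then have p: "0 < \<psi> x" using \<psi>(3) by simp
        have "\<phi> k x = exp (- (inverse (real (Suc k)) * inverse (\<psi> x)))" for k
        proof -
          have "\<not> real (Suc k) * \<psi> x \<le> 0" using p mult_pos_pos[of "real (Suc k)" "\<psi> x"] by linarith
          then show ?thesis by (simp add: \<phi>_def bump_fun_one divide_inverse del: of_nat_Suc)
        qed
        moreover have "(\<lambda>k. exp (- (inverse (real (Suc k)) * inverse (\<psi> x)))) \<longlonglongrightarrow> exp (- (0 * inverse (\<psi> x)))"
          by (intro tendsto_intros LIMSEQ_inverse_real_of_nat)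
        ultimately have "(\<lambda>k. \<phi> k x) \<longlonglongrightarrow> 1" by simp
        from tendsto_mult[OF tendsto_const abs_powr_tendsto[OF q this], of "f x"] show ?thesis using True by simp
      next
        case False
        then have "\<psi> x = 0" using \<psi>(2,3)[of x] by auto
        then have "\<phi> k x = 0" for k by (simp add: \<phi>_def bump_fun_one)
        then show ?thesis using False by simp
      qed
    qed
    show "AE x in M. norm (f x * \<bar>\<phi> k x\<bar> powr q) \<le> \<bar>f x\<bar>" for k
    proof (rule AE_I2)
      fix x
      have "\<bar>\<phi> k x\<bar> powr q \<le> 1 powr q" using \<phi>01 q by (intro powr_mono2) auto
      then have "\<bar>f x\<bar> * \<bar>\<phi> k x\<bar> powr q \<le> \<bar>f x\<bar> * 1" by (intro mult_left_mono) auto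
      then show "norm (f x * \<bar>\<phi> k x\<bar> powr q) \<le> \<bar>f x\<bar>" by (simp add: abs_mult)
    qed
    show "(\<lambda>x. f x * \<bar>\<phi> k x\<bar> powr q) \<in> borel_measurable M" for k using \<phi>m[of k] by measurable
    show "(\<lambda>x. indicator (W j) x * f x) \<in> borel_measurable M" using WM[of j] by measurable
  qed (use fi in auto)
  then have "eventually (\<lambda>k. 0 < (\<integral>x. f x * \<bar>\<phi> k x\<bar> powr q \<partial>M)) sequentially"
    by (rule order_tendstoD(1)) (rule j)
  then obtain k where "0 < (\<integral>x. f x * \<bar>\<phi> k x\<bar> powr q \<partial>M)"
    using eventually_happens'[OF sequentially_bot] by blast
  then show ?thesis using \<phi>T by blast
qed

end

section \<open>The weak solution\<close>

context fractional_setting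
begin

text \<open>Outside \<open>Qset \<Omega>\<close> both points lie outside \<open>\<Omega>\<close>,
  where \<open>u\<close> vanishes almost everywhere, so the form loses nothing by restriction. The
  exponent n / p + s occurs \<open>p - 2\<close> times in the modulus and twice more in the other
  factors, which adds up to n + p s.\<close>

lemma fracp_form_eq:
  assumes u: "u \<in> X0" and \<phi>: "\<phi> \<in> X0"
  shows "fracp_form s p u \<phi> = (\<integral>z. spow p (D u z) * D \<phi> z \<partial>N)"
proof -
  let ?\<beta> = "real CARD('n) + p * s" and ?\<gamma> = "real CARD('n) / p + s"
  define F where "F z = spow p (u (fst z) - u (snd z)) * (\<phi> (fst z) - \<phi> (snd z)) / norm (fst z - snd z) powr ?\<beta>" for z
  have DF: "spow p (D u z) * D \<phi> z = F z" for z
  proof (cases "norm (fst z - snd z) = 0")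
    case True
    then show ?thesis by (simp add: D_def F_def)
  next
    case False
    define \<nu> where "\<nu> = norm (fst z - snd z)"
    have \<nu>: "0 < \<nu>" using False by (simp add: \<nu>_def)
    have "(\<nu> powr c) powr (p - 2) * (\<nu> powr c * \<nu> powr c) = \<nu> powr (c * (p - 2) + (c + c))" for c
      by (simp only: powr_powr powr_add)
    note this[of ?\<gamma>]
    also have "?\<gamma> * (p - 2) + (?\<gamma> + ?\<gamma>) = ?\<beta>" using p by (simp add: field_simps)
    finally have e: "(\<nu> powr ?\<gamma>) powr (p - 2) * (\<nu> powr ?\<gamma> * \<nu> powr ?\<gamma>) = \<nu> powr ?\<beta>" .
    have "spow p (D u z) * D \<phi> z = \<bar>u (fst z) - u (snd z)\<bar> powr (p - 2) * (u (fst z) - u (snd z)) * (\<phi> (fst z) - \<phi> (snd z))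
        / ((\<nu> powr ?\<gamma>) powr (p - 2) * (\<nu> powr ?\<gamma> * \<nu> powr ?\<gamma>))"
      by (simp add: spow_def D_def \<nu>_def[symmetric] abs_divide powr_divide)
    then show ?thesis unfolding e by (simp add: F_def spow_def \<nu>_def)
  qed
  have m: "(\<lambda>z. spow p (D u z) * D \<phi> z) \<in> borel_measurable N"
    using X0D(3)[OF u] X0D(3)[OF \<phi>] unfolding spow_def by measurable
  have "AE z in lebesgue. (fst z \<notin> \<Omega> \<longrightarrow> u (fst z) = 0) \<and> (snd z \<notin> \<Omega> \<longrightarrow> u (snd z) = 0)"
    using AE_lebesgue_pair[OF X0_approx(1)[OF u]] by simp
  then have ae: "AE z in lebesgue. indicator (Qset \<Omega>) z *\<^sub>R F z = F z"
  proof eventually_elim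
    case (elim z)
    show ?case
    proof (cases "z \<in> Qset \<Omega>")
      case False
      then have "fst z \<notin> \<Omega>" "snd z \<notin> \<Omega>" by (cases z; auto simp: Qset_def)+
      then show ?thesis using elim by (simp add: F_def spow_def)
    qed simp
  qed
  have "(\<lambda>z. indicator (Qset \<Omega>) z *\<^sub>R F z) \<in> borel_measurable lebesgue"
    using m Q_lebesgue unfolding DF by (subst (asm) borel_measurable_restrict_space_iff) auto
  moreover from this ae have "F \<in> borel_measurable lebesgue"
    by (rule borel_measurable_AE)
  ultimately have "(\<integral>z. indicator (Qset \<Omega>) z *\<^sub>R F z \<partial>lebesgue) = (\<integral>z. F z \<partial>lebesgue)"
    by (intro integral_cong_AE ae)
  moreover have "fracp_form s p u \<phi> = (\<integral>z. F z \<partial>lebesgue)"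
    unfolding fracp_form_def F_def by (simp add: case_prod_unfold)
  moreover have "(\<integral>z. F z \<partial>N) = (\<integral>z. indicator (Qset \<Omega>) z *\<^sub>R F z \<partial>lebesgue)"
    using Q_lebesgue by (intro integral_restrict_space) auto
  ultimately show ?thesis by (simp add: DF)
qed

end

theorem theorem1p5:
  fixes \<Omega> :: "(real ^ 'n) set"
    and f :: "real ^ 'n \<Rightarrow> real"
    and s p q r a b :: real
  assumes "0 < s" "s < 1"
    and "2 \<le> p"
    and "p * s < real CARD('n)" "real CARD('n) < 2 * p * s"
    and "1 < q" "q < p"
    and "r = crit_exponent (real CARD('n)) s p"
    and "smooth_bounded_domain \<Omega>"
    and "0 < a" "0 < b"
    and "f \<in> Lspace_on (r / (r - q)) \<Omega>"
    and "\<not> (AE x in lebesgue_on \<Omega>. max (f x) 0 = 0)"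
  shows "\<exists>\<mu>\<^sub>0\<^sub>0>0. \<forall>\<mu>. 0 < \<mu> \<and> \<mu> < \<mu>\<^sub>0\<^sub>0 \<longrightarrow>
           (\<exists>u. weak_solution s p q \<Omega> (\<lambda>t. a + b * t) f \<mu> u)"
proof -
  interpret fractional_setting \<Omega> s p r
    using assms by unfold_locales (auto simp: smooth_bounded_domain_def)
  have f: "f \<in> borel_measurable M" "integrable M (\<lambda>x. \<bar>f x\<bar> powr (r / (r - q)))"
    using assms(12) by (auto simp: Lspace_on_def)
  have "integrable M (\<lambda>x. 1 + \<bar>f x\<bar> powr (r / (r - q)))"
    using f(2) finite_measure.integrable_const[OF finite_M(2), of "1::real"]
    by (intro Bochner_Integration.integrable_add) auto
  \<comment> \<open>On a set of finite measure \<open>1 + \<bar>f x\<bar> powr (r / (r - q))\<close>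
    is an integrable majorant of \<open>f\<close>; \<open>ex_test_function_pos\<close> requires this
    integrability.\<close>
  then have fi: "integrable M f"
  proof (rule Bochner_Integration.integrable_bound[OF _ f(1)], intro AE_I2)
    fix x
    have e: "1 \<le> r / (r - q)" using r_gt assms(6,7) by (simp add: field_simps)
    show "norm (f x) \<le> norm (1 + \<bar>f x\<bar> powr (r / (r - q)))"
    proof (cases "\<bar>f x\<bar> \<le> 1")
      case False
      then have "\<bar>f x\<bar> powr 1 \<le> \<bar>f x\<bar> powr (r / (r - q))" using e by (intro powr_mono) auto
      then show ?thesis by simp
    qed (smt (verit) powr_ge_zero real_norm_def)
  qed
  \<comment> \<open>The abstract result is applied with Lebesgue measure on \<open>\<Omega>\<close>
    and on \<open>Qset \<Omega>\<close>. Its positivity condition on \<open>f\<close> is met by a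
    test function, which lies in \<open>X0\<close>.\<close>
  interpret crit: critical_kirchhoff M N D X0 f p q r sobolev_const a b
  proof
    show "\<bar>D (\<lambda>x. \<bar>u x\<bar>) z\<bar> \<le> \<bar>D u z\<bar>" for u z by (rule D_contraction) (rule abs_triangle_ineq3)
    show "\<exists>\<sigma> v. strict_mono \<sigma> \<and> v \<in> X0 \<and> (AE x in M. (\<lambda>k. u (\<sigma> k) x) \<longlonglongrightarrow> v x) \<and>
        (AE z in N. (\<lambda>k. D (u (\<sigma> k)) z) \<longlonglongrightarrow> D v z)"
      if "\<And>k. u k \<in> X0" "\<And>k. (\<integral>z. \<bar>D (u k) z\<bar> powr p \<partial>N) \<le> K" for u :: "nat \<Rightarrow> real ^ 'n \<Rightarrow> real" and K
      using X0_compact[of u K] that by (simp add: E_def)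
    show "\<exists>\<phi>\<in>X0. 0 < (\<integral>x. f x * \<bar>\<phi> x\<bar> powr q \<partial>M)"
      using ex_test_function_pos[OF f(1) fi assms(13), of q] assms(6) T_subset_X0 by auto
    show "(\<integral>x. \<bar>u x\<bar> powr r \<partial>M) \<le> sobolev_const * (\<integral>z. \<bar>D u z\<bar> powr p \<partial>N) powr (r / p)" if "u \<in> X0" for u
      using sobolev_const(3)[OF that] by (simp add: E_def)
  qed (use assms r_gt sobolev_const X0D X0_lin D_lin X0_abs f in auto)
  obtain \<mu>0 where \<mu>0: "0 < \<mu>0" "\<And>\<mu>. 0 < \<mu> \<Longrightarrow> \<mu> < \<mu>0 \<Longrightarrow>
    \<exists>u\<in>X0. (\<forall>x. 0 \<le> u x) \<and> \<not> (AE x in M. u x = 0) \<and>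
      (\<forall>\<phi>\<in>X0. (a + b * (\<integral>z. \<bar>D u z\<bar> powr p \<partial>N)) * (\<integral>z. spow p (D u z) * D \<phi> z \<partial>N) =
        \<mu> * (\<integral>x. f x * (spow q (u x) * \<phi> x) \<partial>M) + (\<integral>x. spow r (u x) * \<phi> x \<partial>M))"
    using crit.ex_nonneg_critical_point by blast
  show ?thesis
  proof (intro exI[of _ \<mu>0] conjI allI impI \<mu>0(1))
    fix \<mu> assume \<mu>: "0 < \<mu> \<and> \<mu> < \<mu>0"
    obtain u where u: "u \<in> X0" "\<And>x. 0 \<le> u x" "\<not> (AE x in M. u x = 0)"
      "\<And>\<phi>. \<phi> \<in> X0 \<Longrightarrow> (a + b * (\<integral>z. \<bar>D u z\<bar> powr p \<partial>N)) * (\<integral>z. spow p (D u z) * D \<phi> z \<partial>N) =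
        \<mu> * (\<integral>x. f x * (spow q (u x) * \<phi> x) \<partial>M) + (\<integral>x. spow r (u x) * \<phi> x \<partial>M)"
      using \<mu>0(2)[of \<mu>] \<mu> by blast
    \<comment> \<open>The energy is nonnegative, so the p-th power undoes the root and the argument
      of \<open>M\<close> is the energy itself.\<close>
    have "X0norm s p \<Omega> u powr p = (\<integral>z. \<bar>D u z\<bar> powr p \<partial>N)"
      using p by (simp add: X0norm_def Qenergy_eq powr_powr E_def integral_nonneg_AE)
    then have "weak_solution s p q \<Omega> (\<lambda>t. a + b * t) f \<mu> u"
      using u by (simp add: weak_solution_def fracp_form_eq mult.assoc r[symmetric])
    then show "\<exists>u. weak_solution s p q \<Omega> (\<lambda>t. a + b * t) f \<mu> u" by blast
  qed
qed

end
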